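(* Let $m,n\ge1$ with $\max\{m,n\}>1$, let $G=\mathrm{Sp}(2m)\times\mathrm{Sp}(2n)$, and let $H=\mathrm{Sp}(2m-2)\times\mathrm{SL}(2)\times\mathrm{Sp}(2n-2)\subseteq G$, where $\mathrm{SL}(2)=\mathrm{Sp}(2)$ is embedded diagonally in the product of the second factors of $\mathrm{Sp}(2m-2)\times\mathrm{Sp}(2)\subseteq\mathrm{Sp}(2m)$ and $\mathrm{Sp}(2n-2)\times\mathrm{Sp}(2)\subseteq\mathrm{Sp}(2n)$. Let $\beta_1'$ be the simple root of the factor $\mathrm{SL}(2)$ of $H$, $\varpi_1'$ the corresponding fundamental weight, and let $P$ be the parabolic subgroup of $H$ corresponding to $I=\{\beta_1'\}$. Then the extended weight monoid $\widetilde\Gamma(G/P)$ is freely generated by $$(\omega_1+\omega_1',0),\quad(\omega_1,-\varpi_1'),\quad(\omega_1',-\varpi_1'),$$ together with $(\omega_2,0)$ if $m>1$, and together with $(\omega_2',0)$ if $n>1$.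
   Context: Groups are over $\mathbb C$. Fix $T\subseteq B\subseteq G$ a maximal torus and Borel subgroup, and $T_H\subseteq B_H\subseteq H$ likewise, with $T_H\subseteq T$ and $B_H\subseteq B$; $B_H^-$ is the Borel subgroup of $H$ opposite to $B_H$. $\omega_1,\omega_2,\dots$ and $\omega'_1,\omega'_2,\dots$ are the fundamental dominant weights of the factors $\mathrm{Sp}(2m)$ and $\mathrm{Sp}(2n)$ of $G$ respectively (Bourbaki numbering). For a set $I$ of simple roots of $H$, the corresponding parabolic subgroup $P$ of $H$ contains $B_H^-$, and its Levi subgroup containing $T_H$ has as simple roots all simple roots of $H$ not in $I$. Characters of $P$ are identified with their restrictions to $T_H$. The extended weight monoid $\widetilde\Gamma(G/P)$ is the set of pairs $(\omega,\chi)$, with $\omega$ a character of $B$ (equivalently of $T$) and $\chi$ a character of $P$, for which there is a non-zero $f\in\mathbb C[G]$ with $f(b^{-1}gp)=\omega(b)f(g)\chi(p)$ for all $b\in B$, $g\in G$, $p\in P$. *)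

theory Defs
  imports "Jordan_Normal_Form.Matrix" "HOL-Algebra.Coset"
begin

section \<open>Symplectic groups\<close>

text \<open>The symplectic form on \<open>\<complex>\<^sup>2\<^sup>k\<close> is the orthogonal sum of \<open>k\<close> standard hyperbolic planes,
  with symplectic basis \<open>(e 0, e 1), (e 2, e 3), \<dots>\<close> (indices start at 0).  With this choice
  \<open>Sp(2k - 2) \<times> Sp(2) \<subseteq> Sp(2k)\<close> is literally the group of block diagonal matrices.\<close>

type_synonym cmat = "complex mat"

definition symp_form :: "nat \<Rightarrow> cmat" where
  "symp_form k = mat (2*k) (2*k) (\<lambda>(i,j).
     if even i \<and> j = Suc i then 1 else if odd i \<and> i = Suc j then -1 else 0)"

text \<open>\<open>Sp k\<close> is the group of rank \<open>k\<close>, usually written \<open>Sp(2k)\<close>.\<close>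

definition Sp :: "nat \<Rightarrow> cmat monoid" where
  "Sp k = \<lparr> carrier = {A \<in> carrier_mat (2*k) (2*k).
                        transpose_mat A * symp_form k * A = symp_form k},
            mult = (*), one = 1\<^sub>m (2*k) \<rparr>"

definition Sp_torus :: "nat \<Rightarrow> cmat set" where
  "Sp_torus k = {A \<in> carrier (Sp k). diagonal_mat A}"

text \<open>The Borel subgroup stabilizing the complete isotropic flag
  \<open>\<langle>e 0\<rangle> \<subset> \<langle>e 0, e 2\<rangle> \<subset> \<dots> \<subset> \<langle>e 0, e 2, \<dots>, e (2k - 2)\<rangle>\<close>, and the opposite one, stabilizing
  \<open>\<langle>e 1\<rangle> \<subset> \<langle>e 1, e 3\<rangle> \<subset> \<dots> \<subset> \<langle>e 1, e 3, \<dots>, e (2k - 1)\<rangle>\<close>.\<close>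

definition Sp_borel :: "nat \<Rightarrow> cmat set" where
  "Sp_borel k = {A \<in> carrier (Sp k).
     \<forall>i<2*k. \<forall>j<k. A $$ (i, 2*j) \<noteq> 0 \<longrightarrow> even i \<and> i \<le> 2*j}"

definition Sp_borel_opp :: "nat \<Rightarrow> cmat set" where
  "Sp_borel_opp k = {A \<in> carrier (Sp k).
     \<forall>i<2*k. \<forall>j<k. A $$ (i, 2*j+1) \<noteq> 0 \<longrightarrow> odd i \<and> i \<le> 2*j+1}"

text \<open>Simple roots and fundamental weights of type C as in Bourbaki, where the coordinate
  \<open>\<epsilon>\<^sub>j\<^sub>+\<^sub>1\<close> of a diagonal matrix \<open>A\<close> in \<open>Sp(2k)\<close> is \<open>A $$ (2j, 2j)\<close>.
  The simple roots are \<open>\<alpha>\<^sub>i = \<epsilon>\<^sub>i - \<epsilon>\<^sub>i\<^sub>+\<^sub>1\<close> for \<open>i < k\<close> and \<open>\<alpha>\<^sub>k = 2\<epsilon>\<^sub>k\<close>; the fundamental weights are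
  \<open>\<omega>\<^sub>i = \<epsilon>\<^sub>1 + \<dots> + \<epsilon>\<^sub>i\<close>.  Characters are functions with values in the multiplicative group,
  so sums of weights appear as products.\<close>

definition C_eps :: "nat \<Rightarrow> cmat \<Rightarrow> complex" where
  "C_eps i A = A $$ (2*(i-1), 2*(i-1))"

definition C_simple_root :: "nat \<Rightarrow> nat \<Rightarrow> cmat \<Rightarrow> complex" where
  "C_simple_root k i A = (if i < k then C_eps i A / C_eps (Suc i) A else (C_eps i A)^2)"

definition C_fund_weight :: "nat \<Rightarrow> cmat \<Rightarrow> complex" where
  "C_fund_weight i A = (\<Prod>j=1..i. C_eps j A)"


section \<open>The groups G and H\<close>

definition grpG :: "nat \<Rightarrow> nat \<Rightarrow> (cmat \<times> cmat) monoid" where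
  "grpG m n = Sp m \<times>\<times> Sp n"

definition diag2 :: "cmat \<Rightarrow> cmat \<Rightarrow> cmat" where
  "diag2 A S = four_block_mat A (0\<^sub>m (dim_row A) (dim_col S)) (0\<^sub>m (dim_row S) (dim_col A)) S"

definition embH :: "cmat \<times> cmat \<times> cmat \<Rightarrow> cmat \<times> cmat" where
  "embH = (\<lambda>(A, S, D). (diag2 A S, diag2 D S))"

definition setH :: "nat \<Rightarrow> nat \<Rightarrow> (cmat \<times> cmat) set" where
  "setH m n = embH ` (carrier (Sp (m-1)) \<times> carrier (Sp 1) \<times> carrier (Sp (n-1)))"


section \<open>Regular functions and characters\<close>

text \<open>Polynomials in the entries of a pair of matrices.  The index bounds matter: entries outside
  the dimensions of a matrix are unspecified.\<close>

inductive_set poly_fun :: "nat \<Rightarrow> nat \<Rightarrow> (cmat \<times> cmat \<Rightarrow> complex) set" for m n where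
  const: "(\<lambda>x. c) \<in> poly_fun m n"
| entry1: "i < 2*m \<Longrightarrow> j < 2*m \<Longrightarrow> (\<lambda>x. fst x $$ (i,j)) \<in> poly_fun m n"
| entry2: "i < 2*n \<Longrightarrow> j < 2*n \<Longrightarrow> (\<lambda>x. snd x $$ (i,j)) \<in> poly_fun m n"
| add: "p \<in> poly_fun m n \<Longrightarrow> q \<in> poly_fun m n \<Longrightarrow> (\<lambda>x. p x + q x) \<in> poly_fun m n"
| mult: "p \<in> poly_fun m n \<Longrightarrow> q \<in> poly_fun m n \<Longrightarrow> (\<lambda>x. p x * q x) \<in> poly_fun m n"

text \<open>The algebra \<open>\<complex>[K]\<close> of regular functions on a closed subgroup \<open>K\<close> of \<open>G\<close>.  As
  \<open>G\<close> is closed in the space of pairs of matrices, no denominators are needed.\<close>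

definition regular_functions ::
  "nat \<Rightarrow> nat \<Rightarrow> (cmat \<times> cmat) set \<Rightarrow> (cmat \<times> cmat \<Rightarrow> complex) set" where
  "regular_functions m n K = {restrict p K | p. p \<in> poly_fun m n}"

definition characters ::
  "nat \<Rightarrow> nat \<Rightarrow> (cmat \<times> cmat) set \<Rightarrow> (cmat \<times> cmat \<Rightarrow> complex) set" where
  "characters m n K = {\<chi> \<in> regular_functions m n K.
     (\<forall>x\<in>K. \<chi> x \<noteq> 0) \<and>
     (\<forall>x\<in>K. \<forall>y\<in>K. \<chi> (x \<otimes>\<^bsub>grpG m n\<^esub> y) = \<chi> x * \<chi> y)}"

definition char_group ::
  "nat \<Rightarrow> nat \<Rightarrow> (cmat \<times> cmat) set \<Rightarrow> (cmat \<times> cmat \<Rightarrow> complex) monoid" where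
  "char_group m n K = \<lparr> carrier = characters m n K,
     mult = (\<lambda>\<chi> \<psi>. \<lambda>x\<in>K. \<chi> x * \<psi> x), one = (\<lambda>x\<in>K. 1) \<rparr>"


section \<open>Borel pairs\<close>

definition conj_set :: "('a, 'b) monoid_scheme \<Rightarrow> 'a \<Rightarrow> 'a set \<Rightarrow> 'a set" where
  "conj_set G g S = (\<lambda>x. g \<otimes>\<^bsub>G\<^esub> x \<otimes>\<^bsub>G\<^esub> inv\<^bsub>G\<^esub> g) ` S"

text \<open>By Borel's conjugacy theorems every pair of a Borel subgroup and a maximal torus in it is
  conjugate to the standard one.  So, with \<open>g\<close> ranging over \<open>G\<close>, the following describes all
  pairs \<open>T \<subseteq> B\<close>.  The element \<open>g\<close> is unique up to right multiplication by the standard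
  torus, hence transporting characters along \<open>g\<close> does not depend on its choice.\<close>

definition borel_pair_G ::
  "nat \<Rightarrow> nat \<Rightarrow> cmat \<times> cmat \<Rightarrow> (cmat \<times> cmat) set \<Rightarrow> (cmat \<times> cmat) set \<Rightarrow> bool" where
  "borel_pair_G m n g T B \<longleftrightarrow> g \<in> carrier (grpG m n) \<and>
     T = conj_set (grpG m n) g (Sp_torus m \<times> Sp_torus n) \<and>
     B = conj_set (grpG m n) g (Sp_borel m \<times> Sp_borel n)"

text \<open>The same for \<open>H\<close>, with in addition the Borel subgroup opposite to \<open>BH\<close> with respect
  to \<open>TH\<close>.\<close>

definition borel_triple_H ::
  "nat \<Rightarrow> nat \<Rightarrow> cmat \<times> cmat \<Rightarrow> (cmat \<times> cmat) set \<Rightarrow> (cmat \<times> cmat) set \<Rightarrow> (cmat \<times> cmat) set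
     \<Rightarrow> bool" where
  "borel_triple_H m n h TH BH BHm \<longleftrightarrow> h \<in> setH m n \<and>
     TH = conj_set (grpG m n) h (embH ` (Sp_torus (m-1) \<times> Sp_torus 1 \<times> Sp_torus (n-1))) \<and>
     BH = conj_set (grpG m n) h (embH ` (Sp_borel (m-1) \<times> Sp_borel 1 \<times> Sp_borel (n-1))) \<and>
     BHm = conj_set (grpG m n) h
             (embH ` (Sp_borel_opp (m-1) \<times> Sp_borel_opp 1 \<times> Sp_borel_opp (n-1)))"

definition transport ::
  "nat \<Rightarrow> nat \<Rightarrow> cmat \<times> cmat \<Rightarrow> (cmat \<times> cmat) set \<Rightarrow> (cmat \<times> cmat \<Rightarrow> complex)
     \<Rightarrow> (cmat \<times> cmat \<Rightarrow> complex)" where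
  "transport m n g T \<chi> = (\<lambda>t\<in>T. \<chi> (inv\<^bsub>grpG m n\<^esub> g \<otimes>\<^bsub>grpG m n\<^esub> t \<otimes>\<^bsub>grpG m n\<^esub> g))"

text \<open>Fundamental weights \<open>\<omega>\<^sub>i\<close> of the first and \<open>\<omega>'\<^sub>i\<close> of the second factor of \<open>G\<close>.\<close>

definition omega1 ::
  "nat \<Rightarrow> nat \<Rightarrow> cmat \<times> cmat \<Rightarrow> (cmat \<times> cmat) set \<Rightarrow> nat \<Rightarrow> (cmat \<times> cmat \<Rightarrow> complex)" where
  "omega1 m n g T i = transport m n g T (\<lambda>t. C_fund_weight i (fst t))"

definition omega2 ::
  "nat \<Rightarrow> nat \<Rightarrow> cmat \<times> cmat \<Rightarrow> (cmat \<times> cmat) set \<Rightarrow> nat \<Rightarrow> (cmat \<times> cmat \<Rightarrow> complex)" where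
  "omega2 m n g T i = transport m n g T (\<lambda>t. C_fund_weight i (snd t))"

text \<open>The entries of an element \<open>diag2 A S\<close> belonging to the coordinates of \<open>A\<close> are its first
  \<open>m - 1\<close> coordinates \<open>\<epsilon>\<^sub>1, \<dots>, \<epsilon>\<^sub>m\<^sub>-\<^sub>1\<close>, and the coordinate of \<open>S \<in> SL(2)\<close> is \<open>\<epsilon>\<^sub>m\<close>.\<close>

definition varpi ::
  "nat \<Rightarrow> nat \<Rightarrow> cmat \<times> cmat \<Rightarrow> (cmat \<times> cmat) set \<Rightarrow> (cmat \<times> cmat \<Rightarrow> complex)" where
  "varpi m n h TH = transport m n h TH (\<lambda>t. C_eps m (fst t))"

definition beta ::
  "nat \<Rightarrow> nat \<Rightarrow> cmat \<times> cmat \<Rightarrow> (cmat \<times> cmat) set \<Rightarrow> (cmat \<times> cmat \<Rightarrow> complex)" where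
  "beta m n h TH = transport m n h TH (\<lambda>t. (C_eps m (fst t))^2)"

definition simple_roots_H ::
  "nat \<Rightarrow> nat \<Rightarrow> cmat \<times> cmat \<Rightarrow> (cmat \<times> cmat) set \<Rightarrow> (cmat \<times> cmat \<Rightarrow> complex) set" where
  "simple_roots_H m n h TH =
     (\<lambda>i. transport m n h TH (\<lambda>t. C_simple_root (m-1) i (fst t))) ` {1..m-1}
     \<union> {beta m n h TH}
     \<union> (\<lambda>i. transport m n h TH (\<lambda>t. C_simple_root (n-1) i (snd t))) ` {1..n-1}"


section \<open>Parabolic subgroups\<close>

text \<open>The Levi subgroup containing the maximal torus \<open>T\<close> with simple roots \<open>J\<close> is the
  centralizer of the identity component of the common kernel of \<open>J\<close> in \<open>T\<close>.  Since \<open>J\<close> is part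
  of a basis of the root lattice, the common kernel is generated by its identity component and
  elements of the centre of \<open>H\<close>, so that its centralizer is the same.\<close>

definition levi :: "('a, 'b) monoid_scheme \<Rightarrow> 'a set \<Rightarrow> 'a set \<Rightarrow> ('a \<Rightarrow> complex) set \<Rightarrow> 'a set"
  where
  "levi G H T J = {x \<in> H. \<forall>t\<in>T. (\<forall>\<alpha>\<in>J. \<alpha> t = 1) \<longrightarrow> x \<otimes>\<^bsub>G\<^esub> t = t \<otimes>\<^bsub>G\<^esub> x}"

text \<open>The parabolic subgroup of \<open>H\<close> corresponding to \<open>I\<close>: it contains the Borel subgroup \<open>Bm\<close>
  and its Levi subgroup has as simple roots those simple roots of \<open>H\<close> that are not in \<open>I\<close>.\<close>

definition parabolic ::
  "('a, 'b) monoid_scheme \<Rightarrow> 'a set \<Rightarrow> 'a set \<Rightarrow> 'a set \<Rightarrow> ('a \<Rightarrow> complex) set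
     \<Rightarrow> ('a \<Rightarrow> complex) set \<Rightarrow> 'a set" where
  "parabolic G H T Bm \<Delta> I = levi G H T (\<Delta> - I) <#>\<^bsub>G\<^esub> Bm"


section \<open>Extended weight monoid and free generation\<close>

text \<open>Characters of \<open>B\<close> and \<open>P\<close> are identified with their restrictions to \<open>T\<close> and \<open>TH\<close>.\<close>

definition ext_weight_monoid ::
  "nat \<Rightarrow> nat \<Rightarrow> (cmat \<times> cmat) set \<Rightarrow> (cmat \<times> cmat) set \<Rightarrow> (cmat \<times> cmat) set \<Rightarrow> (cmat \<times> cmat) set
     \<Rightarrow> ((cmat \<times> cmat \<Rightarrow> complex) \<times> (cmat \<times> cmat \<Rightarrow> complex)) set" where
  "ext_weight_monoid m n T B TH P =
     {(restrict \<omega> T, restrict \<chi> TH) | \<omega> \<chi>.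
        \<omega> \<in> characters m n B \<and> \<chi> \<in> characters m n P \<and>
        (\<exists>f \<in> regular_functions m n (carrier (grpG m n)).
           (\<exists>x \<in> carrier (grpG m n). f x \<noteq> 0) \<and>
           (\<forall>b\<in>B. \<forall>x\<in>carrier (grpG m n). \<forall>p\<in>P.
              f (inv\<^bsub>grpG m n\<^esub> b \<otimes>\<^bsub>grpG m n\<^esub> x \<otimes>\<^bsub>grpG m n\<^esub> p) = \<omega> b * f x * \<chi> p))}"

text \<open>The subset \<open>M\<close> of the commutative group \<open>A\<close> is a monoid freely generated by the members
  of the list \<open>xs\<close>: every element of \<open>M\<close>, and no other one, has a unique expression
  as a combination of \<open>xs\<close> with natural number coefficients.\<close>

definition freely_generated ::
  "('a, 'b) monoid_scheme \<Rightarrow> 'a set \<Rightarrow> 'a list \<Rightarrow> bool" where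
  "freely_generated A M xs \<longleftrightarrow> set xs \<subseteq> carrier A \<and>
     bij_betw (\<lambda>k :: nat \<Rightarrow> nat. \<Otimes>\<^bsub>A\<^esub>i\<in>{..<length xs}. (xs ! i) [^]\<^bsub>A\<^esub> (k i))
       ({..<length xs} \<rightarrow>\<^sub>E UNIV) M"

end

theory Submission
  imports Defs "Jordan_Normal_Form.Determinant" "HOL-Computational_Algebra.Fundamental_Theorem_Algebra"
begin

text \<open>Why the theorem holds.  After conjugation the pair \<open>(B, P)\<close> may be replaced by a standard one.
Interchanging the first and the last hyperbolic plane moves the common factor \<open>SL(2)\<close> to the plane
spanned by \<open>e 0\<close> and \<open>e 1\<close>; then \<open>P\<close> becomes the group of all pairs of symplectic matrices whose
first two columns are \<open>a e 0 + c e 1\<close> and \<open>a\<^sup>-\<^sup>1 e 1\<close>, with the same \<open>a\<close> and \<open>c\<close> in both components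
(\<open>H_setup.parabolic_eq\<close>, \<open>H_setup.P_h'\<close>).

For \<open>x = (X, Y)\<close> in \<open>G\<close> let \<open>p, q\<close> be the first two columns of \<open>X\<close> and \<open>r, s\<close> those of \<open>Y\<close>, with rows
numbered from \<open>0\<close>.  The functions \<open>q 1\<close>, \<open>s 1\<close>, \<open>p 1 s 1 - q 1 r 1\<close>, \<open>p 1 q 3 - p 3 q 1\<close> and
\<open>r 1 s 3 - r 3 s 1\<close> (the last two only for \<open>m > 1\<close> and \<open>n > 1\<close> respectively) are semi-invariant, and their weights are the five proposed generators; products of powers of them show that the monoid
generated by these weights is contained in the extended weight monoid
(\<open>exponent_tuple.f_std_semi\<close>).

Conversely let \<open>f\<close> be a non-zero semi-invariant function.  The symplectic group is generated by
unipotent one-parameter subgroups (\<open>Fixing_subset_eichler_gen\<close>).  This has two consequences: \<open>G\<close> is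
irreducible, so that \<open>f\<close> and the five functions have a common point where none of them vanishes
(\<open>grpG_irreducible\<close>), and a character of \<open>P\<close> is trivial on \<open>Sp(2m - 2) \<times> Sp(2n - 2)\<close>, so that
\<open>f\<close> depends on \<open>p, q, r, s\<close> only.  Two unipotent elements of \<open>B\<close> in each component and one of \<open>P\<close> bring a
point where the five functions do not vanish into a normal form which depends on their values alone;
hence at such points \<open>f\<close> is determined by the values of the five functions
(\<open>semi_invariant.f_invariants\<close>).

Finally consider, for each of the five functions \<open>F\<close>, a polynomial curve \<open>x(t)\<close> in \<open>G\<close> on which \<open>F\<close>
equals \<open>t\<close> and the four others are constant and non-zero.  A one-parameter
subgroup of the tori multiplies \<open>F\<close> by \<open>t\<^sup>2\<close> and fixes the other functions, so that
\<open>f (x (t\<^sup>2)) = t\<^sup>K f (x 1)\<close>, where \<open>K\<close> is an integer given by the weight of \<open>f\<close>.  The left side is a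
polynomial in \<open>t\<^sup>2\<close>; therefore \<open>K\<close> is even and not negative.  The five numbers \<open>K div 2\<close> are the
coefficients of the weight of \<open>f\<close> with respect to the generators
(\<open>nonzero_semi_invariant.exponents\<close>).  They are unique because the five weights are linearly
independent (\<open>standard_setup.weight_pair_inj\<close>).\<close>

section \<open>The symplectic form and the symplectic group\<close>

definition unitv :: "nat \<Rightarrow> nat \<Rightarrow> complex" where
  "unitv j = (\<lambda>i. if i = j then 1 else 0)"

lemma unitv_apply: "unitv j i = (if i = j then 1 else 0)"
  by (simp add: unitv_def)

text \<open>Vectors are functions on the natural numbers, of which only the values below \<open>2 * k\<close> matter; this
avoids a type for each dimension.  \<open>Om k\<close> is the form with Gram matrix \<open>symp_form k\<close>.\<close>

definition Om :: "nat \<Rightarrow> (nat \<Rightarrow> complex) \<Rightarrow> (nat \<Rightarrow> complex) \<Rightarrow> complex" where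
  "Om k u v = (\<Sum>l<k. u (2*l) * v (2*l+1) - u (2*l+1) * v (2*l))"

text \<open>Columns are cut off at the dimension, so that equality of columns is equality of functions
although matrix entries outside the dimension are unspecified.\<close>

definition colv :: "cmat \<Rightarrow> nat \<Rightarrow> nat \<Rightarrow> complex" where
  "colv A j = (\<lambda>i. if i < dim_row A then A $$ (i,j) else 0)"

definition mat_act :: "nat \<Rightarrow> cmat \<Rightarrow> (nat \<Rightarrow> complex) \<Rightarrow> nat \<Rightarrow> complex" where
  "mat_act k A v = (\<lambda>i. if i < 2*k then \<Sum>l<2*k. A $$ (i,l) * v l else 0)"

lemma Om_add_left: "Om k (\<lambda>i. u i + u' i) v = Om k u v + Om k u' v"
  by (simp add: Om_def sum.distrib[symmetric] algebra_simps)

lemma Om_scale_left: "Om k (\<lambda>i. c * u i) v = c * Om k u v"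
  by (simp add: Om_def sum_distrib_left algebra_simps)

lemma Om_swap: "Om k u v = - Om k v u"
  by (simp add: Om_def sum_negf[symmetric] algebra_simps)

lemma Om_add_right: "Om k v (\<lambda>i. u i + u' i) = Om k v u + Om k v u'"
  by (simp add: Om_def sum.distrib[symmetric] algebra_simps)

lemma Om_scale_right: "Om k v (\<lambda>i. c * u i) = c * Om k v u"
  by (simp add: Om_def sum_distrib_left algebra_simps)

lemma Om_diff_left: "Om k (\<lambda>i. u i - u' i) v = Om k u v - Om k u' v"
  by (simp add: Om_def sum_subtractf[symmetric] algebra_simps)

lemma Om_diff_right: "Om k v (\<lambda>i. u i - u' i) = Om k v u - Om k v u'"
  by (simp add: Om_def sum_subtractf[symmetric] algebra_simps)

lemma Om_self [simp]: "Om k u u = 0"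
  by (simp add: Om_def algebra_simps)

lemma Om_sum_right: "finite S \<Longrightarrow> Om k v (\<lambda>i. \<Sum>l\<in>S. c l * u l i) = (\<Sum>l\<in>S. c l * Om k v (u l))"
proof (induction S rule: finite_induct)
  case empty
  then show ?case by (simp add: Om_def)
next
  case (insert x F)
  then show ?case by (simp add: Om_add_right Om_scale_right)
qed

lemmas Om_linear = Om_add_left Om_add_right Om_scale_left Om_scale_right Om_diff_left Om_diff_right

lemma Om_cong:
  assumes "\<And>i. i < 2*k \<Longrightarrow> u i = u' i" "\<And>i. i < 2*k \<Longrightarrow> v i = v' i"
  shows "Om k u v = Om k u' v'"
  unfolding Om_def by (intro sum.cong refl) (use assms in auto)

lemma Om_unitv_left:
  "Om k (unitv i) v = (if i < 2*k then if even i then v (Suc i) else - v (i-1) else 0)"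
proof -
  have "Om k (unitv i) v = (\<Sum>l<k. if l = i div 2 then (if even i then v (Suc i) else - v (i-1)) else 0)"
    unfolding Om_def
  proof (intro sum.cong refl)
    fix l
    show "unitv i (2*l) * v (2*l+1) - unitv i (2*l+1) * v (2*l) =
      (if l = i div 2 then (if even i then v (Suc i) else - v (i-1)) else 0)"
      by (cases "even i") (auto simp: unitv_apply elim!: evenE oddE)
  qed
  also have "\<dots> = (if i < 2*k then if even i then v (Suc i) else - v (i-1) else 0)"
    by (auto simp: sum.delta)
  finally show ?thesis .
qed

lemma Om_unitv_right:
  "Om k v (unitv i) = (if i < 2*k then if even i then - v (Suc i) else v (i-1) else 0)"
  by (subst Om_swap) (simp add: Om_unitv_left)

lemma sum_even_odd: "(\<Sum>r<2*(k::nat). (h r :: 'a :: comm_monoid_add)) = (\<Sum>l<k. h (2*l) + h (2*l+1))"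
  by (induction k) (simp_all add: ac_simps)

lemma unitv_expand: "i < n \<Longrightarrow> (\<Sum>l<n. v l * unitv l i) = v i"
  by (simp add: unitv_apply if_distrib[of "\<lambda>x. _ * x"] cong: if_cong)

lemma symp_form_carrier [simp]: "symp_form k \<in> carrier_mat (2*k) (2*k)"
  by (simp add: symp_form_def)

lemma symp_form_dim [simp]: "dim_row (symp_form k) = 2*k" "dim_col (symp_form k) = 2*k"
  by (simp_all add: symp_form_def)

lemma symp_form_nth: "i < 2*k \<Longrightarrow> j < 2*k \<Longrightarrow> symp_form k $$ (i,j) = Om k (unitv i) (unitv j)"
  unfolding Om_unitv_left by (cases i) (auto simp: symp_form_def unitv_apply)

lemma gram_nth:
  assumes A: "A \<in> carrier_mat (2*k) (2*k)" and ij: "i < 2*k" "j < 2*k"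
  shows "(transpose_mat A * symp_form k * A) $$ (i,j) = Om k (colv A i) (colv A j)"
proof -
  have "(symp_form k * A) $$ (r, j) = Om k (unitv r) (colv A j)" if "r < 2*k" for r
  proof -
    have "(symp_form k * A) $$ (r, j) = (\<Sum>l<2*k. symp_form k $$ (r,l) * A $$ (l,j))"
      using A ij that by (simp add: scalar_prod_def symp_form_def atLeast0LessThan)
    also have "\<dots> = (\<Sum>l<2*k. A $$ (l,j) * Om k (unitv r) (unitv l))"
      using that by (intro sum.cong refl) (simp add: symp_form_nth)
    also have "\<dots> = Om k (unitv r) (\<lambda>i. \<Sum>l<2*k. A $$ (l,j) * unitv l i)"
      by (simp add: Om_sum_right)
    also have "\<dots> = Om k (unitv r) (colv A j)"
      using A by (intro Om_cong) (auto simp: unitv_expand colv_def)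
    finally show ?thesis .
  qed
  moreover have "transpose_mat A * symp_form k * A = transpose_mat A * (symp_form k * A)"
    using A by (intro assoc_mult_mat[of _ _ "2*k" _ "2*k" _ "2*k"]) auto
  ultimately have "(transpose_mat A * symp_form k * A) $$ (i,j)
      = (\<Sum>r<2*k. A $$ (r,i) * Om k (unitv r) (colv A j))"
    using A ij by (simp add: scalar_prod_def atLeast0LessThan)
  also have "\<dots> = (\<Sum>r<2*k. colv A i r * Om k (unitv r) (colv A j))"
    using A by (intro sum.cong) (auto simp: colv_def)
  also have "\<dots> = Om k (colv A i) (colv A j)"
    by (auto simp: sum_even_odd Om_def[of k "colv A i"] Om_unitv_left intro!: sum.cong)
  finally show ?thesis .
qed

lemma Sp_iff:
  "A \<in> carrier (Sp k) \<longleftrightarrow> A \<in> carrier_mat (2*k) (2*k) \<and>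
     (\<forall>i<2*k. \<forall>j<2*k. Om k (colv A i) (colv A j) = Om k (unitv i) (unitv j))"
proof -
  have "transpose_mat A * symp_form k * A = symp_form k \<longleftrightarrow>
     (\<forall>i<2*k. \<forall>j<2*k. Om k (colv A i) (colv A j) = Om k (unitv i) (unitv j))"
    if A: "A \<in> carrier_mat (2*k) (2*k)"
  proof
    assume "transpose_mat A * symp_form k * A = symp_form k"
    then show "\<forall>i<2*k. \<forall>j<2*k. Om k (colv A i) (colv A j) = Om k (unitv i) (unitv j)"
      using gram_nth[OF A] by (metis symp_form_nth)
  next
    assume *: "\<forall>i<2*k. \<forall>j<2*k. Om k (colv A i) (colv A j) = Om k (unitv i) (unitv j)"
    show "transpose_mat A * symp_form k * A = symp_form k"
    proof (rule eq_matI)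
      fix i j assume "i < dim_row (symp_form k)" "j < dim_col (symp_form k)"
      then show "(transpose_mat A * symp_form k * A) $$ (i,j) = symp_form k $$ (i,j)"
        using gram_nth[OF A] * by (simp add: symp_form_nth)
    qed (use A in \<open>auto simp: symp_form_def\<close>)
  qed
  then show ?thesis by (auto simp: Sp_def)
qed

lemma Sp_mult [simp]: "A \<otimes>\<^bsub>Sp k\<^esub> B = A * B"
  by (simp add: Sp_def)

lemma Sp_one [simp]: "\<one>\<^bsub>Sp k\<^esub> = 1\<^sub>m (2*k)"
  by (simp add: Sp_def)

lemma Sp_carrier_mat: "A \<in> carrier (Sp k) \<Longrightarrow> A \<in> carrier_mat (2*k) (2*k)"
  by (simp add: Sp_iff)

lemma Sp_form: "A \<in> carrier (Sp k) \<Longrightarrow> i < 2*k \<Longrightarrow> j < 2*k \<Longrightarrow>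
    Om k (colv A i) (colv A j) = Om k (unitv i) (unitv j)"
  by (simp add: Sp_iff)

lemma colv_one: "j < 2*k \<Longrightarrow> colv (1\<^sub>m (2*k)) j = unitv j"
  by (auto simp: colv_def unitv_def fun_eq_iff)

lemma colv_mult:
  assumes "A \<in> carrier_mat (2*k) (2*k)" "B \<in> carrier_mat (2*k) (2*k)" "j < 2*k"
  shows "colv (A * B) j = mat_act k A (colv B j)"
proof
  fix i show "colv (A * B) j i = mat_act k A (colv B j) i"
    using assms by (cases "i < 2*k") (auto simp: colv_def mat_act_def scalar_prod_def
        atLeast0LessThan intro!: sum.cong)
qed

lemma mat_act_add: "mat_act k A (\<lambda>i. u i + v i) = (\<lambda>i. mat_act k A u i + mat_act k A v i)"
  by (auto simp: mat_act_def sum.distrib algebra_simps)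

lemma mat_act_scale: "mat_act k A (\<lambda>i. c * u i) = (\<lambda>i. c * mat_act k A u i)"
  by (auto simp: mat_act_def sum_distrib_left algebra_simps)

lemma mat_eqI_colv:
  assumes "A \<in> carrier_mat n n" "B \<in> carrier_mat n n" "\<And>j. j < n \<Longrightarrow> colv A j = colv B j"
  shows "A = B"
proof (rule eq_matI)
  fix i j assume "i < dim_row B" "j < dim_col B"
  then show "A $$ (i,j) = B $$ (i,j)"
    using fun_cong[OF assms(3)[of j], of i] assms(1,2) by (auto simp: colv_def)
qed (use assms in auto)

lemma Sp_mult_closed:
  assumes "A \<in> carrier (Sp k)" "B \<in> carrier (Sp k)"
  shows "A * B \<in> carrier (Sp k)"
proof -
  let ?J = "symp_form k"
  have A: "A \<in> carrier_mat (2*k) (2*k)" and B: "B \<in> carrier_mat (2*k) (2*k)"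
    using assms by (simp_all add: Sp_iff)
  note [simp] = assoc_mult_mat[of _ "2*k" "2*k" _ "2*k" _ "2*k"]
    mult_carrier_mat[of _ "2*k" "2*k" _ "2*k"]
  have "transpose_mat (A*B) * ?J * (A*B) = transpose_mat B * (transpose_mat A * ?J * A) * B"
    using A B by (simp add: transpose_mult[OF A B])
  then show ?thesis
    using assms by (auto simp: Sp_def)
qed

lemma Sp_one_closed: "1\<^sub>m (2*k) \<in> carrier (Sp k)"
  by (simp add: Sp_iff colv_one)

lemma symp_form_square: "symp_form k * symp_form k = - 1\<^sub>m (2*k)"
proof (rule mat_eqI_colv[of _ "2*k"])
  fix j assume j: "j < 2*k"
  show "colv (symp_form k * symp_form k) j = colv (- 1\<^sub>m (2*k)) j"
  proof
    fix i
    show "colv (symp_form k * symp_form k) j i = colv (- 1\<^sub>m (2*k)) j i"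
    proof (cases "i < 2*k")
      case True
      have "colv (symp_form k * symp_form k) j i = (\<Sum>l<2*k. colv (symp_form k) j l * Om k (unitv i) (unitv l))"
        using True j by (auto simp: colv_mult[of _ k] mat_act_def symp_form_nth intro!: sum.cong)
      also have "\<dots> = Om k (unitv i) (\<lambda>r. \<Sum>l<2*k. colv (symp_form k) j l * unitv l r)"
        by (simp add: Om_sum_right)
      also have "\<dots> = Om k (unitv i) (colv (symp_form k) j)"
        by (intro Om_cong) (auto simp: unitv_expand)
      also have "\<dots> = colv (- 1\<^sub>m (2*k)) j i"
        using True j by (auto simp: Om_unitv_left colv_def symp_form_def elim!: oddE evenE)
      finally show ?thesis .
    qed (simp add: colv_def symp_form_def)
  qed
qed (auto simp: symp_form_def)

lemma Sp_left_inverse: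
  assumes "A \<in> carrier (Sp k)"
  shows "\<exists>B\<in>carrier (Sp k). B * A = 1\<^sub>m (2*k)"
proof -
  let ?J = "symp_form k"
  define B where "B = - (?J * transpose_mat A * ?J)"
  have A: "A \<in> carrier_mat (2*k) (2*k)" and J: "?J \<in> carrier_mat (2*k) (2*k)"
    and AJ: "transpose_mat A * ?J * A = ?J"
    using assms by (auto simp: Sp_def)
  have B: "B \<in> carrier_mat (2*k) (2*k)" using A J by (auto simp: B_def)
  note as = assoc_mult_mat[of _ "2*k" "2*k" _ "2*k" _ "2*k"]
    mult_carrier_mat[of _ "2*k" "2*k" _ "2*k"]
  have "B * A = - (?J * transpose_mat A * ?J * A)"
    unfolding B_def using A J by (auto intro!: uminus_mult_left_mat)
  also have "?J * transpose_mat A * ?J * A = ?J * (transpose_mat A * ?J * A)"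
    using A J by (simp add: as)
  also have "- \<dots> = 1\<^sub>m (2*k)"
    unfolding AJ symp_form_square by simp
  finally have BA: "B * A = 1\<^sub>m (2*k)" .
  have AB: "A * B = 1\<^sub>m (2*k)"
    by (rule mat_mult_left_right_inverse[OF B A BA])
  have "transpose_mat B * ?J * B = transpose_mat B * (transpose_mat A * ?J * A) * B"
    unfolding AJ ..
  also have "\<dots> = (transpose_mat B * transpose_mat A) * ?J * (A * B)"
    using A B J by (simp add: as)
  also have "transpose_mat B * transpose_mat A = transpose_mat (A * B)"
    using A B by (simp add: transpose_mult[OF A B])
  finally have "transpose_mat B * ?J * B = ?J"
    using J unfolding AB by simp
  then show ?thesis using B BA by (auto simp: Sp_def)
qed

lemma Sp_group: "group (Sp k)"
proof (rule groupI)
  fix A B C assume "A \<in> carrier (Sp k)" "B \<in> carrier (Sp k)" "C \<in> carrier (Sp k)"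
  then show "A \<otimes>\<^bsub>Sp k\<^esub> B \<otimes>\<^bsub>Sp k\<^esub> C = A \<otimes>\<^bsub>Sp k\<^esub> (B \<otimes>\<^bsub>Sp k\<^esub> C)"
    by (auto simp: Sp_iff intro!: assoc_mult_mat)
next
  fix A assume "A \<in> carrier (Sp k)"
  then show "\<exists>y\<in>carrier (Sp k). y \<otimes>\<^bsub>Sp k\<^esub> A = \<one>\<^bsub>Sp k\<^esub>"
    using Sp_left_inverse by simp
qed (auto simp: Sp_mult_closed Sp_one_closed dest: Sp_carrier_mat)

section \<open>Generation by Eichler transformations\<close>

text \<open>The map \<open>v \<mapsto> v + \<omega>(w, v) e + \<omega>(e, v) w\<close> is the exponential of an element of the symplectic Lie
algebra which has square zero if \<open>\<omega>(e, w) = 0\<close>.  Such an Eichler transformation is linear in \<open>e\<close> up to the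
identity, hence scaling \<open>e\<close> gives a one-parameter subgroup.  The choice \<open>e = c w\<close> gives a
symplectic transvection; with suitable unit vectors one gets all root subgroups.\<close>

definition eichler_op :: "nat \<Rightarrow> (nat \<Rightarrow> complex) \<Rightarrow> (nat \<Rightarrow> complex) \<Rightarrow> (nat \<Rightarrow> complex) \<Rightarrow> nat \<Rightarrow> complex" where
  "eichler_op k e w v = (\<lambda>i. v i + Om k w v * e i + Om k e v * w i)"

definition eichler :: "nat \<Rightarrow> (nat \<Rightarrow> complex) \<Rightarrow> (nat \<Rightarrow> complex) \<Rightarrow> cmat" where
  "eichler k e w = mat (2*k) (2*k) (\<lambda>(i,j). eichler_op k e w (unitv j) i)"

lemma eichler_carrier [simp]: "eichler k e w \<in> carrier_mat (2*k) (2*k)"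
  by (simp add: eichler_def)

lemma eichler_dim [simp]: "dim_row (eichler k e w) = 2*k" "dim_col (eichler k e w) = 2*k"
  by (simp_all add: eichler_def)

lemma eichler_nth: "i < 2*k \<Longrightarrow> j < 2*k \<Longrightarrow> eichler k e w $$ (i,j) = eichler_op k e w (unitv j) i"
  by (simp add: eichler_def)

lemma mat_act_eichler: "i < 2*k \<Longrightarrow> mat_act k (eichler k e w) v i = eichler_op k e w v i"
proof -
  assume i: "i < 2*k"
  have *: "Om k u v = (\<Sum>l<2*k. v l * Om k u (unitv l))" for u
  proof -
    have "(\<Sum>l<2*k. v l * Om k u (unitv l)) = Om k u (\<lambda>r. \<Sum>l<2*k. v l * unitv l r)"
      by (simp add: Om_sum_right)
    also have "\<dots> = Om k u v" by (intro Om_cong) (auto simp: unitv_expand)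
    finally show ?thesis by simp
  qed
  have "mat_act k (eichler k e w) v i = (\<Sum>l<2*k. v l * unitv l i + v l * Om k w (unitv l) * e i
      + v l * Om k e (unitv l) * w i)"
    using i by (auto simp: mat_act_def eichler_nth eichler_op_def algebra_simps intro!: sum.cong)
  also have "\<dots> = (\<Sum>l<2*k. v l * unitv l i) + (\<Sum>l<2*k. v l * Om k w (unitv l)) * e i
      + (\<Sum>l<2*k. v l * Om k e (unitv l)) * w i"
    by (simp only: sum.distrib sum_distrib_right)
  finally show ?thesis using i unfolding eichler_op_def *[of w] *[of e] by (simp add: unitv_expand)
qed

lemma Om_eichler_op:
  assumes "Om k e w = 0"
  shows "Om k (eichler_op k e w u) (eichler_op k e w v) = Om k u v"
proof -
  have we: "Om k w e = 0" using assms by (subst Om_swap) simp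
  show ?thesis
    using assms we Om_swap[of k u e] Om_swap[of k u w]
    unfolding eichler_op_def Om_linear by simp
qed

lemma colv_eichler_mult:
  assumes "A \<in> carrier_mat (2*k) (2*k)" "i < 2*k" "j < 2*k"
  shows "colv (eichler k e w * A) j i = eichler_op k e w (colv A j) i"
  using assms by (simp add: colv_mult[of _ k] mat_act_eichler)

lemma eichler_Sp:
  assumes "Om k e w = 0"
  shows "eichler k e w \<in> carrier (Sp k)"
proof -
  have "Om k (colv (eichler k e w) i) (colv (eichler k e w) j) = Om k (unitv i) (unitv j)"
    if "i < 2*k" "j < 2*k" for i j
  proof -
    have "Om k (colv (eichler k e w) i) (colv (eichler k e w) j) =
        Om k (eichler_op k e w (unitv i)) (eichler_op k e w (unitv j))"
      by (intro Om_cong) (use that in \<open>auto simp: colv_def eichler_nth\<close>)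
    then show ?thesis using Om_eichler_op[OF assms] by simp
  qed
  then show ?thesis by (simp add: Sp_iff)
qed

definition supp_in :: "nat \<Rightarrow> nat \<Rightarrow> (nat \<Rightarrow> complex) set" where
  "supp_in j k = {v. \<forall>i. i < 2*j \<or> 2*k \<le> i \<longrightarrow> v i = 0}"

lemma colv_eichler_mult_full:
  assumes "A \<in> carrier_mat (2*k) (2*k)" "j < 2*k" "e \<in> supp_in l k" "w \<in> supp_in l k"
  shows "colv (eichler k e w * A) j = eichler_op k e w (colv A j)"
proof
  fix i show "colv (eichler k e w * A) j i = eichler_op k e w (colv A j) i"
  proof (cases "i < 2*k")
    case False
    then show ?thesis using assms by (auto simp: eichler_op_def supp_in_def colv_def)
  qed (use assms colv_eichler_mult in blast)
qed

text \<open>\<open>Fixing k j\<close> is a copy of \<open>Sp (k - j)\<close> acting on the last \<open>k - j\<close> hyperbolic planes.\<close>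

definition Fixing :: "nat \<Rightarrow> nat \<Rightarrow> cmat set" where
  "Fixing k j = {A \<in> carrier (Sp k). \<forall>i<2*j. colv A i = unitv i}"

inductive_set eichler_gen :: "nat \<Rightarrow> nat \<Rightarrow> cmat set" for k j where
  one: "1\<^sub>m (2*k) \<in> eichler_gen k j"
| mult: "A \<in> eichler_gen k j \<Longrightarrow> e \<in> supp_in j k \<Longrightarrow> w \<in> supp_in j k \<Longrightarrow> Om k e w = 0
    \<Longrightarrow> eichler k e w * A \<in> eichler_gen k j"

lemma eichler_gen_Sp: "A \<in> eichler_gen k j \<Longrightarrow> A \<in> carrier (Sp k)"
  by (induction rule: eichler_gen.induct) (auto simp: Sp_one_closed Sp_mult_closed eichler_Sp)

lemma eichler_gen_mono: "A \<in> eichler_gen k j \<Longrightarrow> i \<le> j \<Longrightarrow> A \<in> eichler_gen k i"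
  by (induction rule: eichler_gen.induct) (auto intro!: eichler_gen.intros simp: supp_in_def unitv_apply)

lemma eichler_inverse:
  assumes A: "A \<in> carrier_mat (2*k) (2*k)" and ew: "Om k e w = 0"
  shows "eichler k (\<lambda>i. - e i) w * (eichler k e w * A) = A"
proof (rule mat_eqI_colv[of _ "2*k"])
  fix j assume j: "j < 2*k"
  have we: "Om k w e = 0" using ew by (subst Om_swap) simp
  have neg: "Om k (\<lambda>i. - e i) v = - Om k e v" for v
    using Om_scale_left[of k "-1" e v] by simp
  have "colv (eichler k (\<lambda>i. - e i) w * (eichler k e w * A)) j i = colv A j i" if i: "i < 2*k" for i
  proof -
    have "colv (eichler k (\<lambda>i. - e i) w * (eichler k e w * A)) j i =
        eichler_op k (\<lambda>i. - e i) w (colv (eichler k e w * A) j) i"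
      using A i j by (intro colv_eichler_mult) auto
    also have "\<dots> = eichler_op k (\<lambda>i. - e i) w (eichler_op k e w (colv A j)) i"
      unfolding eichler_op_def[of _ "\<lambda>i. - e i"] using A i j
      by (simp add: colv_eichler_mult cong: Om_cong)
    also have "\<dots> = colv A j i"
      using ew we by (simp add: eichler_op_def Om_linear neg)
    finally show ?thesis .
  qed
  then show "colv (eichler k (\<lambda>i. - e i) w * (eichler k e w * A)) j = colv A j"
    using A by (auto simp: fun_eq_iff colv_def)
qed (use A in auto)

lemma eichler_gen_cancel:
  assumes "eichler k e w * A \<in> eichler_gen k j" "A \<in> carrier (Sp k)"
    "e \<in> supp_in j k" "w \<in> supp_in j k" "Om k e w = 0"
  shows "A \<in> eichler_gen k j"
proof -
  have "Om k (\<lambda>i. - e i) w = 0" using Om_scale_left[of k "-1" e w] assms by simp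
  then have "eichler k (\<lambda>i. - e i) w * (eichler k e w * A) \<in> eichler_gen k j"
    using assms by (intro eichler_gen.mult[OF assms(1)]) (auto simp: supp_in_def)
  moreover have "eichler k (\<lambda>i. - e i) w * (eichler k e w * A) = A"
    using assms by (intro eichler_inverse Sp_carrier_mat)
  ultimately show ?thesis by simp
qed

text \<open>If \<open>\<omega>(u, v) \<noteq> 0\<close>, the transvection in the direction \<open>v - u\<close>, suitably scaled, takes \<open>u\<close> to \<open>v\<close> and
fixes the vectors orthogonal to \<open>v - u\<close>.\<close>

lemma eichler_gen_move:
  assumes A: "A \<in> carrier (Sp k)" and a: "a < 2*k" and u: "colv A a \<in> supp_in j k"
    and v: "v \<in> supp_in j k" and uv: "Om k (colv A a) v \<noteq> 0"
  obtains A' where "A' \<in> carrier (Sp k)" "colv A' a = v"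
    "\<And>b. b < 2*k \<Longrightarrow> Om k (\<lambda>i. v i - colv A a i) (colv A b) = 0 \<Longrightarrow> colv A' b = colv A b"
    "A' \<in> eichler_gen k j \<Longrightarrow> A \<in> eichler_gen k j"
proof -
  define d where "d = (\<lambda>i. v i - colv A a i)"
  define c where "c = 1 / (2 * Om k v (colv A a))"
  define e where "e = (\<lambda>i. c * d i)"
  have d: "d \<in> supp_in j k" and e: "e \<in> supp_in j k"
    using u v by (auto simp: d_def e_def supp_in_def)
  have vu: "Om k v (colv A a) \<noteq> 0" using uv by (subst Om_swap) simp
  have ed: "Om k e d = 0" by (simp add: e_def Om_scale_left)
  have col: "colv (eichler k e d * A) b = (\<lambda>i. colv A b i + 2 * c * Om k d (colv A b) * d i)"
    if "b < 2*k" for b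
    using that colv_eichler_mult_full[OF Sp_carrier_mat[OF A] that e d]
    by (simp add: eichler_op_def e_def Om_scale_left fun_eq_iff)
  have "Om k d (colv A a) = Om k v (colv A a)" by (simp add: d_def Om_linear)
  then have "colv (eichler k e d * A) a = v"
    using vu by (simp add: col a c_def) (simp add: d_def)
  moreover have "colv (eichler k e d * A) b = colv A b"
    if "b < 2*k" "Om k (\<lambda>i. v i - colv A a i) (colv A b) = 0" for b
    using that by (simp add: col flip: d_def)
  ultimately show ?thesis
    using that[of "eichler k e d * A"] eichler_gen_cancel[OF _ A e d ed] A ed
    by (auto simp: Sp_mult_closed eichler_Sp)
qed

lemma Fixing_supp:
  assumes "A \<in> Fixing k j" "2*j \<le> i" "i < 2*k"
  shows "colv A i \<in> supp_in j k"
proof -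
  have A: "A \<in> carrier (Sp k)" "\<And>r. r < 2*j \<Longrightarrow> colv A r = unitv r"
    using assms by (auto simp: Fixing_def)
  have "colv A i r = 0" if "r < 2*j" for r
  proof (cases "even r")
    case True
    then obtain l where l: "r = 2*l" by (elim evenE)
    have "Om k (unitv (Suc r)) (colv A i) = Om k (unitv (Suc r)) (unitv i)"
      using Sp_form[OF A(1), of "Suc r" i] A(2)[of "Suc r"] that assms l by simp
    then show ?thesis using that assms l by (auto simp: Om_unitv_left unitv_apply)
  next
    case False
    then obtain l where l: "r = 2*l+1" by (elim oddE)
    have "Om k (unitv (2*l)) (colv A i) = Om k (unitv (2*l)) (unitv i)"
      using Sp_form[OF A(1), of "2*l" i] A(2)[of "2*l"] that assms l by simp
    then show ?thesis using that assms l by (auto simp: Om_unitv_left unitv_apply)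
  qed
  then show ?thesis using A(1) by (auto simp: supp_in_def colv_def Sp_iff)
qed

lemma unitv_supp: "2*j \<le> i \<Longrightarrow> i < 2*k \<Longrightarrow> unitv i \<in> supp_in j k"
  by (auto simp: supp_in_def unitv_apply)

lemma supp_in_add: "u \<in> supp_in j k \<Longrightarrow> v \<in> supp_in j k \<Longrightarrow> (\<lambda>i. u i + v i) \<in> supp_in j k"
  by (auto simp: supp_in_def unitv_apply)

lemma Om_supp_unitv:
  assumes v: "v \<in> supp_in j k" and i: "i < 2*j" "j \<le> k"
  shows "Om k v (unitv i) = 0"
proof -
  have "Suc i < 2*j" if "even i" using that i by presburger
  then show ?thesis using v i by (simp add: Om_unitv_right supp_in_def)
qed

lemma supp_in_diff: "u \<in> supp_in j k \<Longrightarrow> v \<in> supp_in j k \<Longrightarrow> (\<lambda>i. u i - v i) \<in> supp_in j k"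
  by (auto simp: supp_in_def unitv_apply)

lemma Fixing_move:
  assumes A: "A \<in> Fixing k j" and jk: "j < k" and a: "2*j \<le> a" "a < 2*k"
    and v: "v \<in> supp_in j k" and uv: "Om k (colv A a) v \<noteq> 0"
  obtains A' where "A' \<in> Fixing k j" "colv A' a = v"
    "\<And>b. b < 2*k \<Longrightarrow> Om k (\<lambda>i. v i - colv A a i) (colv A b) = 0 \<Longrightarrow> colv A' b = colv A b"
    "A' \<in> eichler_gen k j \<Longrightarrow> A \<in> eichler_gen k j"
proof -
  have A': "A \<in> carrier (Sp k)" and u: "colv A a \<in> supp_in j k"
    using A a Fixing_supp by (auto simp: Fixing_def)
  obtain B where B: "B \<in> carrier (Sp k)" "colv B a = v"
    "\<And>b. b < 2*k \<Longrightarrow> Om k (\<lambda>i. v i - colv A a i) (colv A b) = 0 \<Longrightarrow> colv B b = colv A b"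
    "B \<in> eichler_gen k j \<Longrightarrow> A \<in> eichler_gen k j"
    using eichler_gen_move[OF A' a(2) u v uv] by blast
  have "colv B b = unitv b" if b: "b < 2*j" for b
  proof -
    have Ab: "colv A b = unitv b" using A b by (simp add: Fixing_def)
    have "Om k (\<lambda>i. v i - colv A a i) (colv A b) = 0"
      unfolding Ab by (rule Om_supp_unitv[OF supp_in_diff[OF v u] b]) (use jk in simp)
    then show ?thesis using B(3)[of b] b jk Ab by simp
  qed
  then have "B \<in> Fixing k j" using B(1) by (simp add: Fixing_def)
  then show ?thesis using that B(2-4) by blast
qed

text \<open>A transvection moves the column to the unit vector if the two are not orthogonal; otherwise two
transvections do, through a vector orthogonal to neither.\<close>

lemma Fixing_extend_first:
  assumes A: "A \<in> Fixing k j" and jk: "j < k"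
  obtains A' where "A' \<in> Fixing k j" "colv A' (2*j) = unitv (2*j)"
    "A' \<in> eichler_gen k j \<Longrightarrow> A \<in> eichler_gen k j"
proof -
  let ?v = "colv A (2*j)" and ?y0 = "colv A (2*j+1)" and ?e = "unitv (2*j)" and ?f = "unitv (2*j+1)"
  have supp: "?v \<in> supp_in j k" "?y0 \<in> supp_in j k" "?e \<in> supp_in j k" "?f \<in> supp_in j k"
    using Fixing_supp[OF A] jk unitv_supp by auto
  have vy: "Om k ?v ?y0 = 1"
    using A jk Sp_form[of A k "2*j" "2*j+1"] by (auto simp: Fixing_def Om_unitv_left unitv_apply)
  have fe: "Om k ?f ?e = -1" using jk by (auto simp: Om_unitv_left unitv_apply)
  show ?thesis
  proof (cases "Om k ?v ?e = 0")
    case False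
    show ?thesis
      by (rule Fixing_move[OF A jk _ _ supp(3) False]) (use jk that in auto)
  next
    case True
    \<comment> \<open>One of the second column, the second unit vector and their sum is orthogonal to neither \<open>?v\<close> nor \<open>?e\<close>.\<close>
    obtain y where y: "y \<in> supp_in j k" "Om k ?v y \<noteq> 0" "Om k y ?e \<noteq> 0"
    proof (cases "Om k ?y0 ?e = 0")
      case y0: True
      show ?thesis
      proof (cases "Om k ?v ?f = 0")
        case True
        show ?thesis
          by (rule that[of "\<lambda>i. ?y0 i + ?f i"])
             (use True y0 fe vy supp in \<open>simp_all add: Om_linear supp_in_add\<close>)
      qed (use that[of ?f] supp fe in auto)
    qed (use that[of ?y0] supp vy in auto)
    obtain B where B: "B \<in> Fixing k j" "colv B (2*j) = y" "B \<in> eichler_gen k j \<Longrightarrow> A \<in> eichler_gen k j"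
      by (rule Fixing_move[OF A jk _ _ y(1,2)]) (use jk in auto)
    show ?thesis
      by (rule Fixing_move[OF B(1) jk _ _ supp(3), of "2*j"]) (use B jk that y in auto)
  qed
qed

text \<open>The image \<open>u\<close> of the second vector of the hyperbolic plane is moved by transvections in directions
orthogonal to the first vector, so that this one stays fixed.  If \<open>u\<close> is orthogonal to its target,
the detour goes through the sum of \<open>u\<close> and the first vector.\<close>

lemma Fixing_extend:
  assumes A: "A \<in> Fixing k j" and jk: "j < k"
  obtains A' where "A' \<in> Fixing k (Suc j)" "A' \<in> eichler_gen k j \<Longrightarrow> A \<in> eichler_gen k j"
proof -
  obtain B where B: "B \<in> Fixing k j" "colv B (2*j) = unitv (2*j)"
    "B \<in> eichler_gen k j \<Longrightarrow> A \<in> eichler_gen k j"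
    using Fixing_extend_first[OF A jk] by blast
  let ?e = "unitv (2*j)" and ?f = "unitv (2*j+1)"
  have one: "Om k ?e (colv C (2*j+1)) = 1" if "C \<in> Fixing k j" "colv C (2*j) = ?e" for C
    using that jk Sp_form[of C k "2*j" "2*j+1"] by (auto simp: Fixing_def Om_unitv_left unitv_apply)
  have ef: "Om k ?e ?f = 1" using jk by (auto simp: Om_unitv_left unitv_apply)
  have supp: "?e \<in> supp_in j k" "?f \<in> supp_in j k"
    using jk unitv_supp by auto
  have keep: "Om k (\<lambda>i. y i - colv C (2*j+1) i) (colv C (2*j)) = 0"
    if "C \<in> Fixing k j" "colv C (2*j) = ?e" "Om k ?e y = 1" for y C
    using one[OF that(1,2)] that(2,3) Om_swap[of k y ?e] Om_swap[of k "colv C (2*j+1)" ?e] by (simp add: Om_linear)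
  have finish: thesis if "C \<in> Fixing k j" "colv C (2*j) = ?e" "Om k (colv C (2*j+1)) ?f \<noteq> 0"
    "C \<in> eichler_gen k j \<Longrightarrow> A \<in> eichler_gen k j" for C
  proof (rule Fixing_move[OF that(1) jk _ _ supp(2), of "2*j+1"])
    fix D
    assume D: "D \<in> Fixing k j" "colv D (2*j+1) = ?f"
      "\<And>b. b < 2*k \<Longrightarrow> Om k (\<lambda>i. ?f i - colv C (2*j+1) i) (colv C b) = 0 \<Longrightarrow> colv D b = colv C b"
      "D \<in> eichler_gen k j \<Longrightarrow> C \<in> eichler_gen k j"
    have "colv D (2*j) = ?e"
      using D(3)[of "2*j"] keep[OF that(1,2) ef] jk that by simp
    then have "D \<in> Fixing k (Suc j)"
      using D by (auto simp: Fixing_def less_Suc_eq)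
    then show thesis using \<open>\<And>A'. A' \<in> Fixing k (Suc j) \<Longrightarrow> (A' \<in> eichler_gen k j \<Longrightarrow> A \<in> eichler_gen k j) \<Longrightarrow> thesis\<close>
        D(4) that(4) by blast
  qed (use jk that in auto)
  show thesis
  proof (cases "Om k (colv B (2*j+1)) ?f = 0")
    case False
    then show thesis using finish[OF B(1,2) _ B(3)] by blast
  next
    case True
    let ?u = "colv B (2*j+1)"
    let ?y = "\<lambda>i. ?u i + ?e i"
    have ue: "Om k ?u ?e = -1" using one[OF B(1,2)] Om_swap[of k ?u ?e] by argo
    have u: "?u \<in> supp_in j k" by (rule Fixing_supp[OF B(1)]) (use jk in auto)
    show thesis
    proof (rule Fixing_move[OF B(1) jk, of "2*j+1" ?y])
      fix C
      assume C: "C \<in> Fixing k j" "colv C (2*j+1) = ?y"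
        "\<And>b. b < 2*k \<Longrightarrow> Om k (\<lambda>i. ?y i - ?u i) (colv B b) = 0 \<Longrightarrow> colv C b = colv B b"
        "C \<in> eichler_gen k j \<Longrightarrow> B \<in> eichler_gen k j"
      have "colv C (2*j) = ?e"
        using C(3)[of "2*j"] B(2) jk by simp
      then show thesis
      proof (rule finish[OF C(1)])
        show "Om k (colv C (2*j+1)) ?f \<noteq> 0" unfolding C(2) Om_linear True ef by simp
      qed (use C(4) B(3) in blast)
    qed (use jk supp u ue in \<open>auto simp: Om_linear supp_in_add\<close>)
  qed
qed

lemma Fixing_subset_eichler_gen:
  assumes "j \<le> k"
  shows "Fixing k j \<subseteq> eichler_gen k j"
  using assms
proof (induction "k - j" arbitrary: j)
  case 0
  show ?case
  proof
    fix A assume A: "A \<in> Fixing k j"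
    have "j = k" using 0 by simp
    then have "A = 1\<^sub>m (2*k)"
      using A by (intro mat_eqI_colv[of _ "2*k"]) (simp_all add: Fixing_def Sp_carrier_mat colv_one)
    then show "A \<in> eichler_gen k j" by (simp add: eichler_gen.one)
  qed
next
  case (Suc d)
  show ?case
  proof
    fix A assume A: "A \<in> Fixing k j"
    have jk: "j < k" using Suc by simp
    obtain B where B: "B \<in> Fixing k (Suc j)" "B \<in> eichler_gen k j \<Longrightarrow> A \<in> eichler_gen k j"
      using Fixing_extend[OF A jk] by blast
    have "d = k - Suc j" using Suc.hyps(2) jk by arith
    then have "B \<in> eichler_gen k (Suc j)" using Suc.hyps(1)[of "Suc j"] jk B by auto
    then show "A \<in> eichler_gen k j" using eichler_gen_mono[of B k "Suc j" j] B(2) by simp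
  qed
qed

corollary Sp_subset_eichler_gen: "carrier (Sp k) \<subseteq> eichler_gen k 0"
  using Fixing_subset_eichler_gen[of 0 k] by (auto simp: Fixing_def)

section \<open>Regular functions along curves, and irreducibility of G\<close>

lemma grpG_carrier: "carrier (grpG m n) = carrier (Sp m) \<times> carrier (Sp n)"
  by (simp add: grpG_def)

lemma grpG_mult [simp]: "x \<otimes>\<^bsub>grpG m n\<^esub> y = (fst x * fst y, snd x * snd y)"
  by (cases x; cases y) (simp add: grpG_def)

lemma grpG_one [simp]: "\<one>\<^bsub>grpG m n\<^esub> = (1\<^sub>m (2*m), 1\<^sub>m (2*n))"
  by (simp add: grpG_def)

lemma grpG_group: "group (grpG m n)"
  unfolding grpG_def by (intro DirProd_group Sp_group)

lemma poly_fun_sum: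
  "finite S \<Longrightarrow> (\<And>i. i \<in> S \<Longrightarrow> p i \<in> poly_fun m n) \<Longrightarrow> (\<lambda>x. \<Sum>i\<in>S. p i x) \<in> poly_fun m n"
  by (induction S rule: finite_induct) (auto intro: poly_fun.intros)

lemma poly_fun_power: "p \<in> poly_fun m n \<Longrightarrow> (\<lambda>x. p x ^ k) \<in> poly_fun m n"
  by (induction k) (auto intro: poly_fun.intros)

lemma poly_fun_diff:
  assumes "p \<in> poly_fun m n" "q \<in> poly_fun m n"
  shows "(\<lambda>x. p x - q x) \<in> poly_fun m n"
proof -
  have "(\<lambda>x. p x + (-1) * q x) \<in> poly_fun m n"
    using assms by (intro poly_fun.add poly_fun.mult poly_fun.const)
  then show ?thesis by simp
qed

lemma poly_fun_translate:
  assumes "p \<in> poly_fun m n"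
    and G: "fst a \<in> carrier_mat (2*m) (2*m)" "snd a \<in> carrier_mat (2*n) (2*n)"
      "fst b \<in> carrier_mat (2*m) (2*m)" "snd b \<in> carrier_mat (2*n) (2*n)"
  shows "\<exists>q\<in>poly_fun m n. \<forall>x. fst x \<in> carrier_mat (2*m) (2*m) \<longrightarrow> snd x \<in> carrier_mat (2*n) (2*n) \<longrightarrow>
     q x = p (fst a * fst x * fst b, snd a * snd x * snd b)"
  using assms(1)
proof (induction rule: poly_fun.induct)
  case (const c)
  show ?case by (rule bexI[of _ "\<lambda>x. c"]) (auto intro: poly_fun.intros)
next
  case (entry1 i j)
  have "(fst a * fst x * fst b) $$ (i,j) =
     (\<Sum>r<2*m. fst a $$ (i,r) * (\<Sum>s<2*m. fst x $$ (r,s) * fst b $$ (s,j)))"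
    if "fst x \<in> carrier_mat (2*m) (2*m)" for x :: "cmat \<times> cmat"
    using G that entry1 by (simp add: scalar_prod_def atLeast0LessThan)
  moreover have "(\<lambda>x. \<Sum>r<2*m. fst a $$ (i,r) * (\<Sum>s<2*m. fst x $$ (r,s) * fst b $$ (s,j)))
      \<in> poly_fun m n"
    by (intro poly_fun_sum poly_fun.mult poly_fun.const poly_fun.entry1) auto
  ultimately show ?case by (intro bexI) auto
next
  case (entry2 i j)
  have "(snd a * snd x * snd b) $$ (i,j) =
     (\<Sum>r<2*n. snd a $$ (i,r) * (\<Sum>s<2*n. snd x $$ (r,s) * snd b $$ (s,j)))"
    if "snd x \<in> carrier_mat (2*n) (2*n)" for x :: "cmat \<times> cmat"
    using G that entry2 by (simp add: scalar_prod_def atLeast0LessThan)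
  moreover have "(\<lambda>x. \<Sum>r<2*n. snd a $$ (i,r) * (\<Sum>s<2*n. snd x $$ (r,s) * snd b $$ (s,j)))
      \<in> poly_fun m n"
    by (intro poly_fun_sum poly_fun.mult poly_fun.const poly_fun.entry2) auto
  ultimately show ?case by (intro bexI) auto
next
  case (add p q)
  obtain p' where p': "p' \<in> poly_fun m n"
    "\<forall>x. fst x \<in> carrier_mat (2*m) (2*m) \<longrightarrow> snd x \<in> carrier_mat (2*n) (2*n) \<longrightarrow>
     p' x = p (fst a * fst x * fst b, snd a * snd x * snd b)" using add.IH(1) by blast
  obtain q' where q': "q' \<in> poly_fun m n"
    "\<forall>x. fst x \<in> carrier_mat (2*m) (2*m) \<longrightarrow> snd x \<in> carrier_mat (2*n) (2*n) \<longrightarrow>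
     q' x = q (fst a * fst x * fst b, snd a * snd x * snd b)" using add.IH(2) by blast
  show ?case
    by (rule bexI[of _ "\<lambda>x. p' x + q' x"]) (use p' q' in \<open>auto intro: poly_fun.intros\<close>)
next
  case (mult p q)
  obtain p' where p': "p' \<in> poly_fun m n"
    "\<forall>x. fst x \<in> carrier_mat (2*m) (2*m) \<longrightarrow> snd x \<in> carrier_mat (2*n) (2*n) \<longrightarrow>
     p' x = p (fst a * fst x * fst b, snd a * snd x * snd b)" using mult.IH(1) by blast
  obtain q' where q': "q' \<in> poly_fun m n"
    "\<forall>x. fst x \<in> carrier_mat (2*m) (2*m) \<longrightarrow> snd x \<in> carrier_mat (2*n) (2*n) \<longrightarrow>
     q' x = q (fst a * fst x * fst b, snd a * snd x * snd b)" using mult.IH(2) by blast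
  show ?case
    by (rule bexI[of _ "\<lambda>x. p' x * q' x"]) (use p' q' in \<open>auto intro: poly_fun.intros\<close>)
qed

definition Poly1 :: "(complex \<Rightarrow> complex) set" where
  "Poly1 = {\<phi>. \<exists>P. \<forall>t. \<phi> t = poly P t}"

definition Laur1 :: "(complex \<Rightarrow> complex) set" where
  "Laur1 = {\<phi>. \<exists>N P. \<forall>t. t \<noteq> 0 \<longrightarrow> t ^ N * \<phi> t = poly P t}"

lemma Poly1_const: "(\<lambda>t. c) \<in> Poly1"
  unfolding Poly1_def by (auto intro: exI[of _ "[:c:]"])

lemma Poly1_id: "(\<lambda>t. t) \<in> Poly1"
  unfolding Poly1_def by (auto intro: exI[of _ "[:0,1:]"])

lemma Poly1_add:
  assumes "\<phi> \<in> Poly1" "\<psi> \<in> Poly1"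
  shows "(\<lambda>t. \<phi> t + \<psi> t) \<in> Poly1"
proof -
  obtain P Q where "\<forall>t. \<phi> t = poly P t" "\<forall>t. \<psi> t = poly Q t"
    using assms unfolding Poly1_def by blast
  then have "\<forall>t. \<phi> t + \<psi> t = poly (P + Q) t" by simp
  then show ?thesis unfolding Poly1_def by blast
qed

lemma Poly1_mult:
  assumes "\<phi> \<in> Poly1" "\<psi> \<in> Poly1"
  shows "(\<lambda>t. \<phi> t * \<psi> t) \<in> Poly1"
proof -
  obtain P Q where "\<forall>t. \<phi> t = poly P t" "\<forall>t. \<psi> t = poly Q t"
    using assms unfolding Poly1_def by blast
  then have "\<forall>t. \<phi> t * \<psi> t = poly (P * Q) t" by simp
  then show ?thesis unfolding Poly1_def by blast
qed

lemma Poly1_uminus: "\<phi> \<in> Poly1 \<Longrightarrow> (\<lambda>t. - \<phi> t) \<in> Poly1"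
  using Poly1_mult[OF Poly1_const[of "-1"], of \<phi>] by simp

lemma Poly1_Laur1:
  assumes "\<phi> \<in> Poly1"
  shows "\<phi> \<in> Laur1"
proof -
  obtain P where "\<forall>t. \<phi> t = poly P t" using assms unfolding Poly1_def by blast
  then have "\<forall>t. t \<noteq> 0 \<longrightarrow> t ^ 0 * \<phi> t = poly P t" by simp
  then show ?thesis unfolding Laur1_def by blast
qed

lemma Laur1_inverse: "(\<lambda>t. 1 / t) \<in> Laur1"
  unfolding Laur1_def by (auto intro!: exI[of _ 1] exI[of _ "[:1:]"])

lemma Laur1_add:
  assumes "\<phi> \<in> Laur1" "\<psi> \<in> Laur1"
  shows "(\<lambda>t. \<phi> t + \<psi> t) \<in> Laur1"
proof -
  obtain N P M Q where *: "\<And>t. t \<noteq> 0 \<Longrightarrow> t ^ N * \<phi> t = poly P t" "\<And>t. t \<noteq> 0 \<Longrightarrow> t ^ M * \<psi> t = poly Q t"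
    using assms unfolding Laur1_def by blast
  have "t ^ (N + M) * (\<phi> t + \<psi> t) = poly (monom 1 M * P + monom 1 N * Q) t" if "t \<noteq> 0" for t
  proof -
    have "t ^ (N + M) * (\<phi> t + \<psi> t) = t ^ M * (t ^ N * \<phi> t) + t ^ N * (t ^ M * \<psi> t)"
      by (simp add: power_add algebra_simps)
    then show ?thesis using *[OF that] by (simp add: poly_monom)
  qed
  then show ?thesis unfolding Laur1_def by blast
qed

lemma Laur1_mult:
  assumes "\<phi> \<in> Laur1" "\<psi> \<in> Laur1"
  shows "(\<lambda>t. \<phi> t * \<psi> t) \<in> Laur1"
proof -
  obtain N P M Q where *: "\<And>t. t \<noteq> 0 \<Longrightarrow> t ^ N * \<phi> t = poly P t" "\<And>t. t \<noteq> 0 \<Longrightarrow> t ^ M * \<psi> t = poly Q t"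
    using assms unfolding Laur1_def by blast
  have "t ^ (N + M) * (\<phi> t * \<psi> t) = poly (P * Q) t" if "t \<noteq> 0" for t
    using that by (simp add: power_add *[symmetric])
  then show ?thesis unfolding Laur1_def by blast
qed

text \<open>The ring \<open>R\<close> will consist of polynomials or of Laurent polynomials in the parameter of the curve.\<close>

lemma poly_fun_curve:
  fixes \<gamma> :: "complex \<Rightarrow> cmat \<times> cmat"
  assumes "f \<in> poly_fun m n"
    and "\<And>c. (\<lambda>t. c) \<in> R"
    and "\<And>\<phi> \<psi>. \<phi> \<in> R \<Longrightarrow> \<psi> \<in> R \<Longrightarrow> (\<lambda>t. \<phi> t + \<psi> t) \<in> R"
    and "\<And>\<phi> \<psi>. \<phi> \<in> R \<Longrightarrow> \<psi> \<in> R \<Longrightarrow> (\<lambda>t. \<phi> t * \<psi> t) \<in> R"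
    and "\<And>i j. i < 2*m \<Longrightarrow> j < 2*m \<Longrightarrow> (\<lambda>t. fst (\<gamma> t) $$ (i,j)) \<in> R"
    and "\<And>i j. i < 2*n \<Longrightarrow> j < 2*n \<Longrightarrow> (\<lambda>t. snd (\<gamma> t) $$ (i,j)) \<in> R"
  shows "(\<lambda>t. f (\<gamma> t)) \<in> R"
  using assms(1) by (induction rule: poly_fun.induct) (use assms in auto)

lemmas poly_fun_Poly1 = poly_fun_curve[where R = Poly1, OF _ Poly1_const Poly1_add Poly1_mult]
lemmas poly_fun_Laur1 = poly_fun_curve[where R = Laur1, OF _ Poly1_Laur1[OF Poly1_const] Laur1_add Laur1_mult]

lemma Poly1_common_nonzero:
  assumes "\<phi> \<in> Poly1" "\<psi> \<in> Poly1" "\<phi> a \<noteq> 0" "\<psi> b \<noteq> 0"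
  shows "\<exists>t. \<phi> t \<noteq> 0 \<and> \<psi> t \<noteq> 0"
proof -
  obtain P Q where PQ: "\<And>t. \<phi> t = poly P t" "\<And>t. \<psi> t = poly Q t"
    using assms unfolding Poly1_def by auto
  have "P * Q \<noteq> 0" using PQ assms by auto
  then have "finite {t. poly (P * Q) t = 0}" by (rule poly_roots_finite)
  then have "{t. poly (P * Q) t = 0} \<noteq> UNIV"
    using infinite_UNIV_char_0[where 'a = complex] by metis
  then obtain t where "poly (P * Q) t \<noteq> 0" by blast
  then show ?thesis using PQ by auto
qed

text \<open>Hence a character is trivial on every unipotent one-parameter subgroup.\<close>

lemma nonvanishing_Poly1:
  assumes "\<phi> \<in> Poly1" "\<And>t. \<phi> t \<noteq> 0"
  shows "\<phi> s = \<phi> t"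
proof -
  obtain P where P: "\<And>t. \<phi> t = poly P t" using assms unfolding Poly1_def by auto
  then have "constant (poly P)" using fundamental_theorem_of_algebra[of P] assms by metis
  then show ?thesis by (simp add: P constant_def)
qed

text \<open>Hence a character restricts to a power on every one-dimensional torus.\<close>

lemma nonvanishing_Laur1:
  assumes "\<phi> \<in> Laur1" "\<And>t. t \<noteq> 0 \<Longrightarrow> \<phi> t \<noteq> 0" "\<phi> 1 = 1"
  shows "\<exists>a::int. \<forall>t. t \<noteq> 0 \<longrightarrow> \<phi> t = t powi a"
proof -
  obtain N P where P: "\<And>t. t \<noteq> 0 \<Longrightarrow> t ^ N * \<phi> t = poly P t" using assms unfolding Laur1_def by blast
  have P0: "P \<noteq> 0" using P[of 1] assms(3) by auto
  obtain Q where Q: "P = [:- 0, 1:] ^ order 0 P * Q" "\<not> [:- 0, 1:] dvd Q"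
    using order_decomp[OF P0, of 0] by blast
  have "poly Q t \<noteq> 0" for t
  proof (cases "t = 0")
    case True
    then show ?thesis using Q(2) by (simp add: poly_eq_0_iff_dvd)
  next
    case False
    then have "poly P t \<noteq> 0" using P[of t] assms(2)[of t] by (metis mult_eq_0_iff power_not_zero)
    then show ?thesis by (subst (asm) Q(1)) auto
  qed
  then have "constant (poly Q)" using fundamental_theorem_of_algebra[of Q] by blast
  then have c: "poly Q t = poly Q 1" for t by (simp add: constant_def)
  define k where "k = order 0 P"
  have Pt: "poly P t = t ^ k * poly Q 1" for t
    by (subst Q(1)) (simp add: c[of t] k_def)
  have "poly Q 1 = 1" using P[of 1] assms(3) Pt[of 1] by simp
  then have "t ^ N * \<phi> t = t ^ k" if "t \<noteq> 0" for t
    using P[OF that] Pt by simp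
  then have "\<phi> t = t powi (int k - int N)" if "t \<noteq> 0" for t
    using that by (simp add: power_int_diff field_simps)
  then show ?thesis by blast
qed

definition eichler_curve where
  "eichler_curve m n e w e' w' t = (eichler m (\<lambda>i. t * e i) w, eichler n (\<lambda>i. t * e' i) w')"

lemma eichler_mult_nth:
  assumes "A \<in> carrier_mat (2*k) (2*k)" "i < 2*k" "j < 2*k"
  shows "(eichler k e w * A) $$ (i,j) = A $$ (i,j) + Om k w (colv A j) * e i + Om k e (colv A j) * w i"
  using colv_eichler_mult[OF assms, of e w] assms by (simp add: colv_def eichler_op_def del: index_mult_mat(1))

lemma Om_zero_left [simp]: "Om k (\<lambda>i. 0) v = 0"
  by (simp add: Om_def)

lemma eichler_zero_mult: "A \<in> carrier_mat (2*k) (2*k) \<Longrightarrow> eichler k (\<lambda>i. 0) w * A = A"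
  by (intro eq_matI) (auto simp: eichler_mult_nth Om_def simp del: index_mult_mat(1))

lemma eichler_zero: "eichler k (\<lambda>i. 0) w = 1\<^sub>m (2*k)"
  by (intro eq_matI) (auto simp: eichler_nth eichler_op_def unitv_apply Om_def)

lemma eichler_curve_Poly1:
  assumes "f \<in> poly_fun m n" "A \<in> carrier_mat (2*m) (2*m)" "B \<in> carrier_mat (2*n) (2*n)"
  shows "(\<lambda>t. f (fst (eichler_curve m n e w e' w' t) * A, snd (eichler_curve m n e w e' w' t) * B)) \<in> Poly1"
  by (rule poly_fun_Poly1[OF assms(1)])
     (use assms in \<open>auto simp: eichler_curve_def eichler_mult_nth Om_scale_left simp del: index_mult_mat(1)
       intro!: Poly1_add Poly1_mult Poly1_const Poly1_id\<close>)

lemma eichler_curve_carrier: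
  assumes "Om m e w = 0" "Om n e' w' = 0"
  shows "eichler_curve m n e w e' w' t \<in> carrier (grpG m n)"
  using assms by (simp add: eichler_curve_def grpG_carrier eichler_Sp Om_scale_left)

text \<open>Elements \<open>a\<close> such that non-vanishing of \<open>f\<close> at \<open>x\<close> and of \<open>F\<close> at \<open>a x\<close> forces a common
non-zero of \<open>f\<close> and \<open>F\<close>.  Irreducibility of \<open>G\<close> says that all elements have this property.\<close>

definition movers :: "nat \<Rightarrow> nat \<Rightarrow> (cmat \<times> cmat) set" where
  "movers m n = {a \<in> carrier (grpG m n). \<forall>f\<in>poly_fun m n. \<forall>F\<in>poly_fun m n. \<forall>x\<in>carrier (grpG m n).
      f x \<noteq> 0 \<longrightarrow> F (a \<otimes>\<^bsub>grpG m n\<^esub> x) \<noteq> 0 \<longrightarrow> (\<exists>z\<in>carrier (grpG m n). f z \<noteq> 0 \<and> F z \<noteq> 0)}"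

lemma grpG_carrier_mat:
  assumes "x \<in> carrier (grpG m n)"
  shows "fst x \<in> carrier_mat (2*m) (2*m)" "snd x \<in> carrier_mat (2*n) (2*n)"
  using assms by (auto simp: grpG_carrier Sp_iff)

text \<open>Both \<open>f (U t x)\<close> and \<open>F (U t a x)\<close> are non-zero polynomials in \<open>t\<close>, the first one because of \<open>t = 0\<close>
and the second one because of \<open>t = 1\<close>.  At a common non-zero \<open>t\<close> the property of \<open>a\<close> applies to
\<open>f\<close> and \<open>F\<close> translated by \<open>U t\<close>.\<close>

lemma movers_eichler_curve:
  assumes a: "a \<in> movers m n" and ew: "Om m e w = 0" "Om n e' w' = 0"
  shows "eichler_curve m n e w e' w' 1 \<otimes>\<^bsub>grpG m n\<^esub> a \<in> movers m n"
  unfolding movers_def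
proof (intro CollectI conjI ballI impI)
  interpret G: group "grpG m n" by (rule grpG_group)
  let ?G = "grpG m n" and ?U = "eichler_curve m n e w e' w'"
  have aG: "a \<in> carrier ?G" using a by (simp add: movers_def)
  have U: "?U t \<in> carrier ?G" for t by (rule eichler_curve_carrier[OF ew])
  show "?U 1 \<otimes>\<^bsub>?G\<^esub> a \<in> carrier ?G" using aG U by (intro G.m_closed)
  fix f F x
  assume f: "f \<in> poly_fun m n" and F: "F \<in> poly_fun m n" and x: "x \<in> carrier ?G" and fx: "f x \<noteq> 0"
    and Fx: "F (?U 1 \<otimes>\<^bsub>?G\<^esub> a \<otimes>\<^bsub>?G\<^esub> x) \<noteq> 0"
  define y where "y = a \<otimes>\<^bsub>?G\<^esub> x"
  have y: "y \<in> carrier ?G" unfolding y_def using aG x by (intro G.m_closed)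
  have Fy: "F (?U 1 \<otimes>\<^bsub>?G\<^esub> y) \<noteq> 0"
    using Fx unfolding y_def G.m_assoc[OF U aG x] .
  have "?U 0 \<otimes>\<^bsub>?G\<^esub> x = x"
    using grpG_carrier_mat[OF x] by (cases x) (simp add: eichler_curve_def eichler_zero_mult)
  then have "f (?U 0 \<otimes>\<^bsub>?G\<^esub> x) \<noteq> 0" using fx by metis
  moreover have "(\<lambda>t. f (?U t \<otimes>\<^bsub>?G\<^esub> x)) \<in> Poly1" "(\<lambda>t. F (?U t \<otimes>\<^bsub>?G\<^esub> y)) \<in> Poly1"
    using eichler_curve_Poly1[OF f] eichler_curve_Poly1[OF F] grpG_carrier_mat[OF x] grpG_carrier_mat[OF y]
    unfolding grpG_mult by blast+
  ultimately obtain t where t: "f (?U t \<otimes>\<^bsub>?G\<^esub> x) \<noteq> 0" "F (?U t \<otimes>\<^bsub>?G\<^esub> y) \<noteq> 0"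
    using Poly1_common_nonzero[of "\<lambda>t. f (?U t \<otimes>\<^bsub>?G\<^esub> x)" "\<lambda>t. F (?U t \<otimes>\<^bsub>?G\<^esub> y)" 0 1] Fy by blast
  have tr: "\<exists>q\<in>poly_fun m n. \<forall>z\<in>carrier ?G. q z = p (?U t \<otimes>\<^bsub>?G\<^esub> z)" if p: "p \<in> poly_fun m n" for p
  proof -
    have U': "fst (?U t) \<in> carrier_mat (2*m) (2*m)" "snd (?U t) \<in> carrier_mat (2*n) (2*n)"
      using grpG_carrier_mat[OF U[of t]] .
    obtain q where q: "q \<in> poly_fun m n" and
      "\<forall>z. fst z \<in> carrier_mat (2*m) (2*m) \<longrightarrow> snd z \<in> carrier_mat (2*n) (2*n) \<longrightarrow>
        q z = p (fst (?U t) * fst z * 1\<^sub>m (2*m), snd (?U t) * snd z * 1\<^sub>m (2*n))"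
      using poly_fun_translate[OF p U', of "(1\<^sub>m (2*m), 1\<^sub>m (2*n))"] by auto
    then have "q z = p (?U t \<otimes>\<^bsub>?G\<^esub> z)" if "z \<in> carrier ?G" for z
      using grpG_carrier_mat[OF that] U' by (cases z) (simp add: right_mult_one_mat[OF mult_carrier_mat])
    then show ?thesis using q by blast
  qed
  obtain f' F' where f': "f' \<in> poly_fun m n" "\<forall>z\<in>carrier ?G. f' z = f (?U t \<otimes>\<^bsub>?G\<^esub> z)"
    and F': "F' \<in> poly_fun m n" "\<forall>z\<in>carrier ?G. F' z = F (?U t \<otimes>\<^bsub>?G\<^esub> z)"
    using tr[OF f] tr[OF F] by blast
  have "f' x \<noteq> 0" "F' (a \<otimes>\<^bsub>?G\<^esub> x) \<noteq> 0"
    using f'(2)[rule_format, OF x] F'(2)[rule_format, OF y] t unfolding y_def by argo+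
  moreover have "f' x \<noteq> 0 \<longrightarrow> F' (a \<otimes>\<^bsub>?G\<^esub> x) \<noteq> 0 \<longrightarrow> (\<exists>z\<in>carrier ?G. f' z \<noteq> 0 \<and> F' z \<noteq> 0)"
    using a f'(1) F'(1) x unfolding movers_def by simp
  ultimately obtain z where z: "z \<in> carrier ?G" "f' z \<noteq> 0" "F' z \<noteq> 0" by blast
  then show "\<exists>z\<in>carrier ?G. f z \<noteq> 0 \<and> F z \<noteq> 0"
    using z f'(2) F'(2) by (intro bexI[of _ "?U t \<otimes>\<^bsub>?G\<^esub> z"] G.m_closed U) auto
qed

lemma grpG_movers: "carrier (grpG m n) \<subseteq> movers m n"
proof -
  interpret G: group "grpG m n" by (rule grpG_group)
  have mat: "snd c \<in> carrier_mat (2*n) (2*n)" "fst c \<in> carrier_mat (2*m) (2*m)" if "c \<in> movers m n" for c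
    using that grpG_carrier_mat unfolding movers_def by blast+
  have "\<one>\<^bsub>grpG m n\<^esub> \<in> movers m n"
    unfolding movers_def
  proof (intro CollectI conjI ballI impI)
    fix f F x assume "x \<in> carrier (grpG m n)" "f x \<noteq> 0" "F (\<one>\<^bsub>grpG m n\<^esub> \<otimes>\<^bsub>grpG m n\<^esub> x) \<noteq> 0"
    then show "\<exists>z\<in>carrier (grpG m n). f z \<noteq> 0 \<and> F z \<noteq> 0" using G.l_one by metis
  qed (rule G.one_closed)
  then have one: "(1\<^sub>m (2*m), 1\<^sub>m (2*n)) \<in> movers m n" by simp
  have fst: "(A, 1\<^sub>m (2*n)) \<in> movers m n" if "A \<in> eichler_gen m 0" for A
    using that
  proof (induction rule: eichler_gen.induct)
    case (mult A e w)
    then show ?case using movers_eichler_curve[of "(A, 1\<^sub>m (2*n))" m n e w "\<lambda>i. 0" "\<lambda>i. 0"]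
      by (simp add: eichler_curve_def eichler_zero)
  qed (use one in simp)
  have snd: "(A, B) \<in> movers m n" if "B \<in> eichler_gen n 0" "A \<in> eichler_gen m 0" for A B
    using that
  proof (induction rule: eichler_gen.induct)
    case (mult B e w)
    then have "A \<in> carrier_mat (2*m) (2*m)" using eichler_gen_Sp Sp_carrier_mat by blast
    then show ?case using mult movers_eichler_curve[of "(A, B)" m n "\<lambda>i. 0" "\<lambda>i. 0" e w]
      by (simp add: eichler_curve_def eichler_zero_mult)
  qed (use fst in simp)
  show ?thesis
  proof
    fix x assume "x \<in> carrier (grpG m n)"
    then have "fst x \<in> eichler_gen m 0" "snd x \<in> eichler_gen n 0"
      using Sp_subset_eichler_gen[of m] Sp_subset_eichler_gen[of n] by (auto simp: grpG_carrier)
    then show "x \<in> movers m n" using snd[of "snd x" "fst x"] by simp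
  qed
qed

lemma grpG_irreducible:
  assumes "f \<in> poly_fun m n" "F \<in> poly_fun m n" "x \<in> carrier (grpG m n)" "y \<in> carrier (grpG m n)"
    "f x \<noteq> 0" "F y \<noteq> 0"
  shows "\<exists>z\<in>carrier (grpG m n). f z \<noteq> 0 \<and> F z \<noteq> 0"
proof -
  interpret G: group "grpG m n" by (rule grpG_group)
  have "y \<otimes>\<^bsub>grpG m n\<^esub> inv\<^bsub>grpG m n\<^esub> x \<in> movers m n"
    using grpG_movers assms by (meson G.inv_closed G.m_closed subsetD)
  moreover have "y \<otimes>\<^bsub>grpG m n\<^esub> inv\<^bsub>grpG m n\<^esub> x \<otimes>\<^bsub>grpG m n\<^esub> x = y"
    using assms by (simp only: G.m_assoc G.inv_closed G.l_inv G.r_one)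
  ultimately show ?thesis using assms unfolding movers_def by force
qed

section \<open>Semi-invariant functions\<close>

text \<open>Rows and columns are numbered by literals; the literal \<open>1\<close> must not be rewritten to \<open>Suc 0\<close>.\<close>

declare One_nat_def [simp del]

lemma Om_scaled_unitv_right [simp]: "Om k v (\<lambda>i. c * unitv j i) = c * Om k v (unitv j)"
  by (rule Om_scale_right)

lemma eichler_borel:
  assumes a: "a < k" and w: "\<forall>b\<le>a. w (Suc (2*b)) = 0"
  shows "eichler k (\<lambda>i. t * unitv (2*a) i) w \<in> Sp_borel k"
proof -
  have ew: "Om k (\<lambda>i. t * unitv (2*a) i) w = 0"
    using w a by (simp add: Om_scale_left Om_unitv_left)
  have "even i \<and> i \<le> 2*j"
    if i: "i < 2*k" and j: "j < k" and nz: "eichler k (\<lambda>i. t * unitv (2*a) i) w $$ (i, 2*j) \<noteq> 0" for i j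
  proof -
    have ee: "Om k (unitv (2*a)) (unitv (2*j)) = 0"
      using a by (auto simp: Om_unitv_left unitv_apply) presburger
    have "eichler k (\<lambda>i. t * unitv (2*a) i) w $$ (i, 2*j)
        = unitv (2*j) i - t * w (Suc (2*j)) * unitv (2*a) i"
      using i j ee by (simp add: eichler_nth eichler_op_def Om_scale_left Om_unitv_right)
    then have "i = 2*j \<or> i = 2*a \<and> w (Suc (2*j)) \<noteq> 0" using nz by (auto simp: unitv_apply split: if_splits)
    then show ?thesis using w by (cases "j \<le> a") auto
  qed
  then show ?thesis using eichler_Sp[OF ew] by (simp add: Sp_borel_def)
qed

lemma one_borel: "1\<^sub>m (2*k) \<in> Sp_borel k"
  by (auto simp: Sp_borel_def Sp_one_closed)

lemma eichler_Fixing: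
  assumes A: "A \<in> Fixing k j" and ew: "e \<in> supp_in j k" "w \<in> supp_in j k" "Om k e w = 0" and jk: "j \<le> k"
  shows "eichler k e w * A \<in> Fixing k j"
proof -
  have "colv (eichler k e w * A) i = unitv i" if i: "i < 2*j" for i
  proof -
    have "A \<in> carrier_mat (2*k) (2*k)" "colv A i = unitv i" using A i by (simp_all add: Fixing_def Sp_iff)
    moreover have "Om k e (unitv i) = 0" "Om k w (unitv i) = 0"
      using Om_supp_unitv[OF ew(1) i jk] Om_supp_unitv[OF ew(2) i jk] by simp_all
    ultimately show ?thesis
      using i jk ew(1,2) by (subst colv_eichler_mult_full[of _ _ _ _ j]) (simp_all add: eichler_op_def)
  qed
  then show ?thesis using A ew(3) by (simp add: Fixing_def Sp_mult_closed eichler_Sp)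
qed

lemma one_Fixing: "j \<le> k \<Longrightarrow> 1\<^sub>m (2*k) \<in> Fixing k j"
  by (simp add: Fixing_def Sp_one_closed colv_one)

lemma eichler_Fixing_one:
  assumes "e \<in> supp_in j k" "w \<in> supp_in j k" "Om k e w = 0" "j \<le> k"
  shows "eichler k e w \<in> Fixing k j"
  using eichler_Fixing[OF one_Fixing assms] assms by (simp add: right_mult_one_mat[OF eichler_carrier])

lemma eichler_gen_Fixing: "A \<in> eichler_gen k j \<Longrightarrow> j \<le> k \<Longrightarrow> A \<in> Fixing k j"
  by (induction rule: eichler_gen.induct) (simp_all add: one_Fixing eichler_Fixing)

lemma mat_act_unitv:
  assumes "A \<in> carrier_mat (2*k) (2*k)" "j < 2*k"
  shows "mat_act k A (unitv j) = colv A j"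
  using colv_mult[OF assms(1) one_carrier_mat assms(2)] assms by (simp add: colv_one)

lemma Sp_inverse:
  assumes "A \<in> carrier (Sp k)"
  obtains B where "B \<in> carrier (Sp k)" "B * A = 1\<^sub>m (2*k)" "A * B = 1\<^sub>m (2*k)"
  using Sp_left_inverse[OF assms] mat_mult_left_right_inverse Sp_carrier_mat assms by metis

text \<open>In this way a function that is invariant under \<open>Fixing k 1\<close> is seen to depend on two columns only.\<close>

lemma Sp_same_cols:
  assumes X: "X \<in> carrier (Sp k)" and X': "X' \<in> carrier (Sp k)" and j: "j \<le> k"
    and cols: "\<And>i. i < 2*j \<Longrightarrow> colv X' i = colv X i"
  obtains A where "A \<in> Fixing k j" "X' = X * A"
proof -
  obtain B where B: "B \<in> carrier (Sp k)" "B * X = 1\<^sub>m (2*k)" "X * B = 1\<^sub>m (2*k)"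
    using Sp_inverse[OF X] by blast
  note cm = Sp_carrier_mat[OF X] Sp_carrier_mat[OF X'] Sp_carrier_mat[OF B(1)]
  have "colv (B * X') i = unitv i" if i: "i < 2*j" for i
  proof -
    have i': "i < 2*k" using i j by simp
    have "colv (B * X') i = colv (B * X) i"
      using colv_mult[OF cm(3,2) i'] colv_mult[OF cm(3,1) i'] cols[OF i] by simp
    then show ?thesis using i' by (simp add: B(2) colv_one)
  qed
  then have "B * X' \<in> Fixing k j" using B X' by (simp add: Fixing_def Sp_mult_closed)
  moreover have "X * (B * X') = X'"
    using assoc_mult_mat[OF cm(1,3,2)] B(3) cm by simp
  ultimately show ?thesis using that by metis
qed

definition B_std :: "nat \<Rightarrow> nat \<Rightarrow> (cmat \<times> cmat) set" where
  "B_std m n = Sp_borel m \<times> Sp_borel n"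

text \<open>The first two columns of an element of the parabolic subgroup, which stabilizes the line of \<open>e 1\<close>
and the plane of \<open>e 0\<close> and \<open>e 1\<close>.  The form forces the entry \<open>1 / a\<close>.\<close>

definition par_cols :: "cmat \<Rightarrow> complex \<Rightarrow> complex \<Rightarrow> bool" where
  "par_cols X a c \<longleftrightarrow> colv X 0 = (\<lambda>i. a * unitv 0 i + c * unitv 1 i) \<and> colv X 1 = (\<lambda>i. (1/a) * unitv 1 i)"

definition P_std :: "nat \<Rightarrow> nat \<Rightarrow> (cmat \<times> cmat) set" where
  "P_std m n = {x \<in> carrier (grpG m n). \<exists>a c. a \<noteq> 0 \<and> par_cols (fst x) a c \<and> par_cols (snd x) a c}"

lemma B_std_G: "x \<in> B_std m n \<Longrightarrow> x \<in> carrier (grpG m n)"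
  by (auto simp: B_std_def grpG_carrier Sp_borel_def)

lemma P_std_G: "x \<in> P_std m n \<Longrightarrow> x \<in> carrier (grpG m n)"
  by (auto simp: P_std_def)

lemma P_stdI:
  "x \<in> carrier (grpG m n) \<Longrightarrow> a \<noteq> 0 \<Longrightarrow> par_cols (fst x) a c \<Longrightarrow> par_cols (snd x) a c \<Longrightarrow> x \<in> P_std m n"
  by (auto simp: P_std_def)

lemma Fixing_par_cols: "A \<in> Fixing k 1 \<Longrightarrow> par_cols A 1 0"
  by (simp add: Fixing_def par_cols_def)

lemma Fixing_P_std:
  assumes "A \<in> Fixing m 1" "B \<in> Fixing n 1"
  shows "(A, B) \<in> P_std m n"
proof -
  have "(A, B) \<in> carrier (grpG m n)" using assms by (simp add: Fixing_def grpG_carrier)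
  moreover have "par_cols A 1 0" "par_cols B 1 0" using assms by (simp_all add: Fixing_par_cols)
  ultimately show ?thesis by (intro P_stdI[of _ _ _ 1 0]) simp_all
qed

text \<open>The equation \<open>f (b\<^sup>-\<^sup>1 x p) = om b f(x) ch p\<close> is stated with \<open>b x\<close> in place of \<open>x\<close>, which avoids inverses.\<close>

locale semi_invariant =
  fixes m n :: nat and f om ch :: "cmat \<times> cmat \<Rightarrow> complex"
  assumes m: "1 \<le> m" and n: "1 \<le> n" and f: "f \<in> poly_fun m n"
    and om_reg: "\<exists>p\<in>poly_fun m n. \<forall>x\<in>B_std m n. om x = p x"
    and om_nz: "\<And>x. x \<in> B_std m n \<Longrightarrow> om x \<noteq> 0"
    and om_mult: "\<And>x y. x \<in> B_std m n \<Longrightarrow> y \<in> B_std m n \<Longrightarrow> om (x \<otimes>\<^bsub>grpG m n\<^esub> y) = om x * om y"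
    and ch_reg: "\<exists>p\<in>poly_fun m n. \<forall>x\<in>P_std m n. ch x = p x"
    and ch_nz: "\<And>x. x \<in> P_std m n \<Longrightarrow> ch x \<noteq> 0"
    and ch_mult: "\<And>x y. x \<in> P_std m n \<Longrightarrow> y \<in> P_std m n \<Longrightarrow> ch (x \<otimes>\<^bsub>grpG m n\<^esub> y) = ch x * ch y"
    and semi: "\<And>b x p. b \<in> B_std m n \<Longrightarrow> x \<in> carrier (grpG m n) \<Longrightarrow> p \<in> P_std m n \<Longrightarrow>
      f (x \<otimes>\<^bsub>grpG m n\<^esub> p) = om b * f (b \<otimes>\<^bsub>grpG m n\<^esub> x) * ch p"
begin

lemma one_B: "(1\<^sub>m (2*m), 1\<^sub>m (2*n)) \<in> B_std m n"
  by (simp add: B_std_def one_borel)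

lemma one_P: "(1\<^sub>m (2*m), 1\<^sub>m (2*n)) \<in> P_std m n"
  using m n by (intro Fixing_P_std one_Fixing)

lemma om_one: "om (1\<^sub>m (2*m), 1\<^sub>m (2*n)) = 1"
  using om_mult[OF one_B one_B] om_nz[OF one_B] by simp

lemma ch_one: "ch (1\<^sub>m (2*m), 1\<^sub>m (2*n)) = 1"
  using ch_mult[OF one_P one_P] ch_nz[OF one_P] by simp

lemma f_left:
  assumes "(b, b') \<in> B_std m n" "X \<in> carrier (Sp m)" "Y \<in> carrier (Sp n)"
  shows "f (X, Y) = om (b, b') * f (b * X, b' * Y)"
  using semi[OF assms(1) _ one_P, of "(X, Y)"] assms(2,3) ch_one
  by (simp add: grpG_carrier right_mult_one_mat[OF Sp_carrier_mat])

lemma f_right: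
  assumes "(p, p') \<in> P_std m n" "X \<in> carrier (Sp m)" "Y \<in> carrier (Sp n)"
  shows "f (X * p, Y * p') = f (X, Y) * ch (p, p')"
  using semi[OF one_B _ assms(1), of "(X, Y)"] assms(2,3) om_one
  by (simp add: grpG_carrier left_mult_one_mat[OF Sp_carrier_mat])

text \<open>A polynomial in \<open>t\<close> without complex zeros is constant, and at \<open>t = 0\<close> its value is one.\<close>

lemma eichler_curve_trivial:
  assumes g: "p \<in> poly_fun m n" "\<And>t. eichler_curve m n e w e' w' t \<in> S" "\<And>x. x \<in> S \<Longrightarrow> g x = p x"
    "\<And>x. x \<in> S \<Longrightarrow> g x \<noteq> 0" "g (1\<^sub>m (2*m), 1\<^sub>m (2*n)) = (1::complex)"
  shows "g (eichler m e w, eichler n e' w') = 1"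
proof -
  have "(\<lambda>t. p (eichler_curve m n e w e' w' t)) \<in> Poly1"
    using eichler_curve_Poly1[OF g(1) one_carrier_mat one_carrier_mat, of e w e' w']
    by (simp add: eichler_curve_def right_mult_one_mat[OF eichler_carrier])
  moreover have "p (eichler_curve m n e w e' w' t) \<noteq> 0" for t
    using g(2-4) by metis
  ultimately have "p (eichler_curve m n e w e' w' 1) = p (eichler_curve m n e w e' w' 0)"
    by (rule nonvanishing_Poly1)
  then have "g (eichler_curve m n e w e' w' 1) = g (eichler_curve m n e w e' w' 0)"
    using g(2,3) by simp
  then show ?thesis using g(5) by (simp add: eichler_curve_def eichler_zero)
qed

lemma om_eichler_curve:
  assumes "\<And>t. eichler_curve m n e w e' w' t \<in> B_std m n"
  shows "om (eichler m e w, eichler n e' w') = 1"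
proof -
  obtain p where p: "p \<in> poly_fun m n" "\<And>x. x \<in> B_std m n \<Longrightarrow> om x = p x" using om_reg by blast
  show ?thesis by (rule eichler_curve_trivial[OF p(1) assms p(2) om_nz om_one])
qed

lemma ch_eichler_curve:
  assumes "\<And>t. eichler_curve m n e w e' w' t \<in> P_std m n"
  shows "ch (eichler m e w, eichler n e' w') = 1"
proof -
  obtain p where p: "p \<in> poly_fun m n" "\<And>x. x \<in> P_std m n \<Longrightarrow> ch x = p x" using ch_reg by blast
  show ?thesis by (rule eichler_curve_trivial[OF p(1) assms p(2) ch_nz ch_one])
qed

lemma f_unipotent_left1:
  assumes "X \<in> carrier (Sp m)" "Y \<in> carrier (Sp n)" "a < m" "\<forall>b\<le>a. w (Suc (2*b)) = 0"
  shows "f (eichler m (unitv (2*a)) w * X, Y) = f (X, Y)"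
proof -
  have B: "eichler_curve m n (unitv (2*a)) w (\<lambda>i. 0) (\<lambda>i. 0) t \<in> B_std m n" for t
    using eichler_borel[OF assms(3,4)] by (simp add: eichler_curve_def eichler_zero B_std_def one_borel)
  then have "om (eichler m (unitv (2*a)) w, eichler n (\<lambda>i. 0) (\<lambda>i. 0)) = 1" by (rule om_eichler_curve)
  then show ?thesis using f_left[OF _ assms(1,2), of "eichler m (unitv (2*a)) w" "1\<^sub>m (2*n)"] B[of 1] assms(2)
    by (simp add: eichler_curve_def eichler_zero left_mult_one_mat[OF Sp_carrier_mat])
qed

lemma f_unipotent_left2:
  assumes "X \<in> carrier (Sp m)" "Y \<in> carrier (Sp n)" "a < n" "\<forall>b\<le>a. w (Suc (2*b)) = 0"
  shows "f (X, eichler n (unitv (2*a)) w * Y) = f (X, Y)"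
proof -
  have B: "eichler_curve m n (\<lambda>i. 0) (\<lambda>i. 0) (unitv (2*a)) w t \<in> B_std m n" for t
    using eichler_borel[OF assms(3,4)] by (simp add: eichler_curve_def eichler_zero B_std_def one_borel)
  then have "om (eichler m (\<lambda>i. 0) (\<lambda>i. 0), eichler n (unitv (2*a)) w) = 1" by (rule om_eichler_curve)
  then show ?thesis using f_left[OF _ assms(1,2), of "1\<^sub>m (2*m)" "eichler n (unitv (2*a)) w"] B[of 1] assms(1)
    by (simp add: eichler_curve_def eichler_zero left_mult_one_mat[OF Sp_carrier_mat])
qed

text \<open>\<open>Fixing m 1\<close> and \<open>Fixing n 1\<close> are generated by Eichler transformations, on which \<open>ch\<close> is trivial.\<close>

lemma ch_Fixing:
  assumes "A \<in> Fixing m 1" "B \<in> Fixing n 1"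
  shows "ch (A, B) = 1"
proof -
  have mul: "ch (E * A, F * B) = ch (E, F) * ch (A, B)"
    if "A \<in> Fixing m 1" "B \<in> Fixing n 1" "E \<in> Fixing m 1" "F \<in> Fixing n 1" for A B E F
    using ch_mult[OF Fixing_P_std[OF that(3,4)] Fixing_P_std[OF that(1,2)]] by simp
  have one: "1\<^sub>m (2*m) \<in> Fixing m 1" "1\<^sub>m (2*n) \<in> Fixing n 1" using m n by (simp_all add: one_Fixing)
  have supp: "(\<lambda>i. t * e i) \<in> supp_in 1 k" if "e \<in> supp_in 1 k" for t e k
    using that by (simp add: supp_in_def)
  have fst: "ch (A, 1\<^sub>m (2*n)) = 1" if "A \<in> eichler_gen m 1" for A
    using that
  proof (induction rule: eichler_gen.induct)
    case (mult A e w)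
    have E: "eichler m (\<lambda>i. t * e i) w \<in> Fixing m 1" for t
      using mult m by (intro eichler_Fixing_one) (simp_all add: supp Om_scale_left)
    have "ch (eichler m e w, eichler n (\<lambda>i. 0) (\<lambda>i. 0)) = 1"
      by (rule ch_eichler_curve) (simp add: eichler_curve_def eichler_zero Fixing_P_std E one)
    then have "ch (eichler m e w, 1\<^sub>m (2*n)) = 1" by (simp add: eichler_zero)
    then show ?case
      using mul[OF eichler_gen_Fixing[OF mult(1) m] one(2) _ one(2), of "eichler m e w"] E[of 1] mult.IH by simp
  qed (rule ch_one)
  have snd: "ch (1\<^sub>m (2*m), B) = 1" if "B \<in> eichler_gen n 1" for B
    using that
  proof (induction rule: eichler_gen.induct)
    case (mult B e w)
    have E: "eichler n (\<lambda>i. t * e i) w \<in> Fixing n 1" for t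
      using mult n by (intro eichler_Fixing_one) (simp_all add: supp Om_scale_left)
    have "ch (eichler m (\<lambda>i. 0) (\<lambda>i. 0), eichler n e w) = 1"
      by (rule ch_eichler_curve) (simp add: eichler_curve_def eichler_zero Fixing_P_std E one)
    then have "ch (1\<^sub>m (2*m), eichler n e w) = 1" by (simp add: eichler_zero)
    then show ?case
      using mul[OF one(1) eichler_gen_Fixing[OF mult(1) n] one(1), of "eichler n e w"] E[of 1] mult.IH by simp
  qed (rule ch_one)
  have "ch (A, B) = ch (A, 1\<^sub>m (2*n)) * ch (1\<^sub>m (2*m), B)"
    using mul[OF one(1) assms(2) assms(1) one(2)] assms
    by (simp add: Fixing_def right_mult_one_mat[OF Sp_carrier_mat] left_mult_one_mat[OF Sp_carrier_mat])
  also have "\<dots> = 1"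
  proof -
    have "A \<in> eichler_gen m 1" "B \<in> eichler_gen n 1"
      using assms Fixing_subset_eichler_gen[OF m] Fixing_subset_eichler_gen[OF n] by blast+
    then show ?thesis using fst snd by simp
  qed
  finally show ?thesis .
qed

lemma f_same_cols:
  assumes X: "X \<in> carrier (Sp m)" "X' \<in> carrier (Sp m)" and Y: "Y \<in> carrier (Sp n)" "Y' \<in> carrier (Sp n)"
    and "\<And>i. i < 2 \<Longrightarrow> colv X' i = colv X i" "\<And>i. i < 2 \<Longrightarrow> colv Y' i = colv Y i"
  shows "f (X', Y') = f (X, Y)"
proof -
  obtain A where A: "A \<in> Fixing m 1" "X' = X * A" using Sp_same_cols[OF X m] assms(5) by auto
  obtain B where B: "B \<in> Fixing n 1" "Y' = Y * B" using Sp_same_cols[OF Y n] assms(6) by auto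
  show ?thesis using f_right[OF Fixing_P_std[OF A(1) B(1)] X(1) Y(1)] ch_Fixing[OF A(1) B(1)] A B by simp
qed

end

definition lower :: "nat \<Rightarrow> complex \<Rightarrow> cmat" where
  "lower k c = eichler k (\<lambda>i. (- c/2) * unitv 1 i) (unitv 1)"

lemma lower_Sp: "lower k c \<in> carrier (Sp k)"
  unfolding lower_def by (intro eichler_Sp) (simp only: Om_scale_left Om_self mult_zero_right)

lemma lower_cols:
  assumes "1 \<le> k"
  shows "colv (lower k c) 0 = (\<lambda>i. unitv 0 i + c * unitv 1 i)" "colv (lower k c) 1 = unitv 1"
proof -
  have nth: "colv (lower k c) j i = (if i < 2*k then unitv j i - c * Om k (unitv 1) (unitv j) * unitv 1 i else 0)"
    if "j < 2*k" for i j
  proof (cases "i < 2*k")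
    case True
    then have "colv (lower k c) j i = eichler_op k (\<lambda>i. (- c/2) * unitv 1 i) (unitv 1) (unitv j) i"
      using that by (simp add: lower_def colv_def eichler_nth)
    also have "\<dots> = unitv j i - c * Om k (unitv 1) (unitv j) * unitv 1 i"
      unfolding eichler_op_def Om_scale_left by (simp add: field_simps)
    finally show ?thesis using True by simp
  qed (simp add: lower_def colv_def)
  show "colv (lower k c) 0 = (\<lambda>i. unitv 0 i + c * unitv 1 i)" "colv (lower k c) 1 = unitv 1"
    using assms by (auto simp: fun_eq_iff nth Om_unitv_left unitv_apply)
qed

lemma mult_lower_cols:
  assumes X: "X \<in> carrier (Sp k)" and k: "1 \<le> k"
  shows "colv (X * lower k c) 0 = (\<lambda>i. colv X 0 i + c * colv X 1 i)" "colv (X * lower k c) 1 = colv X 1"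
  using colv_mult[OF Sp_carrier_mat[OF X] Sp_carrier_mat[OF lower_Sp], of _ c] k
  by (simp_all add: lower_cols mat_act_add mat_act_scale mat_act_unitv[OF Sp_carrier_mat[OF X]])

context semi_invariant
begin

text \<open>The unipotent radical of the Borel subgroup of \<open>SL(2)\<close> adds the same multiple of the
second column to the first one in both components.\<close>

lemma f_cols:
  assumes X: "X \<in> carrier (Sp m)" "X' \<in> carrier (Sp m)" and Y: "Y \<in> carrier (Sp n)" "Y' \<in> carrier (Sp n)"
    and "colv X' 0 = (\<lambda>i. colv X 0 i + c * colv X 1 i)" "colv X' 1 = colv X 1"
    and "colv Y' 0 = (\<lambda>i. colv Y 0 i + c * colv Y 1 i)" "colv Y' 1 = colv Y 1"
  shows "f (X', Y') = f (X, Y)"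
proof -
  have P: "(lower m c, lower n c) \<in> P_std m n" for c
  proof -
    have "par_cols (lower m c) 1 c" "par_cols (lower n c) 1 c"
      using lower_cols[OF m] lower_cols[OF n] by (simp_all add: par_cols_def)
    then show ?thesis by (intro P_stdI[of _ _ _ 1 c]) (simp_all add: grpG_carrier lower_Sp)
  qed
  have "ch (lower m c, lower n c) = 1"
    unfolding lower_def
  proof (rule ch_eichler_curve)
    fix t
    show "eichler_curve m n (\<lambda>i. - c/2 * unitv 1 i) (unitv 1) (\<lambda>i. - c/2 * unitv 1 i) (unitv 1) t \<in> P_std m n"
      using P[of "t * c"] by (simp add: eichler_curve_def lower_def mult.assoc)
  qed
  then have "f (X * lower m c, Y * lower n c) = f (X, Y)"
    using f_right[OF P X(1) Y(1), of c] by simp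
  moreover have "f (X', Y') = f (X * lower m c, Y * lower n c)"
  proof (rule f_same_cols)
    show "X * lower m c \<in> carrier (Sp m)" "Y * lower n c \<in> carrier (Sp n)"
      using X Y by (simp_all add: Sp_mult_closed lower_Sp)
    fix i :: nat assume "i < 2"
    then have "i = 0 \<or> i = 1" by auto
    then show "colv X' i = colv (X * lower m c) i" "colv Y' i = colv (Y * lower n c) i"
      using mult_lower_cols[OF X(1) m] mult_lower_cols[OF Y(1) n] assms(5-) by auto
  qed (use X Y in auto)
  ultimately show ?thesis by simp
qed

end

section \<open>Normal form of a generic element\<close>

text \<open>The minor in the rows that are dual to \<open>e 0\<close> and \<open>e 2\<close>; for \<open>k = 1\<close> there is no second row, and the
value \<open>1\<close> makes this semi-invariant harmless.\<close>

definition minor :: "nat \<Rightarrow> cmat \<Rightarrow> complex" where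
  "minor k X = (if k > 1 then X $$ (1,0) * X $$ (3,1) - X $$ (3,0) * X $$ (1,1) else 1)"

lemma colv_nth: "A \<in> carrier_mat (2*k) (2*k) \<Longrightarrow> i < 2*k \<Longrightarrow> colv A j i = A $$ (i,j)"
  by (simp add: colv_def)

lemma colv_eichler_mult_eq:
  assumes A: "A \<in> carrier_mat (2*k) (2*k)" and j: "j < 2*k"
  shows "colv (eichler k e w * A) j i = (if i < 2*k then eichler_op k e w (colv A j) i else 0)"
  using colv_eichler_mult[OF A _ j] A by (auto simp: colv_def)

text \<open>Two unipotent elements of the Borel subgroup suffice.  The first one, with \<open>e = e 0\<close>, clears the column
\<open>q\<close> up to its entry in row \<open>1\<close>; then \<open>\<omega>(p, q) = 1\<close> determines \<open>p 0\<close>.  The second one,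
with \<open>e = e 2\<close>, fixes \<open>q\<close> and clears the entry of \<open>p\<close> in row \<open>2\<close> and those below row \<open>3\<close>.
The function \<open>\<phi>\<close> stands for any invariant of these elements.\<close>

lemma normal_form:
  assumes X: "X \<in> carrier (Sp k)" and k: "1 \<le> k" and q1: "X $$ (1,1) \<noteq> 0" and mnr: "minor k X \<noteq> 0"
    and inv: "\<And>X a w. X \<in> carrier (Sp k) \<Longrightarrow> a < k \<Longrightarrow> \<forall>b\<le>a. w (Suc (2*b)) = 0 \<Longrightarrow>
      \<phi> (eichler k (unitv (2*a)) w * X) = \<phi> X"
  shows "\<exists>X'\<in>carrier (Sp k). \<phi> X' = \<phi> X \<and> colv X' 1 = (\<lambda>i. X $$ (1,1) * unitv 1 i) \<and>
    colv X' 0 = (\<lambda>i. 1 / X $$ (1,1) * unitv 0 i + X $$ (1,0) * unitv 1 i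
      - (if k > 1 then minor k X / X $$ (1,1) else 0) * unitv 3 i)"
proof -
  define p q where "p = colv X 0" and "q = colv X 1"
  have cm: "X \<in> carrier_mat (2*k) (2*k)" using X by (rule Sp_carrier_mat)
  have q1': "q 1 = X $$ (1,1)" and p1: "p 1 = X $$ (1,0)"
    using cm k by (simp_all add: p_def q_def colv_def)
  have q10: "q 1 \<noteq> 0" using q1 q1' by simp
  have out: "p i = 0" "q i = 0" if "2*k \<le> i" for i using that cm by (simp_all add: p_def q_def colv_def)
  \<comment> \<open>\<open>w = - q / q 1\<close> except that \<open>w 1 = 0\<close> and \<open>w 0\<close> is halved, because \<open>\<omega>(w, q) e 0\<close> also contributes to row \<open>0\<close>.\<close>
  define w where "w = (\<lambda>i. (-1/q 1) * q i + (q 0/(2*q 1)) * unitv 0 i + unitv 1 i)"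
  have w1: "w 1 = 0" using q10 by (simp add: w_def unitv_apply)
  have wq: "Om k w q = - q 0 / 2"
    unfolding w_def Om_linear using k q10 by (simp add: Om_unitv_left field_simps flip: One_nat_def)
  have e0: "Om k (unitv 0) v = v 1" for v using k by (simp add: Om_unitv_left One_nat_def)
  define X1 where "X1 = eichler k (unitv 0) w * X"
  have X1: "X1 \<in> carrier (Sp k)"
    unfolding X1_def using X w1 by (intro Sp_mult_closed eichler_Sp) (simp_all add: e0)
  have \<phi>1: "\<phi> X1 = \<phi> X" unfolding X1_def using inv[OF X, of 0 w] w1 k by (simp add: One_nat_def)
  have col1: "colv X1 1 = (\<lambda>i. q 1 * unitv 1 i)"
  proof
    fix i
    have "colv X1 1 i = (if i < 2*k then q i - q 0 / 2 * unitv 0 i + q 1 * w i else 0)"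
      unfolding X1_def using colv_eichler_mult_eq[OF cm] k by (simp add: eichler_op_def e0 wq flip: q_def)
    then show "colv X1 1 i = q 1 * unitv 1 i"
      using q10 k out by (auto simp: w_def unitv_apply field_simps)
  qed
  define p' where "p' = colv X1 0"
  have p': "p' i = (if i < 2*k then p i + Om k w p * unitv 0 i + p 1 * w i else 0)" for i
    unfolding p'_def X1_def using colv_eichler_mult_eq[OF cm] k by (simp add: eichler_op_def e0 flip: p_def)
  have out': "p' i = 0" if "2*k \<le> i" for i using that by (simp add: p')
  have p'1: "p' 1 = p 1" using p'[of 1] w1 k by (simp add: unitv_apply)
  have p'0: "p' 0 = 1 / q 1"
  proof -
    have "Om k p' (\<lambda>i. q 1 * unitv 1 i) = Om k (unitv 0) (unitv 1)"
      using Sp_form[OF X1, of 0 1] k unfolding col1 p'_def by simp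
    moreover have "Om k (unitv 0) (unitv 1) = 1" by (simp add: e0 unitv_apply)
    moreover have "Om k p' (unitv 1) = p' 0" using k by (simp add: Om_unitv_right)
    ultimately have "q 1 * p' 0 = 1" by (simp add: Om_scale_right)
    then show ?thesis using q10 by (simp add: field_simps)
  qed
  show ?thesis
  proof (cases "k > 1")
    case False
    have "p' i = (1 / q 1) * unitv 0 i + p 1 * unitv 1 i" for i
      using False k p'0 p'1 out'[of i] by (cases "i = 0 \<or> i = 1") (auto simp: unitv_apply)
    then show ?thesis using False X1 \<phi>1 col1 by (intro bexI[of _ X1]) (simp_all add: fun_eq_iff q1' p1 flip: p'_def)
  next
    case True
    have p'3: "p' 3 = - minor k X / q 1"
      using True q10 p'[of 3] cm by (simp add: minor_def w_def unitv_apply p_def q_def colv_def field_simps One_nat_def)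
    then have p'30: "p' 3 \<noteq> 0" using mnr q10 by simp
    \<comment> \<open>\<open>w' = - p' / p' 3\<close>, with the entries \<open>0, 1, 3\<close> removed and the entry \<open>2\<close> halved for the same reason.\<close>
    define w' where "w' = (\<lambda>i. (-1/p' 3) * p' i + (p' 2/(2*p' 3)) * unitv 2 i + unitv 3 i
        + (p' 0/p' 3) * unitv 0 i + (p' 1/p' 3) * unitv 1 i)"
    have w'0: "w' 0 = 0" "w' 1 = 0" "w' 3 = 0" using p'30 by (simp_all add: w'_def unitv_apply)
    have e2: "Om k (unitv 2) v = v 3" for v using True by (simp add: Om_unitv_left)
    have w'p: "Om k w' p' = - p' 2 / 2"
      unfolding w'_def Om_linear using True p'30 by (simp add: Om_unitv_left One_nat_def)
    define X2 where "X2 = eichler k (unitv 2) w' * X1"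
    have X2: "X2 \<in> carrier (Sp k)"
      unfolding X2_def using X1 w'0 by (intro Sp_mult_closed eichler_Sp) (simp_all add: e2)
    have cm1: "X1 \<in> carrier_mat (2*k) (2*k)" using X1 by (rule Sp_carrier_mat)
    have "\<forall>b\<le>1. w' (Suc (2*b)) = 0"
    proof (intro allI impI)
      fix b :: nat assume "b \<le> 1"
      then have "b = 0 \<or> b = 1" by auto
      then show "w' (Suc (2*b)) = 0"
        by (elim disjE) (use w'0 in \<open>simp_all flip: One_nat_def\<close>)
    qed
    then have \<phi>2: "\<phi> X2 = \<phi> X1" unfolding X2_def using inv[OF X1, of 1 w'] True by simp
    have col21: "colv X2 1 = (\<lambda>i. q 1 * unitv 1 i)"
    proof
      fix i
      have "Om k w' (\<lambda>i. q 1 * unitv 1 i) = 0"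
        using w'0 k by (simp add: Om_scale_right Om_unitv_right One_nat_def)
      then show "colv X2 1 i = q 1 * unitv 1 i"
        unfolding X2_def using colv_eichler_mult_eq[OF cm1] k
        by (simp add: eichler_op_def e2 col1) (simp add: unitv_apply)
    qed
    have col20: "colv X2 0 i = p' 0 * unitv 0 i + p' 1 * unitv 1 i + p' 3 * unitv 3 i" for i
    proof -
      have "colv X2 0 i = (if i < 2*k then p' i - p' 2 / 2 * unitv 2 i + p' 3 * w' i else 0)"
        unfolding X2_def using colv_eichler_mult_eq[OF cm1] k by (simp add: eichler_op_def e2 w'p flip: p'_def)
      then show ?thesis using p'30 True by (auto simp: w'_def unitv_apply field_simps)
    qed
    show ?thesis
      using True X2 \<phi>1 \<phi>2 col21 col20 p'0 p'1 p'3
      by (intro bexI[of _ X2]) (simp_all add: fun_eq_iff q1' p1)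
  qed
qed

definition cross :: "cmat \<times> cmat \<Rightarrow> complex" where
  "cross x = fst x $$ (1,0) * snd x $$ (1,1) - fst x $$ (1,1) * snd x $$ (1,0)"

definition generic :: "nat \<Rightarrow> nat \<Rightarrow> cmat \<times> cmat \<Rightarrow> bool" where
  "generic m n x \<longleftrightarrow> fst x $$ (1,1) \<noteq> 0 \<and> snd x $$ (1,1) \<noteq> 0 \<and> cross x \<noteq> 0 \<and>
     minor m (fst x) \<noteq> 0 \<and> minor n (snd x) \<noteq> 0"

context semi_invariant
begin

text \<open>The normal forms of the two points differ at most in the entries \<open>p 1\<close> and \<open>r 1\<close>.  As \<open>p 1 s 1 - q 1 r 1\<close>
is the same for both, one element of the unipotent radical of \<open>P\<close> accounts for both differences.\<close>

lemma f_invariants: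
  assumes X: "X \<in> carrier (Sp m)" "X' \<in> carrier (Sp m)" and Y: "Y \<in> carrier (Sp n)" "Y' \<in> carrier (Sp n)"
    and gen: "generic m n (X, Y)"
    and eq: "X' $$ (1,1) = X $$ (1,1)" "Y' $$ (1,1) = Y $$ (1,1)" "cross (X', Y') = cross (X, Y)"
      "minor m X' = minor m X" "minor n Y' = minor n Y"
  shows "f (X', Y') = f (X, Y)"
proof -
  have nf: "\<exists>X1\<in>carrier (Sp m). \<exists>Y1\<in>carrier (Sp n). f (X1, Y1) = f (X, Y) \<and>
      colv X1 1 = (\<lambda>i. X $$ (1,1) * unitv 1 i) \<and>
      colv X1 0 = (\<lambda>i. 1 / X $$ (1,1) * unitv 0 i + X $$ (1,0) * unitv 1 i
        - (if m > 1 then minor m X / X $$ (1,1) else 0) * unitv 3 i) \<and>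
      colv Y1 1 = (\<lambda>i. Y $$ (1,1) * unitv 1 i) \<and>
      colv Y1 0 = (\<lambda>i. 1 / Y $$ (1,1) * unitv 0 i + Y $$ (1,0) * unitv 1 i
        - (if n > 1 then minor n Y / Y $$ (1,1) else 0) * unitv 3 i)"
    if X: "X \<in> carrier (Sp m)" and Y: "Y \<in> carrier (Sp n)" and gen: "generic m n (X, Y)" for X Y
  proof -
    have g: "X $$ (1,1) \<noteq> 0" "Y $$ (1,1) \<noteq> 0" "minor m X \<noteq> 0" "minor n Y \<noteq> 0"
      using gen by (simp_all add: generic_def)
    obtain X1 where X1: "X1 \<in> carrier (Sp m)" "f (X1, Y) = f (X, Y)"
      "colv X1 1 = (\<lambda>i. X $$ (1,1) * unitv 1 i)"
      "colv X1 0 = (\<lambda>i. 1 / X $$ (1,1) * unitv 0 i + X $$ (1,0) * unitv 1 i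
        - (if m > 1 then minor m X / X $$ (1,1) else 0) * unitv 3 i)"
      using normal_form[OF X m g(1,3), of "\<lambda>X. f (X, Y)"] f_unipotent_left1[OF _ Y] by blast
    obtain Y1 where Y1: "Y1 \<in> carrier (Sp n)" "f (X1, Y1) = f (X1, Y)"
      "colv Y1 1 = (\<lambda>i. Y $$ (1,1) * unitv 1 i)"
      "colv Y1 0 = (\<lambda>i. 1 / Y $$ (1,1) * unitv 0 i + Y $$ (1,0) * unitv 1 i
        - (if n > 1 then minor n Y / Y $$ (1,1) else 0) * unitv 3 i)"
      using normal_form[OF Y n g(2,4), of "\<lambda>Y. f (X1, Y)"] f_unipotent_left2[OF X1(1)] by blast
    show ?thesis
      by (rule bexI[OF _ X1(1)], rule bexI[OF _ Y1(1)]) (simp only: X1(2-) Y1(2-) simp_thms)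
  qed
  obtain X1 Y1 where 1: "X1 \<in> carrier (Sp m)" "Y1 \<in> carrier (Sp n)" "f (X1, Y1) = f (X, Y)"
    "colv X1 1 = (\<lambda>i. X $$ (1,1) * unitv 1 i)"
    "colv X1 0 = (\<lambda>i. 1 / X $$ (1,1) * unitv 0 i + X $$ (1,0) * unitv 1 i
        - (if m > 1 then minor m X / X $$ (1,1) else 0) * unitv 3 i)"
    "colv Y1 1 = (\<lambda>i. Y $$ (1,1) * unitv 1 i)"
    "colv Y1 0 = (\<lambda>i. 1 / Y $$ (1,1) * unitv 0 i + Y $$ (1,0) * unitv 1 i
        - (if n > 1 then minor n Y / Y $$ (1,1) else 0) * unitv 3 i)"
    using nf[OF X(1) Y(1) gen] by blast
  have gen': "generic m n (X', Y')" using gen eq by (simp add: generic_def)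
  obtain X2 Y2 where 2: "X2 \<in> carrier (Sp m)" "Y2 \<in> carrier (Sp n)" "f (X2, Y2) = f (X', Y')"
    "colv X2 1 = (\<lambda>i. X $$ (1,1) * unitv 1 i)"
    "colv X2 0 = (\<lambda>i. 1 / X $$ (1,1) * unitv 0 i + X' $$ (1,0) * unitv 1 i
        - (if m > 1 then minor m X / X $$ (1,1) else 0) * unitv 3 i)"
    "colv Y2 1 = (\<lambda>i. Y $$ (1,1) * unitv 1 i)"
    "colv Y2 0 = (\<lambda>i. 1 / Y $$ (1,1) * unitv 0 i + Y' $$ (1,0) * unitv 1 i
        - (if n > 1 then minor n Y / Y $$ (1,1) else 0) * unitv 3 i)"
    using nf[OF X(2) Y(2) gen'] unfolding eq by blast
  define c where "c = (X' $$ (1,0) - X $$ (1,0)) / X $$ (1,1)"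
  have g: "X $$ (1,1) \<noteq> 0" "Y $$ (1,1) \<noteq> 0" using gen by (simp_all add: generic_def)
  have cX: "X' $$ (1,0) = X $$ (1,0) + c * X $$ (1,1)" using g by (simp add: c_def)
  have "X' $$ (1,0) * Y $$ (1,1) - X $$ (1,1) * Y' $$ (1,0) = X $$ (1,0) * Y $$ (1,1) - X $$ (1,1) * Y $$ (1,0)"
    using eq(3) by (simp add: cross_def eq)
  then have "X $$ (1,1) * (Y $$ (1,0) + c * Y $$ (1,1) - Y' $$ (1,0)) = 0"
    unfolding cX by (simp add: algebra_simps)
  then have cY: "Y' $$ (1,0) = Y $$ (1,0) + c * Y $$ (1,1)" using g by simp
  have "f (X2, Y2) = f (X1, Y1)"
  proof (rule f_cols[OF 1(1) 2(1) 1(2) 2(2)])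
    show "colv X2 0 = (\<lambda>i. colv X1 0 i + c * colv X1 1 i)"
      unfolding 1(4,5) 2(5) cX by (simp add: algebra_simps)
    show "colv Y2 0 = (\<lambda>i. colv Y1 0 i + c * colv Y1 1 i)"
      unfolding 1(6,7) 2(7) cY by (simp add: algebra_simps)
  qed (simp_all only: 1 2)
  then show ?thesis using 1(3) 2(3) by simp
qed

end

section \<open>Torus elements and test curves\<close>

definition diag_entry :: "(nat \<Rightarrow> complex) \<Rightarrow> nat \<Rightarrow> complex" where
  "diag_entry a i = (if even i then a (i div 2) else 1 / a (i div 2))"

definition Dmat :: "nat \<Rightarrow> (nat \<Rightarrow> complex) \<Rightarrow> cmat" where
  "Dmat k a = mat (2*k) (2*k) (\<lambda>(i,j). if i = j then diag_entry a i else 0)"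

lemma Dmat_carrier [simp]: "Dmat k a \<in> carrier_mat (2*k) (2*k)"
  by (simp add: Dmat_def)

lemma Dmat_nth: "i < 2*k \<Longrightarrow> j < 2*k \<Longrightarrow> Dmat k a $$ (i,j) = (if i = j then diag_entry a i else 0)"
  by (simp add: Dmat_def)

lemma colv_Dmat: "j < 2*k \<Longrightarrow> colv (Dmat k a) j = (\<lambda>i. diag_entry a j * unitv j i)"
  by (auto simp: colv_def Dmat_def unitv_apply fun_eq_iff)

lemma Dmat_Sp:
  assumes "\<And>l. a l \<noteq> 0"
  shows "Dmat k a \<in> carrier (Sp k)"
proof -
  have "diag_entry a j * (diag_entry a i * Om k (unitv i) (unitv j)) = Om k (unitv i) (unitv j)" for i j
  proof (cases "even i")
    case True
    then show ?thesis using assms by (auto simp: Om_unitv_left unitv_apply diag_entry_def)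
  next
    case False
    then obtain l where "i = Suc (2*l)" by (elim oddE) simp
    then show ?thesis using assms by (auto simp: Om_unitv_left unitv_apply diag_entry_def)
  qed
  then show ?thesis
    by (simp add: Sp_iff colv_Dmat Om_scale_left Om_scale_right)
qed

lemma Dmat_diagonal: "diagonal_mat (Dmat k a)"
  by (simp add: diagonal_mat_def Dmat_def)

lemma Dmat_borel: "(\<And>l. a l \<noteq> 0) \<Longrightarrow> Dmat k a \<in> Sp_borel k"
  by (auto simp: Sp_borel_def Dmat_Sp Dmat_nth)

lemma Dmat_mult_nth:
  assumes "X \<in> carrier_mat (2*k) (2*k)" "i < 2*k" "j < 2*k"
  shows "(Dmat k a * X) $$ (i,j) = diag_entry a i * X $$ (i,j)"
proof -
  have "(Dmat k a * X) $$ (i,j) = (\<Sum>l<2*k. Dmat k a $$ (i,l) * X $$ (l,j))"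
    using assms Dmat_carrier[of k a] by (simp add: scalar_prod_def atLeast0LessThan Dmat_def)
  also have "\<dots> = (\<Sum>l<2*k. if l = i then diag_entry a i * X $$ (i,j) else 0)"
    using assms by (intro sum.cong) (auto simp: Dmat_nth)
  also have "\<dots> = diag_entry a i * X $$ (i,j)" using assms by simp
  finally show ?thesis .
qed

lemma mult_Dmat_nth:
  assumes "X \<in> carrier_mat (2*k) (2*k)" "i < 2*k" "j < 2*k"
  shows "(X * Dmat k a) $$ (i,j) = X $$ (i,j) * diag_entry a j"
proof -
  have "colv (X * Dmat k a) j i = (diag_entry a j) * colv X j i"
    using colv_mult[OF assms(1) Dmat_carrier assms(3)] mat_act_unitv[OF assms(1,3)]
    by (simp add: colv_Dmat[OF assms(3)] mat_act_scale)
  then show ?thesis using assms by (simp add: colv_def Dmat_def del: index_mult_mat(1))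
qed

lemma Dmat_Dmat: "Dmat k a * Dmat k b = Dmat k (\<lambda>l. a l * b l)"
proof (rule eq_matI)
  fix i j assume "i < dim_row (Dmat k (\<lambda>l. a l * b l))" "j < dim_col (Dmat k (\<lambda>l. a l * b l))"
  then have "i < 2*k" "j < 2*k" by (simp_all add: Dmat_def)
  then show "(Dmat k a * Dmat k b) $$ (i,j) = Dmat k (\<lambda>l. a l * b l) $$ (i,j)"
    by (simp add: Dmat_mult_nth Dmat_nth diag_entry_def del: index_mult_mat(1))
qed (simp_all add: Dmat_def)

lemma Dmat_one: "Dmat k (\<lambda>l. 1) = 1\<^sub>m (2*k)"
  by (intro eq_matI) (auto simp: Dmat_def diag_entry_def)

lemma Dmat_cong: "(\<And>l. l < k \<Longrightarrow> a l = b l) \<Longrightarrow> Dmat k a = Dmat k b"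
  by (intro eq_matI) (auto simp: Dmat_def diag_entry_def)

lemma Dmat_par_cols: "1 \<le> k \<Longrightarrow> par_cols (Dmat k a) (a 0) 0"
  by (simp add: par_cols_def colv_Dmat diag_entry_def)

lemma Dmat_Fixing: "1 \<le> k \<Longrightarrow> (\<And>l. a l \<noteq> 0) \<Longrightarrow> a 0 = 1 \<Longrightarrow> Dmat k a \<in> Fixing k 1"
proof -
  assume a: "1 \<le> k" "\<And>l. a l \<noteq> 0" "a 0 = 1"
  have "i = 0 \<or> i = 1" if "i < 2*1" for i :: nat using that by auto
  then show ?thesis using a by (auto simp: Fixing_def Dmat_Sp colv_Dmat diag_entry_def)
qed

lemma minor_scale:
  assumes X: "X \<in> carrier_mat (2*k) (2*k)" and a: "a 0 \<noteq> 0" "a 1 \<noteq> 0" "s \<noteq> 0"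
  shows "minor k (Dmat k a * X * Dmat k (\<lambda>l. if l = 0 then s else 1)) =
    (if k > 1 then minor k X / (a 0 * a 1) else 1)"
proof (cases "k > 1")
  case True
  have c: "Dmat k a * X \<in> carrier_mat (2*k) (2*k)" using X by (rule mult_carrier_mat[OF Dmat_carrier])
  show ?thesis
    using True a by (simp add: minor_def mult_Dmat_nth[OF c] Dmat_mult_nth[OF X] diag_entry_def field_simps
        del: index_mult_mat(1))
qed (simp add: minor_def)

lemma scale_nth:
  assumes X: "X \<in> carrier_mat (2*k) (2*k)" and k: "1 \<le> k"
  shows "(Dmat k a * X * Dmat k (\<lambda>l. if l = 0 then s else 1)) $$ (1,1) = X $$ (1,1) / (a 0 * s)"
    "(Dmat k a * X * Dmat k (\<lambda>l. if l = 0 then s else 1)) $$ (1,0) = X $$ (1,0) * s / a 0"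
proof -
  have c: "Dmat k a * X \<in> carrier_mat (2*k) (2*k)" using X by (rule mult_carrier_mat[OF Dmat_carrier])
  show "(Dmat k a * X * Dmat k (\<lambda>l. if l = 0 then s else 1)) $$ (1,1) = X $$ (1,1) / (a 0 * s)"
    "(Dmat k a * X * Dmat k (\<lambda>l. if l = 0 then s else 1)) $$ (1,0) = X $$ (1,0) * s / a 0"
    using k by (simp_all add: mult_Dmat_nth[OF c] Dmat_mult_nth[OF X] diag_entry_def del: index_mult_mat(1))
qed

definition blk :: "nat \<Rightarrow> complex \<Rightarrow> complex \<Rightarrow> complex \<Rightarrow> complex \<Rightarrow> cmat" where
  "blk k \<alpha> \<beta> \<gamma> \<delta> = mat (2*k) (2*k) (\<lambda>(i,j).
     if j = 0 then \<alpha> * unitv 0 i + \<gamma> * unitv 1 i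
     else if j = 1 then \<beta> * unitv 0 i + \<delta> * unitv 1 i else unitv j i)"

text \<open>An element with prescribed entries \<open>\<gamma>\<close> and \<open>\<delta>\<close> in row \<open>1\<close> of the first two columns and with
minor \<open>c\<close>.  Its entries are polynomials in the parameters.\<close>

definition Zmat :: "nat \<Rightarrow> complex \<Rightarrow> complex \<Rightarrow> complex \<Rightarrow> complex \<Rightarrow> complex \<Rightarrow> cmat" where
  "Zmat k c \<alpha> \<beta> \<gamma> \<delta> = eichler k (unitv 1) (\<lambda>i. c * unitv 3 i) * blk k \<alpha> \<beta> \<gamma> \<delta>"

lemma blk_carrier [simp]: "blk k \<alpha> \<beta> \<gamma> \<delta> \<in> carrier_mat (2*k) (2*k)"
  by (simp add: blk_def)

lemma colv_blk:
  assumes "1 \<le> k" "j < 2*k"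
  shows "colv (blk k \<alpha> \<beta> \<gamma> \<delta>) j = (\<lambda>i. if j = 0 then \<alpha> * unitv 0 i + \<gamma> * unitv 1 i
     else if j = 1 then \<beta> * unitv 0 i + \<delta> * unitv 1 i else unitv j i)"
proof -
  have "1 < 2*k" using assms(1) by linarith
  then show ?thesis using assms(2) by (auto simp: colv_def blk_def fun_eq_iff unitv_apply)
qed

lemma blk_Sp:
  assumes k: "1 \<le> k" and det: "\<alpha> * \<delta> - \<beta> * \<gamma> = 1"
  shows "blk k \<alpha> \<beta> \<gamma> \<delta> \<in> carrier (Sp k)"
proof -
  have e: "Om k (unitv 0) v = v 1" "Om k (unitv 1) v = - v 0" for v
    using k by (simp_all add: Om_unitv_left One_nat_def)
  have r: "Om k v (unitv 0) = - v 1" "Om k v (unitv 1) = v 0" for v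
    using k by (simp_all add: Om_unitv_right One_nat_def)
  have "Om k (colv (blk k \<alpha> \<beta> \<gamma> \<delta>) i) (colv (blk k \<alpha> \<beta> \<gamma> \<delta>) j) = Om k (unitv i) (unitv j)"
    if ij: "i < 2*k" "j < 2*k" for i j
    using k ij det
    by (cases "i = 0"; cases "i = 1"; cases "j = 0"; cases "j = 1")
       (simp_all add: colv_blk Om_add_left Om_add_right Om_scale_left Om_scale_right e r,
        simp_all add: unitv_apply algebra_simps)
  then show ?thesis by (simp add: Sp_iff)
qed

lemma Zmat_Sp:
  assumes k: "1 \<le> k" and det: "\<alpha> * \<delta> - \<beta> * \<gamma> = 1"
  shows "Zmat k c \<alpha> \<beta> \<gamma> \<delta> \<in> carrier (Sp k)"
  unfolding Zmat_def using blk_Sp[OF assms]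
  by (intro Sp_mult_closed eichler_Sp) (auto simp: Om_unitv_left unitv_apply)

lemma Zmat_nth:
  assumes k: "1 \<le> k" and i: "i < 2*k"
  shows "Zmat k c \<alpha> \<beta> \<gamma> \<delta> $$ (i,0) = \<alpha> * unitv 0 i + \<gamma> * unitv 1 i - c * \<alpha> * unitv 3 i"
    "Zmat k c \<alpha> \<beta> \<gamma> \<delta> $$ (i,1) = \<beta> * unitv 0 i + \<delta> * unitv 1 i - c * \<beta> * unitv 3 i"
proof -
  have e: "Om k (unitv 1) v = - v 0" for v
    using k by (simp add: Om_unitv_left One_nat_def)
  have e3: "Om k (\<lambda>i. c * unitv 3 i) v = (if 1 < k then - c * v 2 else 0)" for v
    by (auto simp: Om_scale_left Om_unitv_left)
  show "Zmat k c \<alpha> \<beta> \<gamma> \<delta> $$ (i,0) = \<alpha> * unitv 0 i + \<gamma> * unitv 1 i - c * \<alpha> * unitv 3 i"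
    "Zmat k c \<alpha> \<beta> \<gamma> \<delta> $$ (i,1) = \<beta> * unitv 0 i + \<delta> * unitv 1 i - c * \<beta> * unitv 3 i"
    unfolding Zmat_def
  proof -
    have k': "0 < 2*k" "1 < 2*k" using k by auto
    have b: "blk k \<alpha> \<beta> \<gamma> \<delta> $$ (i,0) = \<alpha> * unitv 0 i + \<gamma> * unitv 1 i"
      "blk k \<alpha> \<beta> \<gamma> \<delta> $$ (i,1) = \<beta> * unitv 0 i + \<delta> * unitv 1 i"
      using i k' by (simp_all add: blk_def)
    show "(eichler k (unitv 1) (\<lambda>i. c * unitv 3 i) * blk k \<alpha> \<beta> \<gamma> \<delta>) $$ (i,0) =
        \<alpha> * unitv 0 i + \<gamma> * unitv 1 i - c * \<alpha> * unitv 3 i"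
      unfolding eichler_mult_nth[OF blk_carrier i k'(1)] colv_blk[OF k k'(1)] e e3 b
      by (simp add: unitv_apply)
    show "(eichler k (unitv 1) (\<lambda>i. c * unitv 3 i) * blk k \<alpha> \<beta> \<gamma> \<delta>) $$ (i,1) =
        \<beta> * unitv 0 i + \<delta> * unitv 1 i - c * \<beta> * unitv 3 i"
      unfolding eichler_mult_nth[OF blk_carrier i k'(2)] colv_blk[OF k k'(2)] e e3 b
      by (simp add: unitv_apply)
  qed
qed

lemma minor_Zmat: "1 \<le> k \<Longrightarrow> \<alpha> * \<delta> - \<beta> * \<gamma> = 1 \<Longrightarrow> minor k (Zmat k c \<alpha> \<beta> \<gamma> \<delta>) = (if k > 1 then c else 1)"
proof -
  assume k: "1 \<le> k" and d: "\<alpha> * \<delta> - \<beta> * \<gamma> = 1"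
  have "\<gamma> * (- (c * \<beta>)) - (- (c * \<alpha>)) * \<delta> = c * (\<alpha> * \<delta> - \<beta> * \<gamma>)" by (simp add: algebra_simps)
  then show ?thesis using k d by (simp add: minor_def Zmat_nth unitv_apply)
qed

lemma Zmat_Poly1:
  assumes k: "1 \<le> k" and ij: "i < 2*k" "j < 2*k"
    and P: "(\<lambda>t. c t) \<in> Poly1" "(\<lambda>t. \<alpha> t) \<in> Poly1" "(\<lambda>t. \<beta> t) \<in> Poly1" "(\<lambda>t. \<gamma> t) \<in> Poly1" "(\<lambda>t. \<delta> t) \<in> Poly1"
  shows "(\<lambda>t. Zmat k (c t) (\<alpha> t) (\<beta> t) (\<gamma> t) (\<delta> t) $$ (i,j)) \<in> Poly1"
proof -
  have col: "(\<lambda>t. colv (blk k (\<alpha> t) (\<beta> t) (\<gamma> t) (\<delta> t)) j i) \<in> Poly1" for i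
    unfolding colv_blk[OF k ij(2)]
    by (cases "j = 0"; cases "j = 1") (auto intro!: Poly1_add Poly1_mult P Poly1_const)
  have Om: "(\<lambda>t. Om k (unitv l) (colv (blk k (\<alpha> t) (\<beta> t) (\<gamma> t) (\<delta> t)) j)) \<in> Poly1" for l
    by (cases "l < 2*k"; cases "even l") (simp_all add: Om_unitv_left col Poly1_uminus Poly1_const)
  have "Zmat k (c t) (\<alpha> t) (\<beta> t) (\<gamma> t) (\<delta> t) $$ (i,j) = colv (blk k (\<alpha> t) (\<beta> t) (\<gamma> t) (\<delta> t)) j i +
      c t * Om k (unitv 3) (colv (blk k (\<alpha> t) (\<beta> t) (\<gamma> t) (\<delta> t)) j) * unitv 1 i +
      Om k (unitv 1) (colv (blk k (\<alpha> t) (\<beta> t) (\<gamma> t) (\<delta> t)) j) * (c t * unitv 3 i)" for t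
    unfolding Zmat_def using ij
    by (simp add: eichler_mult_nth Om_scale_left colv_nth[OF blk_carrier] del: index_mult_mat(1))
  then show ?thesis
    by (simp only:) (intro Poly1_add Poly1_mult P col Om Poly1_const)
qed

text \<open>Evenness comes from \<open>t = -1\<close>.  If \<open>K\<close> were negative, then \<open>t powi (- K) * \<phi> (t^2)\<close> would be a polynomial
that is constant and non-zero away from \<open>0\<close> but vanishes at \<open>0\<close>.\<close>

lemma even_exponent:
  fixes \<phi> :: "complex \<Rightarrow> complex" and K :: int
  assumes "\<phi> \<in> Poly1" and t: "\<And>t. t \<noteq> 0 \<Longrightarrow> \<phi> (t^2) = \<phi> 1 * t powi K" and nz: "\<phi> 1 \<noteq> 0"
  shows "\<exists>k::nat. K = 2 * int k"
proof -
  obtain P where P: "\<And>t. \<phi> t = poly P t" using assms(1) unfolding Poly1_def by auto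
  have "(-1) powi K = (1::complex)" using t[of "-1"] nz by simp
  then have "even K" using power_int_minus_left_odd[of K "1::complex"] by auto
  moreover have "K \<ge> 0"
  proof (rule ccontr)
    assume "\<not> K \<ge> 0"
    define N where "N = nat (- K)"
    have N: "K = - int N" "N > 0" using \<open>\<not> K \<ge> 0\<close> by (simp_all add: N_def)
    \<comment> \<open>\<open>t\<^sup>N P(t\<^sup>2) - \<phi>(1)\<close>\<close>
    define Q where "Q = monom 1 N * pcompose P [:0,0,1:] - [:\<phi> 1:]"
    have "poly Q t = 0" if "t \<noteq> 0" for t
      using t[OF that] that by (simp add: Q_def P poly_pcompose poly_monom N power_int_minus power2_eq_square field_simps)
    then have "UNIV - {0} \<subseteq> {t. poly Q t = 0}" by auto
    moreover have "infinite (UNIV - {0::complex})" using infinite_UNIV_char_0 by (simp add: infinite_remove)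
    ultimately have "Q = 0" using poly_roots_finite[of Q] finite_subset by blast
    then have "poly Q 0 = 0" by simp
    then show False using N nz by (simp add: Q_def poly_monom zero_power)
  qed
  ultimately show ?thesis by (metis evenE nonneg_int_cases zero_le_mult_iff zero_le_numeral zero_less_numeral not_less)
qed

section \<open>Exponents of a semi-invariant function\<close>

lemma colv_eqI2:
  assumes "X \<in> carrier_mat (2*k) (2*k)" "Y \<in> carrier_mat (2*k) (2*k)" "j < 2*k"
    "\<And>i. i < 2*k \<Longrightarrow> X $$ (i,j) = Y $$ (i,j)"
  shows "colv X j = colv Y j"
  using assms by (auto simp: colv_def fun_eq_iff)

definition cochar :: "nat \<Rightarrow> nat set \<Rightarrow> complex \<Rightarrow> cmat" where
  "cochar k S t = Dmat k (\<lambda>l. if l \<in> S then t else 1)"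

lemma cochar_empty: "cochar k {} t = 1\<^sub>m (2*k)"
  by (simp add: cochar_def Dmat_one)

lemma cochar_one: "cochar k S 1 = 1\<^sub>m (2*k)"
  by (simp add: cochar_def Dmat_one cong: if_cong)

lemma cochar_Laur1: "i < 2*k \<Longrightarrow> j < 2*k \<Longrightarrow> (\<lambda>t. cochar k S t $$ (i,j)) \<in> Laur1"
proof -
  assume ij: "i < 2*k" "j < 2*k"
  have "(\<lambda>t. 1 / (if P then t else 1)) \<in> Laur1" for P
    by (cases P) (simp_all add: Laur1_inverse Poly1_Laur1 Poly1_const)
  moreover have "(\<lambda>t. if P then t else 1) \<in> Laur1" for P
    by (cases P) (simp_all add: Poly1_Laur1 Poly1_const Poly1_id)
  moreover have "(\<lambda>t. 0) \<in> Laur1" by (simp add: Poly1_Laur1 Poly1_const)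
  ultimately show ?thesis
    using ij by (cases "i = j"; cases "even i") (simp_all add: cochar_def Dmat_nth diag_entry_def)
qed

definition cocurve where
  "cocurve m n S S' t = (cochar m S t, cochar n S' t)"

lemma cocurve_exponent:
  assumes g: "p \<in> poly_fun m n" "\<And>t. t \<noteq> 0 \<Longrightarrow> cocurve m n S S' t \<in> K" "\<And>x. x \<in> K \<Longrightarrow> g x = p x"
    "\<And>x. x \<in> K \<Longrightarrow> g x \<noteq> 0" "g (1\<^sub>m (2*m), 1\<^sub>m (2*n)) = (1::complex)"
  shows "\<exists>a::int. \<forall>t. t \<noteq> 0 \<longrightarrow> g (cochar m S t, cochar n S' t) = t powi a"
proof -
  have "(\<lambda>t. p (cocurve m n S S' t)) \<in> Laur1"
    by (rule poly_fun_Laur1[OF g(1)]) (simp_all add: cocurve_def cochar_Laur1)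
  moreover have gp: "p (cocurve m n S S' t) = g (cocurve m n S S' t)" if "t \<noteq> 0" for t
    using g(2)[OF that] g(3) by simp
  moreover have "p (cocurve m n S S' t) \<noteq> 0" if "t \<noteq> 0" for t
    using gp[OF that] g(2)[OF that] g(4) by simp
  moreover have "p (cocurve m n S S' 1) = 1"
    using gp[of 1] g(5) by (simp add: cocurve_def cochar_one)
  ultimately obtain a :: int where "\<forall>t. t \<noteq> 0 \<longrightarrow> p (cocurve m n S S' t) = t powi a"
    using nonvanishing_Laur1 by blast
  then have "\<forall>t. t \<noteq> 0 \<longrightarrow> g (cochar m S t, cochar n S' t) = t powi a"
    using gp by (simp add: cocurve_def)
  then show ?thesis ..
qed

definition generic_poly :: "nat \<Rightarrow> nat \<Rightarrow> cmat \<times> cmat \<Rightarrow> complex" where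
  "generic_poly m n = (\<lambda>x. fst x $$ (1,1) * (snd x $$ (1,1) * (cross x * (minor m (fst x) * minor n (snd x)))))"

lemma generic_generic_poly: "generic m n x \<longleftrightarrow> generic_poly m n x \<noteq> 0"
  by (simp add: generic_def generic_poly_def)

lemma cross_poly: "1 \<le> m \<Longrightarrow> 1 \<le> n \<Longrightarrow> cross \<in> poly_fun m n"
  unfolding cross_def[abs_def] by (intro poly_fun_diff poly_fun.mult poly_fun.entry1 poly_fun.entry2) linarith+

lemma minor_poly: "(\<lambda>x. minor m (fst x)) \<in> poly_fun m n" "(\<lambda>x. minor n (snd x)) \<in> poly_fun m n"
proof -
  show "(\<lambda>x. minor m (fst x)) \<in> poly_fun m n"
  proof (cases "m > 1")
    case True
    then show ?thesis
      by (simp only: minor_def if_True) (intro poly_fun_diff poly_fun.mult poly_fun.entry1; linarith)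
  qed (simp add: minor_def poly_fun.const)
  show "(\<lambda>x. minor n (snd x)) \<in> poly_fun m n"
  proof (cases "n > 1")
    case True
    then show ?thesis
      by (simp only: minor_def if_True) (intro poly_fun_diff poly_fun.mult poly_fun.entry2; linarith)
  qed (simp add: minor_def poly_fun.const)
qed

lemma corner_poly:
  "1 \<le> m \<Longrightarrow> (\<lambda>x. fst x $$ (1,1)) \<in> poly_fun m n" "1 \<le> n \<Longrightarrow> (\<lambda>x. snd x $$ (1,1)) \<in> poly_fun m n"
  by (rule poly_fun.entry1 poly_fun.entry2; linarith)+

lemma generic_poly_poly: "1 \<le> m \<Longrightarrow> 1 \<le> n \<Longrightarrow> generic_poly m n \<in> poly_fun m n"
  unfolding generic_poly_def by (intro poly_fun.mult corner_poly cross_poly minor_poly)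

lemma Zmat_corner:
  assumes "1 \<le> k"
  shows "Zmat k c \<alpha> \<beta> \<gamma> \<delta> $$ (1,0) = \<gamma>" "Zmat k c \<alpha> \<beta> \<gamma> \<delta> $$ (1,1) = \<delta>"
proof -
  have "1 < 2*k" using assms by linarith
  then show "Zmat k c \<alpha> \<beta> \<gamma> \<delta> $$ (1,0) = \<gamma>" "Zmat k c \<alpha> \<beta> \<gamma> \<delta> $$ (1,1) = \<delta>"
    using Zmat_nth[OF assms, of 1] by (simp_all add: unitv_apply)
qed

locale nonzero_semi_invariant = semi_invariant +
  assumes nz: "\<exists>x\<in>carrier (grpG m n). f x \<noteq> 0"
begin

definition base_point where
  "base_point = (Zmat m 1 1 0 0 1, Zmat n 1 1 0 (-1) 1)"

lemma base_point: "base_point \<in> carrier (grpG m n)" "generic m n base_point"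
  using m n by (simp_all add: base_point_def grpG_carrier Zmat_Sp generic_def cross_def Zmat_corner minor_Zmat)

lemma D_borel:
  "(\<And>l. a l \<noteq> 0) \<Longrightarrow> (\<And>l. d l \<noteq> 0) \<Longrightarrow> (Dmat m a, Dmat n d) \<in> B_std m n"
  by (simp add: B_std_def Dmat_borel)

lemma D_par:
  assumes "\<And>l. a l \<noteq> 0" "\<And>l. d l \<noteq> 0" "a 0 = d 0"
  shows "(Dmat m a, Dmat n d) \<in> P_std m n"
  by (rule P_stdI[of _ _ _ "a 0" 0])
     (use assms m n Dmat_par_cols[of m a] Dmat_par_cols[of n d] in \<open>simp_all add: grpG_carrier Dmat_Sp\<close>)

text \<open>Left multiplication by a torus element of \<open>B\<close> and right multiplication by one of \<open>SL(2)\<close> scale the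
five basic functions as in the hypotheses; the result has the same invariants as \<open>(X', Y')\<close>.\<close>

lemma torus_move:
  assumes X: "X \<in> carrier (Sp m)" "X' \<in> carrier (Sp m)" and Y: "Y \<in> carrier (Sp n)" "Y' \<in> carrier (Sp n)"
    and nz: "\<And>l. a l \<noteq> 0" "\<And>l. d l \<noteq> 0" "s \<noteq> 0"
    and gen: "generic m n (X, Y)"
    and eq: "X' $$ (1,1) = X $$ (1,1) / (a 0 * s)" "Y' $$ (1,1) = Y $$ (1,1) / (d 0 * s)"
      "cross (X', Y') = cross (X, Y) / (a 0 * d 0)"
      "minor m X' = (if m > 1 then minor m X / (a 0 * a 1) else 1)"
      "minor n Y' = (if n > 1 then minor n Y / (d 0 * d 1) else 1)"
  shows "f (X', Y') * om (Dmat m a, Dmat n d) = f (X, Y) * ch (cochar m {0} s, cochar n {0} s)"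
proof -
  let ?S = "\<lambda>k. Dmat k (\<lambda>l. if l = 0 then s else 1)"
  have S: "?S k = cochar k {0} s" for k by (simp add: cochar_def)
  have P: "(?S m, ?S n) \<in> P_std m n" using nz by (intro D_par) auto
  have cX: "X \<in> carrier_mat (2*m) (2*m)" and cY: "Y \<in> carrier_mat (2*n) (2*n)"
    using X Y by (simp_all add: Sp_carrier_mat)
  have DX: "Dmat m a * X \<in> carrier (Sp m)" and DY: "Dmat n d * Y \<in> carrier (Sp n)"
    using X Y nz by (simp_all add: Sp_mult_closed Dmat_Sp)
  have "?S m \<in> carrier (Sp m)" "?S n \<in> carrier (Sp n)" using nz by (simp_all add: Dmat_Sp)
  then have XS: "Dmat m a * X * ?S m \<in> carrier (Sp m)" and YS: "Dmat n d * Y * ?S n \<in> carrier (Sp n)"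
    using DX DY by (simp_all add: Sp_mult_closed)
  have fe: "f (Dmat m a * X * ?S m, Dmat n d * Y * ?S n) * om (Dmat m a, Dmat n d) =
      f (X, Y) * ch (?S m, ?S n)"
    using f_right[OF P DX DY] f_left[OF D_borel X(1) Y(1), of a d] nz by simp
  have X11: "(Dmat m a * X * ?S m) $$ (1,1) = X $$ (1,1) / (a 0 * s)"
    and Y11: "(Dmat n d * Y * ?S n) $$ (1,1) = Y $$ (1,1) / (d 0 * s)"
    and X10: "(Dmat m a * X * ?S m) $$ (1,0) = X $$ (1,0) * s / a 0"
    and Y10: "(Dmat n d * Y * ?S n) $$ (1,0) = Y $$ (1,0) * s / d 0"
    using scale_nth[OF cX m] scale_nth[OF cY n] by blast+
  have "f (Dmat m a * X * ?S m, Dmat n d * Y * ?S n) = f (X', Y')"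
  proof (rule f_invariants[OF X(2) XS Y(2) YS])
    show "generic m n (X', Y')"
      using gen nz by (simp add: generic_def eq)
    show "(Dmat m a * X * ?S m) $$ (1,1) = X' $$ (1,1)" "(Dmat n d * Y * ?S n) $$ (1,1) = Y' $$ (1,1)"
      by (simp_all only: eq X11 Y11)
    show "minor m (Dmat m a * X * ?S m) = minor m X'" "minor n (Dmat n d * Y * ?S n) = minor n Y'"
      using minor_scale[OF cX, of a s] minor_scale[OF cY, of d s] nz by (simp_all only: eq simp_thms)
    have "cross (Dmat m a * X * ?S m, Dmat n d * Y * ?S n) =
      (X $$ (1,0) * s / a 0) * (Y $$ (1,1) / (d 0 * s)) - (X $$ (1,1) / (a 0 * s)) * (Y $$ (1,0) * s / d 0)"
      unfolding cross_def fst_conv snd_conv X11 Y11 X10 Y10 ..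
    also have "\<dots> = cross (X, Y) / (a 0 * d 0)"
      using nz(1)[of 0] nz(2)[of 0] nz(3) by (simp add: cross_def field_simps)
    finally show "cross (Dmat m a * X * ?S m, Dmat n d * Y * ?S n) = cross (X', Y')" by (simp only: eq)
  qed
  then show ?thesis using fe unfolding S by simp
qed

text \<open>The torus acts transitively on the possible values of the five basic functions, and \<open>f\<close> is non-zero at
some generic point because \<open>G\<close> is irreducible.\<close>

lemma generic_nonzero:
  assumes x: "x \<in> carrier (grpG m n)" "generic m n x"
  shows "f x \<noteq> 0"
proof -
  obtain x0 where x0: "x0 \<in> carrier (grpG m n)" "f x0 \<noteq> 0" using nz by blast
  have "generic_poly m n base_point \<noteq> 0" using base_point(2) generic_generic_poly by blast
  then obtain z where z: "z \<in> carrier (grpG m n)" "f z \<noteq> 0" "generic_poly m n z \<noteq> 0"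
    using grpG_irreducible[OF f generic_poly_poly[OF m n] x0(1) base_point(1) x0(2)] by blast
  then have gz: "generic m n z" by (simp add: generic_generic_poly)
  note g = gz[unfolded generic_def] x(2)[unfolded generic_def]
  define v1 v2 v3 v4 v5 where "v1 = fst x $$ (1,1) / fst z $$ (1,1)" and "v2 = snd x $$ (1,1) / snd z $$ (1,1)"
    and "v3 = cross x / cross z" and "v4 = minor m (fst x) / minor m (fst z)"
    and "v5 = minor n (snd x) / minor n (snd z)"
  have v: "v1 \<noteq> 0" "v2 \<noteq> 0" "v3 \<noteq> 0" "v4 \<noteq> 0" "v5 \<noteq> 0"
    using g by (simp_all add: v1_def v2_def v3_def v4_def v5_def)
  \<comment> \<open>The product \<open>v1 v2 s\<^sup>2\<close> must be the factor of \<open>cross\<close>; this determines \<open>s\<close> up to sign.\<close>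
  define s where "s = csqrt (v3 / (v1 * v2))"
  have s2: "s^2 = v3 / (v1 * v2)" by (simp add: s_def)
  then have s: "s \<noteq> 0" using v by auto
  define a d where "a = (\<lambda>l::nat. if l = 0 then 1 / (v1 * s) else if l = 1 then v1 * s / v4 else 1)"
    and "d = (\<lambda>l::nat. if l = 0 then 1 / (v2 * s) else if l = 1 then v2 * s / v5 else 1)"
  have ad: "a l \<noteq> 0" "d l \<noteq> 0" for l using v s by (simp_all add: a_def d_def)
  have "f (fst x, snd x) * om (Dmat m a, Dmat n d) = f (fst z, snd z) * ch (cochar m {0} s, cochar n {0} s)"
  proof (rule torus_move)
    show "fst x $$ (1,1) = fst z $$ (1,1) / (a 0 * s)" "snd x $$ (1,1) = snd z $$ (1,1) / (d 0 * s)"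
      using s v g by (simp_all add: a_def d_def v1_def v2_def)
    have "1 / (a 0 * d 0) = v1 * v2 * s^2" by (simp add: a_def d_def power2_eq_square)
    also have "\<dots> = v3" using v by (simp add: s2)
    finally show "cross (fst x, snd x) = cross (fst z, snd z) / (a 0 * d 0)"
      using g by (simp add: v3_def field_simps)
    have "1 / (a 0 * a 1) = v4" "1 / (d 0 * d 1) = v5" using v s by (simp_all add: a_def d_def)
    then show "minor m (fst x) = (if m > 1 then minor m (fst z) / (a 0 * a 1) else 1)"
      "minor n (snd x) = (if n > 1 then minor n (snd z) / (d 0 * d 1) else 1)"
      using g by (auto simp: v4_def v5_def field_simps minor_def split: if_splits)
  qed (use x z gz s ad in \<open>auto simp: grpG_carrier\<close>)
  moreover have "ch (cochar m {0} s, cochar n {0} s) \<noteq> 0"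
    unfolding cochar_def using s by (intro ch_nz D_par) auto
  ultimately show ?thesis using z(2) by auto
qed

lemma om_D_mult:
  assumes "\<And>l. a l \<noteq> 0" "\<And>l. d l \<noteq> 0" "\<And>l. a' l \<noteq> 0" "\<And>l. d' l \<noteq> 0"
  shows "om (Dmat m (\<lambda>l. a l * a' l), Dmat n (\<lambda>l. d l * d' l)) = om (Dmat m a, Dmat n d) * om (Dmat m a', Dmat n d')"
  using om_mult[OF D_borel D_borel, of a d a' d'] assms by (simp add: Dmat_Dmat)

text \<open>The base point has its first two columns supported in the rows \<open>0, 1, 3\<close>, which these torus elements fix.\<close>

lemma om_rest:
  assumes "\<And>l. a l \<noteq> 0" "\<And>l. d l \<noteq> 0" "a 0 = 1" "a 1 = 1" "d 0 = 1" "d 1 = 1"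
  shows "om (Dmat m a, Dmat n d) = 1"
proof -
  obtain Z Z' where Z: "base_point = (Z, Z')" "Z = Zmat m 1 1 0 0 1" "Z' = Zmat n 1 1 0 (-1) 1" by (simp add: base_point_def)
  have ZS: "Z \<in> carrier (Sp m)" "Z' \<in> carrier (Sp n)" using m n Z by (simp_all add: Zmat_Sp)
  have col: "colv (Dmat k b * Zmat k c \<alpha> \<beta> \<gamma> \<delta>) j = colv (Zmat k c \<alpha> \<beta> \<gamma> \<delta>) j"
    if k: "1 \<le> k" and det: "\<alpha> * \<delta> - \<beta> * \<gamma> = 1" and j: "j < 2" and b: "b 0 = 1" "b 1 = 1" for k c \<alpha> \<beta> \<gamma> \<delta> b j
  proof (rule colv_eqI2)
    have cm: "Zmat k c \<alpha> \<beta> \<gamma> \<delta> \<in> carrier_mat (2*k) (2*k)" using Zmat_Sp[OF k det] by (rule Sp_carrier_mat)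
    then show "Dmat k b * Zmat k c \<alpha> \<beta> \<gamma> \<delta> \<in> carrier_mat (2*k) (2*k)" "Zmat k c \<alpha> \<beta> \<gamma> \<delta> \<in> carrier_mat (2*k) (2*k)"
      by (auto intro: mult_carrier_mat[OF Dmat_carrier])
    show jk: "j < 2*k" using j k by linarith
    fix i assume i: "i < 2*k"
    have d: "diag_entry b i = 1" if "i = 0 \<or> i = 1 \<or> i = 3" using that b by (auto simp: diag_entry_def)
    have "j = 0 \<or> j = 1" using j by linarith
    then have "Zmat k c \<alpha> \<beta> \<gamma> \<delta> $$ (i,j) = 0" if "\<not> (i = 0 \<or> i = 1 \<or> i = 3)"
      using that Zmat_nth[OF k i] by (auto simp: unitv_apply)
    then show "(Dmat k b * Zmat k c \<alpha> \<beta> \<gamma> \<delta>) $$ (i,j) = Zmat k c \<alpha> \<beta> \<gamma> \<delta> $$ (i,j)"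
      using d unfolding Dmat_mult_nth[OF cm i jk] by (cases "i = 0 \<or> i = 1 \<or> i = 3") auto
  qed
  have "f (Dmat m a * Z, Dmat n d * Z') = f (Z, Z')"
  proof (rule f_same_cols)
    show "Dmat m a * Z \<in> carrier (Sp m)" "Dmat n d * Z' \<in> carrier (Sp n)"
      using ZS assms by (simp_all add: Sp_mult_closed Dmat_Sp)
    fix j :: nat assume "j < 2"
    then show "colv (Dmat m a * Z) j = colv Z j" "colv (Dmat n d * Z') j = colv Z' j"
      unfolding Z using m n assms by (intro col; simp)+
  qed (use ZS in auto)
  moreover have "f (Z, Z') \<noteq> 0" using generic_nonzero[OF base_point] Z(1) by simp
  ultimately show ?thesis using f_left[OF D_borel ZS, of a d] assms by simp
qed

lemma om_cochar: "\<exists>a::int. \<forall>t. t \<noteq> 0 \<longrightarrow> om (cochar m S t, cochar n S' t) = t powi a"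
proof -
  obtain p where p: "p \<in> poly_fun m n" "\<And>x. x \<in> B_std m n \<Longrightarrow> om x = p x" using om_reg by blast
  show ?thesis
    by (rule cocurve_exponent[OF p(1) _ p(2) om_nz om_one])
       (simp_all add: cocurve_def cochar_def D_borel)
qed

lemma ch_cochar: "\<exists>a::int. \<forall>t. t \<noteq> 0 \<longrightarrow> ch (cochar m {0} t, cochar n {0} t) = t powi a"
proof -
  obtain p where p: "p \<in> poly_fun m n" "\<And>x. x \<in> P_std m n \<Longrightarrow> ch x = p x" using ch_reg by blast
  show ?thesis
    by (rule cocurve_exponent[OF p(1) _ p(2) ch_nz ch_one])
       (simp_all add: cocurve_def cochar_def D_par)
qed

lemma torus_weights:
  obtains A1 A2 B1 B2 c :: int where
    "\<And>a d. (\<And>l. a l \<noteq> 0) \<Longrightarrow> (\<And>l. d l \<noteq> 0) \<Longrightarrow>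
      om (Dmat m a, Dmat n d) = a 0 powi A1 * a 1 powi A2 * d 0 powi B1 * d 1 powi B2"
    "\<And>t. t \<noteq> 0 \<Longrightarrow> ch (cochar m {0} t, cochar n {0} t) = t powi c"
    "m = 1 \<Longrightarrow> A2 = 0" "n = 1 \<Longrightarrow> B2 = 0"
proof -
  obtain A1 where A1: "\<And>t. t \<noteq> 0 \<Longrightarrow> om (cochar m {0} t, cochar n {} t) = t powi A1" using om_cochar by metis
  obtain A2 where A2: "\<And>t. t \<noteq> 0 \<Longrightarrow> om (cochar m {1} t, cochar n {} t) = t powi A2" using om_cochar by metis
  obtain B1 where B1: "\<And>t. t \<noteq> 0 \<Longrightarrow> om (cochar m {} t, cochar n {0} t) = t powi B1" using om_cochar by metis
  obtain B2 where B2: "\<And>t. t \<noteq> 0 \<Longrightarrow> om (cochar m {} t, cochar n {1} t) = t powi B2" using om_cochar by metis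
  obtain c where c: "\<And>t. t \<noteq> 0 \<Longrightarrow> ch (cochar m {0} t, cochar n {0} t) = t powi c" using ch_cochar by metis
  have triv: "a = 0" if "\<And>t::complex. t \<noteq> 0 \<Longrightarrow> t powi a = 1" for a :: int
  proof -
    have "norm ((2::complex) powi a) = 1" using that[of 2] by simp
    then have "(2::real) powi a = 1" by (simp add: norm_power_int)
    moreover have "(2::real) ^ k = 1 \<longleftrightarrow> k = 0" for k :: nat
      using one_less_power[of "2::real" k] by (cases k) auto
    ultimately show ?thesis
      by (auto simp: power_int_def power_one_over split: if_splits)
  qed
  have cc: "cochar 1 {1} t = 1\<^sub>m (2*1)" for t
    unfolding cochar_def Dmat_one[symmetric] by (rule Dmat_cong) simp
  show ?thesis
  proof (rule that[of A1 A2 B1 B2 c])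
    show "A2 = 0" if "m = 1" using triv A2 om_one that cc by (metis cochar_empty)
    show "B2 = 0" if "n = 1" using triv B2 om_one that cc by (metis cochar_empty)
    fix a d :: "nat \<Rightarrow> complex" assume nz: "\<And>l. a l \<noteq> 0" "\<And>l. d l \<noteq> 0"
    define r where "r = (\<lambda>b :: nat \<Rightarrow> complex. \<lambda>l::nat. if l = 0 \<or> l = 1 then 1 else b l)"
    define u where "u = (\<lambda>(i::nat) (t::complex). \<lambda>l::nat. if l \<in> {i} then t else 1)"
    define v where "v = (\<lambda>t::complex. \<lambda>l::nat. if l \<in> {} then t else 1)"
    have un: "u i t l \<noteq> 0" "v t l \<noteq> 0" if "t \<noteq> 0" for i t l using that by (simp_all add: u_def v_def)
    have rn: "r a l \<noteq> 0" "r d l \<noteq> 0" for l using nz by (simp_all add: r_def)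
    have one: "(\<lambda>l. v t l * b l) = b" "(\<lambda>l. b l * v t l) = b" for t b by (simp_all add: v_def)
    have dec: "(\<lambda>l. u 0 (b 0) l * (u 1 (b 1) l * r b l)) = b" for b
      by (auto simp: u_def r_def fun_eq_iff)
    have m0: "om (Dmat m (\<lambda>l. u 0 (a 0) l * (u 1 (a 1) l * r a l)), Dmat n (\<lambda>l. u 0 (d 0) l * (u 1 (d 1) l * r d l)))
       = om (Dmat m (u 0 (a 0)), Dmat n (u 0 (d 0))) * (om (Dmat m (u 1 (a 1)), Dmat n (u 1 (d 1))) * om (Dmat m (r a), Dmat n (r d)))"
      using un rn nz by (simp add: om_D_mult)
    have m1: "om (Dmat m (u i s), Dmat n (u i t)) = om (Dmat m (u i s), Dmat n (v t)) * om (Dmat m (v s), Dmat n (u i t))"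
      if "s \<noteq> 0" "t \<noteq> 0" for i s t
      using om_D_mult[of "u i s" "v t" "v s" "u i t"] un that by (simp add: one)
    have "om (Dmat m (r a), Dmat n (r d)) = 1" using rn by (intro om_rest) (simp_all add: r_def)
    moreover have uo: "om (Dmat m (u 0 t), Dmat n (v t')) = t powi A1" "om (Dmat m (u 1 t), Dmat n (v t')) = t powi A2"
      "om (Dmat m (v t'), Dmat n (u 0 t)) = t powi B1" "om (Dmat m (v t'), Dmat n (u 1 t)) = t powi B2" if "t \<noteq> 0" for t t'
      using A1[OF that] A2[OF that] B1[OF that] B2[OF that] unfolding cochar_def u_def v_def by simp_all
    ultimately show "om (Dmat m a, Dmat n d) = a 0 powi A1 * a 1 powi A2 * d 0 powi B1 * d 1 powi B2"
      using m0 nz unfolding dec by (simp add: m1 uo)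
  qed (rule c)
qed

text \<open>The integers \<open>e1, \<dots>, e5\<close> below describe the one-parameter subgroup
\<open>(t\<^sup>e\<^sup>1, t\<^sup>e\<^sup>2), (t\<^sup>e\<^sup>3, t\<^sup>e\<^sup>4), t\<^sup>e\<^sup>5\<close> of the first two coordinates
of both tori of \<open>G\<close> and of the torus of \<open>SL(2)\<close>.  In each of the five applications it is chosen to
multiply one basic function by \<open>t\<^sup>2\<close> and to fix the others.\<close>

lemma exponents:
  "\<exists>k1 k2 k3 k4 k5 :: nat. (m = 1 \<longrightarrow> k4 = 0) \<and> (n = 1 \<longrightarrow> k5 = 0) \<and>
    (\<forall>a d. (\<forall>l. a l \<noteq> 0) \<longrightarrow> (\<forall>l. d l \<noteq> 0) \<longrightarrow>
      om (Dmat m a, Dmat n d) = a 0 ^ (k1 + k2 + k4) * a 1 ^ k4 * d 0 ^ (k1 + k3 + k5) * d 1 ^ k5) \<and>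
    (\<forall>t. t \<noteq> 0 \<longrightarrow> ch (cochar m {0} t, cochar n {0} t) = (1/t) ^ (k2 + k3))"
proof -
  obtain A1 A2 B1 B2 c :: int where
    om: "\<And>a d. (\<And>l. a l \<noteq> 0) \<Longrightarrow> (\<And>l. d l \<noteq> 0) \<Longrightarrow>
      om (Dmat m a, Dmat n d) = a 0 powi A1 * a 1 powi A2 * d 0 powi B1 * d 1 powi B2"
    and ch: "\<And>t. t \<noteq> 0 \<Longrightarrow> ch (cochar m {0} t, cochar n {0} t) = t powi c"
    and 1: "m = 1 \<Longrightarrow> A2 = 0" "n = 1 \<Longrightarrow> B2 = 0"
    using torus_weights by metis
  have key: "\<exists>k::nat. e5 * c - e1 * A1 - e2 * A2 - e3 * B1 - e4 * B2 = 2 * int k"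
    if det: "\<And>t. \<alpha> t * \<delta> t - \<beta> t * \<gamma> t = 1" "\<And>t. \<alpha>' t * \<delta>' t - \<beta>' t * \<gamma>' t = 1"
      and P: "c1 \<in> Poly1" "\<alpha> \<in> Poly1" "\<beta> \<in> Poly1" "\<gamma> \<in> Poly1" "\<delta> \<in> Poly1"
        "c2 \<in> Poly1" "\<alpha>' \<in> Poly1" "\<beta>' \<in> Poly1" "\<gamma>' \<in> Poly1" "\<delta>' \<in> Poly1"
      and gen: "\<delta> 1 \<noteq> 0" "\<delta>' 1 \<noteq> 0" "\<gamma> 1 * \<delta>' 1 - \<delta> 1 * \<gamma>' 1 \<noteq> 0" "c1 1 \<noteq> 0" "c2 1 \<noteq> 0"
      and eq: "\<And>t. t \<noteq> 0 \<Longrightarrow> \<delta> (t^2) = \<delta> 1 / (t powi e1 * t powi e5)"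
        "\<And>t. t \<noteq> 0 \<Longrightarrow> \<delta>' (t^2) = \<delta>' 1 / (t powi e3 * t powi e5)"
        "\<And>t. t \<noteq> 0 \<Longrightarrow> \<gamma> (t^2) * \<delta>' (t^2) - \<delta> (t^2) * \<gamma>' (t^2) = (\<gamma> 1 * \<delta>' 1 - \<delta> 1 * \<gamma>' 1) / (t powi e1 * t powi e3)"
        "\<And>t. t \<noteq> 0 \<Longrightarrow> c1 (t^2) = c1 1 / (t powi e1 * t powi e2)"
        "\<And>t. t \<noteq> 0 \<Longrightarrow> c2 (t^2) = c2 1 / (t powi e3 * t powi e4)"
    for c1 \<alpha> \<beta> \<gamma> \<delta> c2 \<alpha>' \<beta>' \<gamma>' \<delta>' and e1 e2 e3 e4 e5 :: int
  proof (rule even_exponent)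
    let ?X = "\<lambda>t. Zmat m (c1 t) (\<alpha> t) (\<beta> t) (\<gamma> t) (\<delta> t)" and ?Y = "\<lambda>t. Zmat n (c2 t) (\<alpha>' t) (\<beta>' t) (\<gamma>' t) (\<delta>' t)"
    show "(\<lambda>t. f (?X t, ?Y t)) \<in> Poly1"
      by (rule poly_fun_Poly1[OF f]) (use m n P in \<open>simp_all add: Zmat_Poly1\<close>)
    have S: "?X t \<in> carrier (Sp m)" "?Y t \<in> carrier (Sp n)" for t
      using m n det by (simp_all add: Zmat_Sp)
    have g: "generic m n (?X 1, ?Y 1)"
      using gen m n det by (simp add: generic_def cross_def Zmat_corner minor_Zmat)
    show "f (?X 1, ?Y 1) \<noteq> 0" using generic_nonzero[OF _ g] S by (simp add: grpG_carrier)
    fix t :: complex assume t: "t \<noteq> 0"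
    define a d where "a = (\<lambda>l::nat. if l = 0 then t powi e1 else if l = 1 then t powi e2 else 1)"
      and "d = (\<lambda>l::nat. if l = 0 then t powi e3 else if l = 1 then t powi e4 else 1)"
    have ad: "a l \<noteq> 0" "d l \<noteq> 0" for l using t by (simp_all add: a_def d_def)
    have "f (?X (t^2), ?Y (t^2)) * om (Dmat m a, Dmat n d) = f (?X 1, ?Y 1) * ch (cochar m {0} (t powi e5), cochar n {0} (t powi e5))"
    proof (rule torus_move[OF S(1) S(1) S(2) S(2) ad _ g])
      show "?X (t^2) $$ (1,1) = ?X 1 $$ (1,1) / (a 0 * t powi e5)" "?Y (t^2) $$ (1,1) = ?Y 1 $$ (1,1) / (d 0 * t powi e5)"
        unfolding Zmat_corner[OF m] Zmat_corner[OF n] using eq(1,2)[OF t] by (simp_all add: a_def d_def)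
      show "cross (?X (t^2), ?Y (t^2)) = cross (?X 1, ?Y 1) / (a 0 * d 0)"
        unfolding cross_def fst_conv snd_conv Zmat_corner[OF m] Zmat_corner[OF n] eq(3)[OF t]
        by (simp add: a_def d_def)
      show "minor m (?X (t^2)) = (if m > 1 then minor m (?X 1) / (a 0 * a 1) else 1)"
        "minor n (?Y (t^2)) = (if n > 1 then minor n (?Y 1) / (d 0 * d 1) else 1)"
        unfolding minor_Zmat[OF m det(1)] minor_Zmat[OF n det(2)] eq(4,5)[OF t]
        by (simp_all add: a_def d_def)
    qed (use t in simp)
    also have "om (Dmat m a, Dmat n d) = t powi (e1*A1 + e2*A2 + e3*B1 + e4*B2)"
      using om[of a d] ad t by (simp add: a_def d_def power_int_add power_int_mult)
    also have "ch (cochar m {0} (t powi e5), cochar n {0} (t powi e5)) = t powi (e5*c)"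
      using ch[of "t powi e5"] t by (simp add: power_int_mult)
    finally show "f (?X (t^2), ?Y (t^2)) = f (?X 1, ?Y 1) * t powi (e5 * c - e1 * A1 - e2 * A2 - e3 * B1 - e4 * B2)"
      using t by (simp add: power_int_diff power_int_add field_simps)
  qed
  note P1 = Poly1_const Poly1_id Poly1_uminus
  have t2: "t powi 2 = t^2" "t powi (-2) = 1 / t^2" "t powi (-1) = 1 / t" for t :: complex
    by (simp_all add: power_int_minus field_simps)
  \<comment> \<open>The first corner entry is \<open>t\<close>.\<close>
  have "\<exists>k::nat. (-1) * c - (-1) * A1 - 1 * A2 - 1 * B1 - (-1) * B2 = 2 * int k"
    by (rule key[of "\<lambda>t. 0" "\<lambda>t. t" "\<lambda>t. -1" "\<lambda>t. 1" "\<lambda>t. 1" "\<lambda>t. 1" "\<lambda>t. 0" "\<lambda>t. 0" "\<lambda>t. 1" "\<lambda>t. 1"])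
       (simp_all add: P1 t2 power2_eq_square field_simps)
  then obtain k2 :: nat where k2: "- c + A1 - A2 - B1 + B2 = 2 * int k2" by auto
  \<comment> \<open>The second corner entry is \<open>t\<close>.\<close>
  have "\<exists>k::nat. (-1) * c - 1 * A1 - (-1) * A2 - (-1) * B1 - 1 * B2 = 2 * int k"
    by (rule key[of "\<lambda>t. 1" "\<lambda>t. 1" "\<lambda>t. 0" "\<lambda>t. 0" "\<lambda>t. 0" "\<lambda>t. t" "\<lambda>t. -1" "\<lambda>t. 1" "\<lambda>t. 1" "\<lambda>t. 1"])
       (simp_all add: P1 t2 power2_eq_square field_simps)
  then obtain k3 :: nat where k3: "- c - A1 + A2 + B1 - B2 = 2 * int k3" by auto
  \<comment> \<open>The function \<open>cross\<close> is \<open>t\<close>.\<close>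
  have "\<exists>k::nat. 1 * c - (-1) * A1 - 1 * A2 - (-1) * B1 - 1 * B2 = 2 * int k"
    by (rule key[of "\<lambda>t. 1" "\<lambda>t. 1" "\<lambda>t. 0" "\<lambda>t. 0" "\<lambda>t. 1" "\<lambda>t. 1" "\<lambda>t. 0" "\<lambda>t. -t" "\<lambda>t. 1" "\<lambda>t. 1"])
       (simp_all add: P1 t2 power2_eq_square field_simps)
  then obtain k1 :: nat where k1: "c + A1 - A2 + B1 - B2 = 2 * int k1" by auto
  \<comment> \<open>The first minor is \<open>t\<close>.\<close>
  have "\<exists>k::nat. 0 * c - 0 * A1 - (-2) * A2 - 0 * B1 - 0 * B2 = 2 * int k"
    by (rule key[of "\<lambda>t. 1" "\<lambda>t. 1" "\<lambda>t. 0" "\<lambda>t. 0" "\<lambda>t. 1" "\<lambda>t. 1" "\<lambda>t. 0" "\<lambda>t. -1" "\<lambda>t. t" "\<lambda>t. 1"])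
       (simp_all add: P1 t2 power2_eq_square field_simps)
  then obtain k4 :: nat where k4: "A2 = int k4" by auto
  \<comment> \<open>The second minor is \<open>t\<close>.\<close>
  have "\<exists>k::nat. 0 * c - 0 * A1 - 0 * A2 - 0 * B1 - (-2) * B2 = 2 * int k"
    by (rule key[of "\<lambda>t. 1" "\<lambda>t. 1" "\<lambda>t. 0" "\<lambda>t. 0" "\<lambda>t. 1" "\<lambda>t. 1" "\<lambda>t. 0" "\<lambda>t. -1" "\<lambda>t. 1" "\<lambda>t. t"])
       (simp_all add: P1 t2 power2_eq_square field_simps)
  then obtain k5 :: nat where k5: "B2 = int k5" by auto
  have A1: "A1 = int (k1 + k2 + k4)" and B1: "B1 = int (k1 + k3 + k5)" and c: "c = - int (k2 + k3)"
    using k1 k2 k3 k4 k5 by simp_all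
  show ?thesis
  proof (intro exI conjI impI allI)
    show "m = 1 \<Longrightarrow> k4 = 0" "n = 1 \<Longrightarrow> k5 = 0" using 1 k4 k5 by simp_all
    show "om (Dmat m a, Dmat n d) = a 0 ^ (k1 + k2 + k4) * a 1 ^ k4 * d 0 ^ (k1 + k3 + k5) * d 1 ^ k5"
      if "\<forall>l. a l \<noteq> 0" "\<forall>l. d l \<noteq> 0" for a d
      using om[OF that[rule_format]] unfolding A1 B1 k4 k5 power_int_of_nat .
    show "ch (cochar m {0} t, cochar n {0} t) = (1/t) ^ (k2 + k3)" if "t \<noteq> 0" for t
      using ch[OF that] unfolding c power_int_minus power_int_of_nat
      by (simp add: power_one_over inverse_eq_divide)
  qed
qed

end

section \<open>The five basic semi-invariants\<close>

lemma borel_carrier: "b \<in> Sp_borel k \<Longrightarrow> b \<in> carrier (Sp k)"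
  by (simp add: Sp_borel_def)

lemma borel_col0:
  assumes b: "b \<in> Sp_borel k" and k: "1 \<le> k"
  shows "colv b 0 = (\<lambda>i. b $$ (0,0) * unitv 0 i)"
proof
  fix i
  have "b $$ (i,0) = 0" if "i < 2*k" "i \<noteq> 0"
  proof (rule ccontr)
    assume "b $$ (i,0) \<noteq> 0"
    then have "b $$ (i,2*0) \<noteq> 0" by simp
    moreover have "0 < k" using k by linarith
    ultimately have "i \<le> 2*0" using b that unfolding Sp_borel_def by blast
    then show False using that by simp
  qed
  then show "colv b 0 i = b $$ (0,0) * unitv 0 i"
    using Sp_carrier_mat[OF borel_carrier[OF b]] k by (auto simp: colv_def unitv_apply)
qed

lemma borel_col2:
  assumes b: "b \<in> Sp_borel k" and k: "1 < k"
  shows "colv b 2 = (\<lambda>i. b $$ (0,2) * unitv 0 i + b $$ (2,2) * unitv 2 i)"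
proof
  fix i
  have "b $$ (i,2) = 0" if "i < 2*k" "i \<noteq> 0" "i \<noteq> 2"
  proof (rule ccontr)
    assume "b $$ (i,2) \<noteq> 0"
    then have "b $$ (i,2*1) \<noteq> 0" by simp
    then have "even i \<and> i \<le> 2*1" using b that k unfolding Sp_borel_def by blast
    then have "i = 0 \<or> i = 2" by (auto elim!: evenE)
    then show False using that by simp
  qed
  then show "colv b 2 i = b $$ (0,2) * unitv 0 i + b $$ (2,2) * unitv 2 i"
    using Sp_carrier_mat[OF borel_carrier[OF b]] k by (auto simp: colv_def unitv_apply)
qed

text \<open>Row \<open>1\<close> of \<open>b\<close> is read off from \<open>\<omega>(b e 0, b e j) = \<omega>(e 0, e j)\<close>, as \<open>b e 0\<close> is a multiple of \<open>e 0\<close>.\<close>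

lemma borel_row1:
  assumes b: "b \<in> Sp_borel k" and k: "1 \<le> k"
  shows "b $$ (0,0) \<noteq> 0" "\<And>j. j < 2*k \<Longrightarrow> b $$ (1,j) = unitv 1 j / b $$ (0,0)"
proof -
  have k': "1 < 2*k" using k by linarith
  have e: "Om k (unitv 0) v = v 1" for v using k by (simp add: Om_unitv_left One_nat_def)
  have r: "b $$ (0,0) * b $$ (1,j) = unitv j 1" if "j < 2*k" for j
    using Sp_form[OF borel_carrier[OF b], of 0 j] k' that colv_nth[OF Sp_carrier_mat[OF borel_carrier[OF b]] k', of j]
    unfolding borel_col0[OF b k] by (simp add: Om_scale_left e)
  show nz: "b $$ (0,0) \<noteq> 0" using r[OF k'] by (auto simp: unitv_apply)
  show "b $$ (1,j) = unitv 1 j / b $$ (0,0)" if "j < 2*k" for j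
    using r[OF that] nz by (simp add: field_simps unitv_apply)
qed

lemma borel_row3:
  assumes b: "b \<in> Sp_borel k" and k: "1 < k"
  shows "b $$ (2,2) \<noteq> 0" "\<exists>c. \<forall>j<2*k. b $$ (3,j) = unitv 3 j / b $$ (2,2) + c * unitv 1 j"
proof -
  have k1: "1 \<le> k" and k3: "3 < 2*k" "1 < 2*k" "2 < 2*k" using k by linarith+
  have e: "Om k (unitv 0) v = v 1" "Om k (unitv 2) v = v 3" for v using k by (simp_all add: Om_unitv_left One_nat_def)
  note cm = Sp_carrier_mat[OF borel_carrier[OF b]]
  have r: "b $$ (0,2) * (unitv 1 j / b $$ (0,0)) + b $$ (2,2) * b $$ (3,j) = unitv j 3" if "j < 2*k" for j
    using Sp_form[OF borel_carrier[OF b], of 2 j] k3 that colv_nth[OF cm k3(1), of j] colv_nth[OF cm k3(2), of j]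
      borel_row1(2)[OF b k1 that]
    unfolding borel_col2[OF b k] by (simp add: Om_add_left Om_scale_left e)
  show nz: "b $$ (2,2) \<noteq> 0" using r[OF k3(1)] by (auto simp: unitv_apply)
  show "\<exists>c. \<forall>j<2*k. b $$ (3,j) = unitv 3 j / b $$ (2,2) + c * unitv 1 j"
  proof (intro exI allI impI)
    fix j assume "j < 2*k"
    then have "b $$ (3,j) = (unitv j 3 - b $$ (0,2) * (unitv 1 j / b $$ (0,0))) / b $$ (2,2)"
      using r[of j] nz by (simp add: field_simps)
    then show "b $$ (3,j) = unitv 3 j / b $$ (2,2) + (- b $$ (0,2) / (b $$ (0,0) * b $$ (2,2))) * unitv 1 j"
      using nz borel_row1(1)[OF b k1] by (simp add: field_simps unitv_apply)
  qed
qed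

lemma mult_nth_sum:
  assumes "A \<in> carrier_mat (2*k) (2*k)" "X \<in> carrier_mat (2*k) (2*k)" "i < 2*k" "j < 2*k"
  shows "(A * X) $$ (i,j) = (\<Sum>l<2*k. A $$ (i,l) * X $$ (l,j))"
  using assms by (simp add: scalar_prod_def atLeast0LessThan)

lemma sum_unitv_mult: "i < n \<Longrightarrow> (\<Sum>l<n. unitv i l * v l) = v i"
  using unitv_expand[of i n v] by (simp add: unitv_apply mult.commute eq_commute)

lemma borel_mult_row1:
  assumes b: "b \<in> Sp_borel k" and k: "1 \<le> k" and X: "X \<in> carrier_mat (2*k) (2*k)" and j: "j < 2*k"
  shows "(b * X) $$ (1,j) = X $$ (1,j) / b $$ (0,0)"
proof -
  have k1: "1 < 2*k" using k by linarith
  have "(b * X) $$ (1,j) = (\<Sum>l<2*k. unitv 1 l * (X $$ (l,j) / b $$ (0,0)))"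
    unfolding mult_nth_sum[OF Sp_carrier_mat[OF borel_carrier[OF b]] X k1 j]
    by (intro sum.cong) (simp_all add: borel_row1(2)[OF b k])
  then show ?thesis using sum_unitv_mult[OF k1, of "\<lambda>l. X $$ (l,j) / b $$ (0,0)"] by simp
qed

lemma borel_mult_minor:
  assumes b: "b \<in> Sp_borel k" and k: "1 < k" and X: "X \<in> carrier_mat (2*k) (2*k)"
  shows "minor k (b * X) = minor k X / (b $$ (0,0) * b $$ (2,2))"
proof -
  have k1: "1 \<le> k" and k3: "3 < 2*k" "1 < 2*k" "0 < 2*k" using k by linarith+
  obtain c where c: "\<And>j. j < 2*k \<Longrightarrow> b $$ (3,j) = unitv 3 j / b $$ (2,2) + c * unitv 1 j"
    using borel_row3(2)[OF b k] by blast
  have r3: "(b * X) $$ (3,j) = X $$ (3,j) / b $$ (2,2) + c * X $$ (1,j)" if j: "j < 2*k" for j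
  proof -
    have "(b * X) $$ (3,j) = (\<Sum>l<2*k. unitv 3 l * (X $$ (l,j) / b $$ (2,2)) + unitv 1 l * (c * X $$ (l,j)))"
      unfolding mult_nth_sum[OF Sp_carrier_mat[OF borel_carrier[OF b]] X k3(1) j]
      by (intro sum.cong) (simp_all add: c algebra_simps)
    then show ?thesis
      using sum_unitv_mult[OF k3(1), of "\<lambda>l. X $$ (l,j) / b $$ (2,2)"] sum_unitv_mult[OF k3(2), of "\<lambda>l. c * X $$ (l,j)"]
      by (simp add: sum.distrib)
  qed
  show ?thesis
    using k borel_row1(1)[OF b k1] borel_row3(1)[OF b k]
    by (simp add: minor_def r3[OF k3(2)] r3[OF k3(3)] borel_mult_row1[OF b k1 X k3(2)] borel_mult_row1[OF b k1 X k3(3)]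
        field_simps del: index_mult_mat(1))
qed

lemma borel_mult_diag:
  assumes b: "b \<in> Sp_borel k" "b' \<in> Sp_borel k" and k: "1 \<le> k"
  shows "(b * b') $$ (0,0) = b $$ (0,0) * b' $$ (0,0)"
    "1 < k \<Longrightarrow> (b * b') $$ (2,2) = b $$ (2,2) * b' $$ (2,2)"
proof -
  note cm = Sp_carrier_mat[OF borel_carrier[OF b(1)]] Sp_carrier_mat[OF borel_carrier[OF b(2)]]
  have k0: "0 < 2*k" using k by linarith
  have "colv (b * b') 0 0 = b' $$ (0,0) * colv b 0 0"
    unfolding colv_mult[OF cm k0] borel_col0[OF b(2) k] by (simp add: mat_act_scale mat_act_unitv[OF cm(1) k0])
  then show "(b * b') $$ (0,0) = b $$ (0,0) * b' $$ (0,0)"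
    using k0 cm by (simp add: colv_def del: index_mult_mat(1))
  assume k1: "1 < k"
  then have k2: "2 < 2*k" by linarith
  have "colv (b * b') 2 2 = b' $$ (0,2) * colv b 0 2 + b' $$ (2,2) * colv b 2 2"
    unfolding colv_mult[OF cm k2] borel_col2[OF b(2) k1]
    by (simp add: mat_act_add mat_act_scale mat_act_unitv[OF cm(1) k0] mat_act_unitv[OF cm(1) k2])
  also have "colv b 0 2 = 0" unfolding borel_col0[OF b(1) k] by (simp add: unitv_apply)
  finally show "(b * b') $$ (2,2) = b $$ (2,2) * b' $$ (2,2)"
    using k2 cm by (simp add: colv_def del: index_mult_mat(1))
qed

lemma borel_mult_closed:
  assumes b: "b \<in> Sp_borel k" "b' \<in> Sp_borel k"
  shows "b * b' \<in> Sp_borel k"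
proof -
  note cm = Sp_carrier_mat[OF borel_carrier[OF b(1)]] Sp_carrier_mat[OF borel_carrier[OF b(2)]]
  have "even i \<and> i \<le> 2*j" if ij: "i < 2*k" "j < k" and nz: "(b * b') $$ (i,2*j) \<noteq> 0" for i j
  proof -
    have "(\<Sum>l<2*k. b $$ (i,l) * b' $$ (l,2*j)) \<noteq> 0"
      using nz mult_nth_sum[OF cm ij(1), of "2*j"] ij by simp
    then obtain l where l: "l < 2*k" "b $$ (i,l) \<noteq> 0" "b' $$ (l,2*j) \<noteq> 0"
      by (metis (no_types, lifting) lessThan_iff mult_eq_0_iff sum.neutral)
    then have l': "even l" "l \<le> 2*j" using b(2) ij by (auto simp: Sp_borel_def)
    then obtain l2 where l2: "l = 2*l2" by (elim evenE)
    then have "b $$ (i,2*l2) \<noteq> 0" "l2 < k" using l by auto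
    then have "even i \<and> i \<le> 2*l2" using b(1) ij(1) unfolding Sp_borel_def by blast
    then show ?thesis using l' l2 by simp
  qed
  then show ?thesis using b by (simp add: Sp_borel_def Sp_mult_closed)
qed

lemma par_cols_mult:
  assumes p: "p \<in> carrier_mat (2*k) (2*k)" "par_cols p a c" and X: "X \<in> carrier_mat (2*k) (2*k)" and k: "1 \<le> k"
  shows "colv (X * p) 0 = (\<lambda>i. a * colv X 0 i + c * colv X 1 i)" "colv (X * p) 1 = (\<lambda>i. (1/a) * colv X 1 i)"
proof -
  have k': "0 < 2*k" "1 < 2*k" using k by linarith+
  show "colv (X * p) 0 = (\<lambda>i. a * colv X 0 i + c * colv X 1 i)" "colv (X * p) 1 = (\<lambda>i. (1/a) * colv X 1 i)"
    using p(2) unfolding colv_mult[OF X p(1) k'(1)] colv_mult[OF X p(1) k'(2)] par_cols_def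
    by (simp_all only: mat_act_add mat_act_scale mat_act_unitv[OF X k'(1)] mat_act_unitv[OF X k'(2)])
qed

lemma par_cols_mult_nth:
  assumes p: "p \<in> carrier_mat (2*k) (2*k)" "par_cols p a c" and X: "X \<in> carrier_mat (2*k) (2*k)" and k: "1 \<le> k"
    and i: "i < 2*k"
  shows "(X * p) $$ (i,0) = a * X $$ (i,0) + c * X $$ (i,1)" "(X * p) $$ (i,1) = X $$ (i,1) / a"
  using fun_cong[OF par_cols_mult(1)[OF assms(1-4)], of i] fun_cong[OF par_cols_mult(2)[OF assms(1-4)], of i]
    i X p by (simp_all add: colv_def del: index_mult_mat(1))

lemma par_cols_corner: "par_cols p a c \<Longrightarrow> p \<in> carrier_mat (2*k) (2*k) \<Longrightarrow> 1 \<le> k \<Longrightarrow> p $$ (1,1) = 1 / a"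
proof -
  assume p: "par_cols p a c" "p \<in> carrier_mat (2*k) (2*k)" "1 \<le> k"
  have "1 < 2*k" using p(3) by linarith
  then show ?thesis using fun_cong[OF p(1)[unfolded par_cols_def, THEN conjunct2], of 1] p(2)
    by (simp add: colv_def unitv_apply)
qed

lemma P_std_mult_closed:
  assumes "p \<in> P_std m n" "p' \<in> P_std m n" and m: "1 \<le> m" and n: "1 \<le> n"
  shows "p \<otimes>\<^bsub>grpG m n\<^esub> p' \<in> P_std m n"
proof -
  interpret G: group "grpG m n" by (rule grpG_group)
  obtain a c where 1: "p \<in> carrier (grpG m n)" "a \<noteq> 0" "par_cols (fst p) a c" "par_cols (snd p) a c"
    using assms(1) by (auto simp: P_std_def)
  obtain a' c' where 2: "p' \<in> carrier (grpG m n)" "a' \<noteq> 0" "par_cols (fst p') a' c'" "par_cols (snd p') a' c'"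
    using assms(2) by (auto simp: P_std_def)
  have pc: "par_cols (X * X') (a * a') (a' * c + c' / a)"
    if "X \<in> carrier_mat (2*k) (2*k)" "X' \<in> carrier_mat (2*k) (2*k)" "par_cols X a c" "par_cols X' a' c'" "1 \<le> k" for X X' k
    unfolding par_cols_def par_cols_mult[OF that(2,4,1,5)] using that(3)
    by (auto simp: par_cols_def fun_eq_iff field_simps 1(2) 2(2))
  show ?thesis
  proof (rule P_stdI)
    show "p \<otimes>\<^bsub>grpG m n\<^esub> p' \<in> carrier (grpG m n)" using 1 2 by (intro G.m_closed)
    show "a * a' \<noteq> 0" using 1 2 by simp
    show "par_cols (fst (p \<otimes>\<^bsub>grpG m n\<^esub> p')) (a * a') (a' * c + c' / a)"
      "par_cols (snd (p \<otimes>\<^bsub>grpG m n\<^esub> p')) (a * a') (a' * c + c' / a)"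
      using pc[OF _ _ 1(3) 2(3) m] pc[OF _ _ 1(4) 2(4) n] grpG_carrier_mat[OF 1(1)] grpG_carrier_mat[OF 2(1)] by simp_all
  qed
qed

text \<open>The entries in position \<open>(2,2)\<close> exist only for \<open>m > 1\<close> and \<open>n > 1\<close>; otherwise the function is used with
\<open>k4 = 0\<close> and \<open>k5 = 0\<close> respectively, when the unspecified value is raised to the power \<open>0\<close>.\<close>

definition om_std :: "nat \<Rightarrow> nat \<Rightarrow> nat \<Rightarrow> nat \<Rightarrow> nat \<Rightarrow> cmat \<times> cmat \<Rightarrow> complex" where
  "om_std k1 k2 k3 k4 k5 = (\<lambda>x. fst x $$ (0,0) ^ (k1 + k2 + k4) * (fst x $$ (2,2) ^ k4 *
     (snd x $$ (0,0) ^ (k1 + k3 + k5) * snd x $$ (2,2) ^ k5)))"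

definition ch_std :: "nat \<Rightarrow> cmat \<times> cmat \<Rightarrow> complex" where
  "ch_std k = (\<lambda>x. fst x $$ (1,1) ^ k)"

definition f_std :: "nat \<Rightarrow> nat \<Rightarrow> nat \<Rightarrow> nat \<Rightarrow> nat \<Rightarrow> nat \<Rightarrow> nat \<Rightarrow> cmat \<times> cmat \<Rightarrow> complex" where
  "f_std m n k1 k2 k3 k4 k5 = (\<lambda>x. fst x $$ (1,1) ^ k2 * (snd x $$ (1,1) ^ k3 * (cross x ^ k1 *
     (minor m (fst x) ^ k4 * minor n (snd x) ^ k5))))"

locale exponent_tuple =
  fixes m n k1 k2 k3 k4 k5 :: nat
  assumes m: "1 \<le> m" and n: "1 \<le> n" and k4: "m = 1 \<Longrightarrow> k4 = 0" and k5: "n = 1 \<Longrightarrow> k5 = 0"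
begin

lemma om_std_poly: "om_std k1 k2 k3 k4 k5 \<in> poly_fun m n"
proof -
  have p4: "(\<lambda>x. fst x $$ (2,2) ^ k4) \<in> poly_fun m n"
  proof (cases "m = 1")
    case True
    then show ?thesis by (simp add: k4 poly_fun.const)
  next
    case False
    then have "2 < 2*m" using m by linarith
    then show ?thesis by (intro poly_fun_power poly_fun.entry1)
  qed
  have p5: "(\<lambda>x. snd x $$ (2,2) ^ k5) \<in> poly_fun m n"
  proof (cases "n = 1")
    case True
    then show ?thesis by (simp add: k5 poly_fun.const)
  next
    case False
    then have "2 < 2*n" using n by linarith
    then show ?thesis by (intro poly_fun_power poly_fun.entry2)
  qed
  have mn: "0 < 2*m" "0 < 2*n" using m n by linarith+
  have p0: "(\<lambda>x. fst x $$ (0,0) ^ i) \<in> poly_fun m n" "(\<lambda>x. snd x $$ (0,0) ^ i) \<in> poly_fun m n" for i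
    using mn by (intro poly_fun_power poly_fun.entry1 poly_fun.entry2; simp)+
  show ?thesis
    unfolding om_std_def by (intro poly_fun.mult p0 p4 p5)
qed

lemma ch_std_poly: "ch_std k \<in> poly_fun m n"
  unfolding ch_std_def by (intro poly_fun_power corner_poly m)

lemma f_std_poly: "f_std m n k1 k2 k3 k4 k5 \<in> poly_fun m n"
  unfolding f_std_def by (intro poly_fun.mult poly_fun_power corner_poly cross_poly minor_poly m n)

lemma om_std_nz: "b \<in> B_std m n \<Longrightarrow> om_std k1 k2 k3 k4 k5 b \<noteq> 0"
proof -
  assume "b \<in> B_std m n"
  then have b: "fst b \<in> Sp_borel m" "snd b \<in> Sp_borel n" by (auto simp: B_std_def)
  have "fst b $$ (2,2) ^ k4 \<noteq> 0"
    using borel_row3(1)[OF b(1)] k4 m by (cases "m = 1") auto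
  moreover have "snd b $$ (2,2) ^ k5 \<noteq> 0"
    using borel_row3(1)[OF b(2)] k5 n by (cases "n = 1") auto
  ultimately show ?thesis
    using borel_row1(1)[OF b(1) m] borel_row1(1)[OF b(2) n] by (simp add: om_std_def)
qed

lemma om_std_mult:
  assumes "b \<in> B_std m n" "b' \<in> B_std m n"
  shows "om_std k1 k2 k3 k4 k5 (b \<otimes>\<^bsub>grpG m n\<^esub> b') = om_std k1 k2 k3 k4 k5 b * om_std k1 k2 k3 k4 k5 b'"
proof -
  have b: "fst b \<in> Sp_borel m" "snd b \<in> Sp_borel n" "fst b' \<in> Sp_borel m" "snd b' \<in> Sp_borel n"
    using assms by (auto simp: B_std_def)
  have "(fst b * fst b') $$ (2,2) ^ k4 = (fst b $$ (2,2) * fst b' $$ (2,2)) ^ k4"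
    using borel_mult_diag(2)[OF b(1,3) m] k4 m by (cases "m = 1") (auto simp del: index_mult_mat(1))
  moreover have "(snd b * snd b') $$ (2,2) ^ k5 = (snd b $$ (2,2) * snd b' $$ (2,2)) ^ k5"
    using borel_mult_diag(2)[OF b(2,4) n] k5 n by (cases "n = 1") (auto simp del: index_mult_mat(1))
  ultimately show ?thesis
    using borel_mult_diag(1)[OF b(1,3) m] borel_mult_diag(1)[OF b(2,4) n]
    by (simp add: om_std_def power_mult_distrib del: index_mult_mat(1))
qed

lemma ch_std_nz: "p \<in> P_std m n \<Longrightarrow> ch_std k p \<noteq> 0"
proof -
  assume "p \<in> P_std m n"
  then obtain a c where p: "p \<in> carrier (grpG m n)" "a \<noteq> 0" "par_cols (fst p) a c"
    by (auto simp: P_std_def)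
  then show ?thesis using par_cols_corner[OF p(3) grpG_carrier_mat(1)[OF p(1)] m] by (simp add: ch_std_def)
qed

lemma ch_std_mult:
  assumes "p \<in> P_std m n" "p' \<in> P_std m n"
  shows "ch_std k (p \<otimes>\<^bsub>grpG m n\<^esub> p') = ch_std k p * ch_std k p'"
proof -
  obtain a c where p: "p' \<in> carrier (grpG m n)" "par_cols (fst p') a c"
    using assms(2) by (auto simp: P_std_def)
  have "1 < 2*m" using m by linarith
  then have "(fst p * fst p') $$ (1,1) = fst p $$ (1,1) * fst p' $$ (1,1)"
    using par_cols_mult_nth(2)[OF _ p(2) _ m] par_cols_corner[OF p(2) _ m] grpG_carrier_mat[OF p(1)]
      grpG_carrier_mat[OF P_std_G[OF assms(1)]] by simp
  then show ?thesis by (simp add: ch_std_def power_mult_distrib del: index_mult_mat(1))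
qed

lemma f_std_semi:
  assumes b: "b \<in> B_std m n" and x: "x \<in> carrier (grpG m n)" and p: "p \<in> P_std m n"
  shows "f_std m n k1 k2 k3 k4 k5 (x \<otimes>\<^bsub>grpG m n\<^esub> p) =
    om_std k1 k2 k3 k4 k5 b * f_std m n k1 k2 k3 k4 k5 (b \<otimes>\<^bsub>grpG m n\<^esub> x) * ch_std (k2 + k3) p"
proof -
  have mn: "0 < 2*m" "1 < 2*m" "0 < 2*n" "1 < 2*n" using m n by linarith+
  note cx = grpG_carrier_mat[OF x]
  have bb: "fst b \<in> Sp_borel m" "snd b \<in> Sp_borel n" using b by (auto simp: B_std_def)
  obtain a c where pp: "p \<in> carrier (grpG m n)" "a \<noteq> 0" "par_cols (fst p) a c" "par_cols (snd p) a c"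
    using p by (auto simp: P_std_def)
  note cp = grpG_carrier_mat[OF pp(1)]
  have nz: "fst b $$ (0,0) \<noteq> 0" "snd b $$ (0,0) \<noteq> 0"
    using borel_row1(1)[OF bb(1) m] borel_row1(1)[OF bb(2) n] .
  note R = par_cols_mult_nth[OF cp(1) pp(3) cx(1) m] par_cols_mult_nth[OF cp(2) pp(4) cx(2) n]
  note L = borel_mult_row1[OF bb(1) m cx(1)] borel_mult_row1[OF bb(2) n cx(2)]
  have cr: "cross (x \<otimes>\<^bsub>grpG m n\<^esub> p) = cross x"
    using pp(2) mn by (simp add: cross_def R field_simps del: index_mult_mat(1))
  have mr: "minor m (fst x * fst p) = minor m (fst x)" "minor n (snd x * snd p) = minor n (snd x)"
  proof -
    show "minor m (fst x * fst p) = minor m (fst x)"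
    proof (cases "1 < m")
      case True
      then have "3 < 2*m" by linarith
      then show ?thesis using pp(2) mn by (simp add: minor_def R field_simps del: index_mult_mat(1))
    qed (simp add: minor_def)
    show "minor n (snd x * snd p) = minor n (snd x)"
    proof (cases "1 < n")
      case True
      then have "3 < 2*n" by linarith
      then show ?thesis using pp(2) mn by (simp add: minor_def R field_simps del: index_mult_mat(1))
    qed (simp add: minor_def)
  qed
  have cl: "cross (b \<otimes>\<^bsub>grpG m n\<^esub> x) = cross x / (fst b $$ (0,0) * snd b $$ (0,0))"
    using nz mn by (simp add: cross_def L field_simps del: index_mult_mat(1))
  have ml: "minor m (fst x) ^ k4 = (fst b $$ (0,0) * fst b $$ (2,2)) ^ k4 * minor m (fst b * fst x) ^ k4"
  proof (cases "1 < m")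
    case True
    then show ?thesis
      using borel_mult_minor[OF bb(1) True cx(1)] borel_row3(1)[OF bb(1) True] nz
      by (simp add: power_mult_distrib[symmetric] del: index_mult_mat(1))
  qed (use m k4 in simp)
  have ml': "minor n (snd x) ^ k5 = (snd b $$ (0,0) * snd b $$ (2,2)) ^ k5 * minor n (snd b * snd x) ^ k5"
  proof (cases "1 < n")
    case True
    then show ?thesis
      using borel_mult_minor[OF bb(2) True cx(2)] borel_row3(1)[OF bb(2) True] nz
      by (simp add: power_mult_distrib[symmetric] del: index_mult_mat(1))
  qed (use n k5 in simp)
  have corner: "fst p $$ (1,1) = 1 / a" by (rule par_cols_corner[OF pp(3) cp(1) m])
  have "f_std m n k1 k2 k3 k4 k5 (x \<otimes>\<^bsub>grpG m n\<^esub> p) =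
      (fst x $$ (1,1) / a) ^ k2 * ((snd x $$ (1,1) / a) ^ k3 * (cross x ^ k1 *
      (minor m (fst x) ^ k4 * minor n (snd x) ^ k5)))"
    unfolding f_std_def cr using R(2)[OF mn(2)] R(4)[OF mn(4)] mr by simp
  also have "\<dots> = om_std k1 k2 k3 k4 k5 b * ((fst x $$ (1,1) / fst b $$ (0,0)) ^ k2 *
      ((snd x $$ (1,1) / snd b $$ (0,0)) ^ k3 * ((cross x / (fst b $$ (0,0) * snd b $$ (0,0))) ^ k1 *
      (minor m (fst b * fst x) ^ k4 * minor n (snd b * snd x) ^ k5)))) * ch_std (k2 + k3) p"
    unfolding om_std_def ch_std_def corner ml ml' using nz pp(2)
    by (simp add: power_add power_divide power_mult_distrib power_one_over field_simps)
  also have "\<dots> = om_std k1 k2 k3 k4 k5 b * f_std m n k1 k2 k3 k4 k5 (b \<otimes>\<^bsub>grpG m n\<^esub> x) * ch_std (k2 + k3) p"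
    unfolding f_std_def cl using L(1)[OF mn(2)] L(2)[OF mn(4)] by simp
  finally show ?thesis .
qed

lemma f_std_nz: "\<exists>x\<in>carrier (grpG m n). f_std m n k1 k2 k3 k4 k5 x \<noteq> 0"
proof -
  let ?z = "(Zmat m 1 1 0 0 1, Zmat n 1 1 0 (-1) 1)"
  have "?z \<in> carrier (grpG m n)" using m n by (simp add: grpG_carrier Zmat_Sp)
  moreover have "f_std m n k1 k2 k3 k4 k5 ?z \<noteq> 0"
    using m n by (simp add: f_std_def cross_def Zmat_corner minor_Zmat)
  ultimately show ?thesis by blast
qed

end

section \<open>Conjugation and the extended weight monoid\<close>

declare grpG_mult [simp del] grpG_one [simp del]

context group
begin

lemma cancel_left: "a \<in> carrier G \<Longrightarrow> y \<in> carrier G \<Longrightarrow> inv a \<otimes> (a \<otimes> y) = y"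
  "a \<in> carrier G \<Longrightarrow> y \<in> carrier G \<Longrightarrow> a \<otimes> (inv a \<otimes> y) = y"
  by (simp_all add: m_assoc[symmetric])

lemma unconj: "a \<in> carrier G \<Longrightarrow> s \<in> carrier G \<Longrightarrow> inv a \<otimes> (a \<otimes> s \<otimes> inv a) \<otimes> a = s"
  by (simp add: m_assoc cancel_left)

lemma conj_mult:
  "a \<in> carrier G \<Longrightarrow> s \<in> carrier G \<Longrightarrow> s' \<in> carrier G \<Longrightarrow>
    (a \<otimes> s \<otimes> inv a) \<otimes> (a \<otimes> s' \<otimes> inv a) = a \<otimes> (s \<otimes> s') \<otimes> inv a"
  by (simp add: m_assoc cancel_left)

lemma semi_conj1:
  "\<lbrakk>g \<in> carrier G; h \<in> carrier G; b \<in> carrier G; x \<in> carrier G; p \<in> carrier G\<rbrakk> \<Longrightarrow>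
    inv (g \<otimes> b \<otimes> inv g) \<otimes> (g \<otimes> (b \<otimes> x) \<otimes> inv h) \<otimes> (h \<otimes> p \<otimes> inv h) = g \<otimes> (x \<otimes> p) \<otimes> inv h"
  by (simp add: m_assoc inv_mult_group cancel_left)

lemma semi_conj2:
  "\<lbrakk>g \<in> carrier G; h \<in> carrier G; b \<in> carrier G; x \<in> carrier G; p \<in> carrier G\<rbrakk> \<Longrightarrow>
    inv g \<otimes> (inv (g \<otimes> b \<otimes> inv g) \<otimes> x \<otimes> (h \<otimes> p \<otimes> inv h)) \<otimes> h = (inv b \<otimes> (inv g \<otimes> x \<otimes> h)) \<otimes> p"
  by (simp add: m_assoc inv_mult_group cancel_left)

end

abbreviation push where
  "push m n a x \<equiv> a \<otimes>\<^bsub>grpG m n\<^esub> x \<otimes>\<^bsub>grpG m n\<^esub> inv\<^bsub>grpG m n\<^esub> a"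

abbreviation pull where
  "pull m n a x \<equiv> inv\<^bsub>grpG m n\<^esub> a \<otimes>\<^bsub>grpG m n\<^esub> x \<otimes>\<^bsub>grpG m n\<^esub> a"

definition char_on :: "nat \<Rightarrow> nat \<Rightarrow> (cmat \<times> cmat) set \<Rightarrow> (cmat \<times> cmat \<Rightarrow> complex) \<Rightarrow> bool" where
  "char_on m n K \<phi> \<longleftrightarrow> (\<exists>p\<in>poly_fun m n. \<forall>x\<in>K. \<phi> x = p x) \<and> (\<forall>x\<in>K. \<phi> x \<noteq> 0) \<and>
     (\<forall>x\<in>K. \<forall>y\<in>K. \<phi> (x \<otimes>\<^bsub>grpG m n\<^esub> y) = \<phi> x * \<phi> y)"

lemma char_on_subset: "char_on m n K \<phi> \<Longrightarrow> K' \<subseteq> K \<Longrightarrow> char_on m n K' \<phi>"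
  unfolding char_on_def by blast

definition mult_closed :: "nat \<Rightarrow> nat \<Rightarrow> (cmat \<times> cmat) set \<Rightarrow> bool" where
  "mult_closed m n K \<longleftrightarrow> K \<subseteq> carrier (grpG m n) \<and> (\<forall>x\<in>K. \<forall>y\<in>K. x \<otimes>\<^bsub>grpG m n\<^esub> y \<in> K)"

lemma poly_fun_translate_G:
  assumes "p \<in> poly_fun m n" "a \<in> carrier (grpG m n)" "b \<in> carrier (grpG m n)"
  shows "\<exists>q\<in>poly_fun m n. \<forall>x\<in>carrier (grpG m n). q x = p (a \<otimes>\<^bsub>grpG m n\<^esub> x \<otimes>\<^bsub>grpG m n\<^esub> b)"
proof -
  obtain q where q: "q \<in> poly_fun m n"
    "\<forall>x. fst x \<in> carrier_mat (2*m) (2*m) \<longrightarrow> snd x \<in> carrier_mat (2*n) (2*n) \<longrightarrow>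
     q x = p (fst a * fst x * fst b, snd a * snd x * snd b)"
    using poly_fun_translate[OF assms(1) grpG_carrier_mat[OF assms(2)] grpG_carrier_mat[OF assms(3)]] by blast
  have "q x = p (a \<otimes>\<^bsub>grpG m n\<^esub> x \<otimes>\<^bsub>grpG m n\<^esub> b)" if "x \<in> carrier (grpG m n)" for x
    using q(2)[rule_format, OF grpG_carrier_mat[OF that]] by (simp only: grpG_mult fst_conv snd_conv)
  then show ?thesis using q(1) by blast
qed

lemma conj_set_elem:
  assumes "a \<in> carrier (grpG m n)" "K \<subseteq> carrier (grpG m n)" "x \<in> conj_set (grpG m n) a K"
  shows "pull m n a x \<in> K" "x \<in> carrier (grpG m n)"
proof -
  interpret G: group "grpG m n" by (rule grpG_group)
  obtain s where s: "s \<in> K" "x = push m n a s"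
    using assms(3) by (auto simp: conj_set_def)
  have sG: "s \<in> carrier (grpG m n)" using s assms(2) by blast
  show "pull m n a x \<in> K"
    unfolding s(2) G.unconj[OF assms(1) sG] by (rule s(1))
  show "x \<in> carrier (grpG m n)" unfolding s(2) using assms(1) sG by simp
qed

lemma conj_set_closed:
  assumes a: "a \<in> carrier (grpG m n)" and K: "mult_closed m n K"
  shows "mult_closed m n (conj_set (grpG m n) a K)"
proof -
  interpret G: group "grpG m n" by (rule grpG_group)
  show ?thesis unfolding mult_closed_def
  proof (intro conjI ballI subsetI)
    fix x assume "x \<in> conj_set (grpG m n) a K"
    then show "x \<in> carrier (grpG m n)" using conj_set_elem(2)[OF a] K unfolding mult_closed_def by blast
  next
    fix x y assume "x \<in> conj_set (grpG m n) a K" "y \<in> conj_set (grpG m n) a K"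
    then obtain s t where st: "s \<in> K" "x = push m n a s"
      "t \<in> K" "y = push m n a t"
      by (auto simp: conj_set_def)
    have c: "s \<in> carrier (grpG m n)" "t \<in> carrier (grpG m n)" "s \<otimes>\<^bsub>grpG m n\<^esub> t \<in> K"
      using st K unfolding mult_closed_def by blast+
    show "x \<otimes>\<^bsub>grpG m n\<^esub> y \<in> conj_set (grpG m n) a K"
      unfolding st(2,4) G.conj_mult[OF a c(1,2)] conj_set_def using c(3) by blast
  qed
qed

lemma char_conj:
  assumes a: "a \<in> carrier (grpG m n)" and K: "mult_closed m n K" and \<phi>: "char_on m n K \<phi>"
  shows "(\<lambda>x\<in>conj_set (grpG m n) a K. \<phi> (pull m n a x))
     \<in> characters m n (conj_set (grpG m n) a K)"
proof -
  interpret G: group "grpG m n" by (rule grpG_group)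
  let ?C = "conj_set (grpG m n) a K" and ?u = "\<lambda>x. pull m n a x"
  have KG: "K \<subseteq> carrier (grpG m n)" using K by (simp add: mult_closed_def)
  note el = conj_set_elem[OF a KG]
  obtain p where p: "p \<in> poly_fun m n" "\<forall>x\<in>K. \<phi> x = p x" using \<phi> by (auto simp: char_on_def)
  obtain q where q: "q \<in> poly_fun m n" "\<forall>x\<in>carrier (grpG m n). q x = p (?u x)"
    using poly_fun_translate_G[OF p(1) G.inv_closed[OF a] a] by blast
  have "(\<lambda>x\<in>?C. \<phi> (?u x)) = restrict q ?C"
  proof (rule restrict_ext)
    fix x assume "x \<in> ?C"
    then show "\<phi> (?u x) = q x" using el[of x] p(2) q(2) by simp
  qed
  then have "(\<lambda>x\<in>?C. \<phi> (?u x)) \<in> regular_functions m n ?C"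
    unfolding regular_functions_def using q(1) by blast
  moreover have "(\<lambda>x\<in>?C. \<phi> (?u x)) x \<noteq> 0" if "x \<in> ?C" for x
    using el[OF that] that \<phi> by (simp add: char_on_def)
  moreover have "(\<lambda>x\<in>?C. \<phi> (?u x)) (x \<otimes>\<^bsub>grpG m n\<^esub> y) = (\<lambda>x\<in>?C. \<phi> (?u x)) x * (\<lambda>x\<in>?C. \<phi> (?u x)) y"
    if xy: "x \<in> ?C" "y \<in> ?C" for x y
  proof -
    have "x \<otimes>\<^bsub>grpG m n\<^esub> y \<in> ?C" using conj_set_closed[OF a K] xy unfolding mult_closed_def by blast
    moreover have "?u (x \<otimes>\<^bsub>grpG m n\<^esub> y) = ?u x \<otimes>\<^bsub>grpG m n\<^esub> ?u y"
      using el[OF xy(1)] el[OF xy(2)] a by (simp add: G.m_assoc G.cancel_left)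
    ultimately show ?thesis
      using el[OF xy(1)] el[OF xy(2)] xy \<phi> by (simp add: char_on_def)
  qed
  ultimately show ?thesis unfolding characters_def by blast
qed

lemma char_unconj:
  assumes a: "a \<in> carrier (grpG m n)" and K: "mult_closed m n K"
    and \<chi>: "\<chi> \<in> characters m n (conj_set (grpG m n) a K)"
  shows "char_on m n K (\<lambda>s. \<chi> (push m n a s))"
proof -
  interpret G: group "grpG m n" by (rule grpG_group)
  let ?C = "conj_set (grpG m n) a K" and ?v = "\<lambda>x. a \<otimes>\<^bsub>grpG m n\<^esub> x \<otimes>\<^bsub>grpG m n\<^esub> inv\<^bsub>grpG m n\<^esub> a"
  have KG: "\<And>s. s \<in> K \<Longrightarrow> s \<in> carrier (grpG m n)" using K by (auto simp: mult_closed_def)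
  have C: "?v s \<in> ?C" if "s \<in> K" for s using that by (auto simp: conj_set_def)
  obtain p where p: "p \<in> poly_fun m n" "\<chi> = restrict p ?C"
    using \<chi> by (auto simp: characters_def regular_functions_def)
  obtain q where q: "q \<in> poly_fun m n" "\<forall>x\<in>carrier (grpG m n). q x = p (?v x)"
    using poly_fun_translate_G[OF p(1) a G.inv_closed[OF a]] by blast
  show ?thesis unfolding char_on_def
  proof (intro conjI ballI)
    show "\<exists>p\<in>poly_fun m n. \<forall>x\<in>K. \<chi> (?v x) = p x"
      using q C KG p(2) by (intro bexI[of _ q]) simp_all
    show "\<chi> (?v x) \<noteq> 0" if "x \<in> K" for x using \<chi> C[OF that] by (simp add: characters_def)
    show "\<chi> (?v (x \<otimes>\<^bsub>grpG m n\<^esub> y)) = \<chi> (?v x) * \<chi> (?v y)" if "x \<in> K" "y \<in> K" for x y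
      unfolding G.conj_mult[OF a KG[OF that(1)] KG[OF that(2)], symmetric]
      using \<chi> C[OF that(1)] C[OF that(2)] by (simp add: characters_def)
  qed
qed

definition T_std :: "nat \<Rightarrow> nat \<Rightarrow> (cmat \<times> cmat) set" where
  "T_std m n = Sp_torus m \<times> Sp_torus n"

definition TH_std :: "nat \<Rightarrow> nat \<Rightarrow> (cmat \<times> cmat) set" where
  "TH_std m n = {x \<in> T_std m n. fst x $$ (0,0) = snd x $$ (0,0)}"

lemma Dmat_torus: "(\<And>l. a l \<noteq> 0) \<Longrightarrow> Dmat k a \<in> Sp_torus k"
  by (simp add: Sp_torus_def Dmat_Sp Dmat_diagonal)

lemma torus_Dmat:
  assumes "A \<in> Sp_torus k"
  obtains a where "\<forall>l. a l \<noteq> 0" "A = Dmat k a"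
proof -
  have A: "A \<in> carrier (Sp k)" and d: "diagonal_mat A" using assms by (simp_all add: Sp_torus_def)
  note cm = Sp_carrier_mat[OF A]
  have col: "colv A j = (\<lambda>i. A $$ (j,j) * unitv j i)" if "j < 2*k" for j
    using d cm that by (auto simp: colv_def unitv_apply diagonal_mat_def fun_eq_iff)
  have r: "A $$ (2*l,2*l) * A $$ (Suc (2*l), Suc (2*l)) = 1" if "l < k" for l
  proof -
    have l: "2*l < 2*k" "Suc (2*l) < 2*k" using that by linarith+
    have "Om k (unitv (2*l)) (unitv (Suc (2*l))) = 1" using l by (simp add: Om_unitv_left unitv_apply)
    then show ?thesis using Sp_form[OF A l] unfolding col[OF l(1)] col[OF l(2)]
      by (simp add: Om_scale_left) (simp only: mult.commute)
  qed
  define a where "a = (\<lambda>l. if l < k then A $$ (2*l,2*l) else 1)"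
  have nz: "a l \<noteq> 0" for l using r[of l] by (auto simp: a_def)
  have "A = Dmat k a"
  proof (rule eq_matI)
    fix i j assume "i < dim_row (Dmat k a)" "j < dim_col (Dmat k a)"
    then have ij: "i < 2*k" "j < 2*k" by (simp_all add: Dmat_def)
    show "A $$ (i,j) = Dmat k a $$ (i,j)"
    proof (cases "i = j")
      case False
      then show ?thesis using d cm ij by (simp add: Dmat_nth diagonal_mat_def)
    next
      case True
      show ?thesis
      proof (cases "even i")
        case e: True
        then show ?thesis using True ij by (auto simp: Dmat_nth diag_entry_def a_def elim!: evenE)
      next
        case False
        then obtain l where l: "i = Suc (2*l)" by (elim oddE) simp
        then have lk: "l < k" using ij by linarith
        have "A $$ (Suc (2*l), Suc (2*l)) = 1 / A $$ (2*l,2*l)"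
          using r[OF lk] nz[of l] lk by (simp add: a_def eq_divide_eq mult.commute)
        moreover have "j = Suc (2*l)" using True l by simp
        ultimately show ?thesis unfolding l using lk by (simp add: Dmat_nth diag_entry_def a_def)
      qed
    qed
  qed (use cm in \<open>auto simp: Dmat_def\<close>)
  then show ?thesis using that nz by blast
qed

lemma T_std_Dmat:
  assumes "s \<in> T_std m n"
  obtains a d where "\<forall>l. a l \<noteq> 0" "\<forall>l. d l \<noteq> 0" "s = (Dmat m a, Dmat n d)"
proof -
  have s: "fst s \<in> Sp_torus m" "snd s \<in> Sp_torus n" using assms by (auto simp: T_std_def)
  obtain a where "\<forall>l. a l \<noteq> 0" "fst s = Dmat m a" using torus_Dmat[OF s(1)] by blast
  moreover obtain d where "\<forall>l. d l \<noteq> 0" "snd s = Dmat n d" using torus_Dmat[OF s(2)] by blast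
  ultimately show ?thesis using that[of a d] by (simp add: prod_eq_iff)
qed

lemma Dmat_T_std: "(\<And>l. a l \<noteq> 0) \<Longrightarrow> (\<And>l. d l \<noteq> 0) \<Longrightarrow> (Dmat m a, Dmat n d) \<in> T_std m n"
  by (simp add: T_std_def Dmat_torus)

lemma Dmat_corner: "1 \<le> k \<Longrightarrow> Dmat k a $$ (0,0) = a 0" "1 < k \<Longrightarrow> Dmat k a $$ (2,2) = a 1"
  "1 \<le> k \<Longrightarrow> Dmat k a $$ (1,1) = 1 / a 0"
proof -
  show "Dmat k a $$ (0,0) = a 0" if "1 \<le> k" using that by (simp add: Dmat_nth diag_entry_def)
  show "Dmat k a $$ (2,2) = a 1" if "1 < k" using that by (simp add: Dmat_nth diag_entry_def)
  assume "1 \<le> k"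
  then have "1 < 2*k" by linarith
  then show "Dmat k a $$ (1,1) = 1 / a 0" by (simp add: Dmat_nth diag_entry_def)
qed

lemma T_std_closed: "mult_closed m n (T_std m n)"
  unfolding mult_closed_def
proof (intro conjI ballI subsetI)
  fix x assume "x \<in> T_std m n" then show "x \<in> carrier (grpG m n)"
    by (auto simp: T_std_def grpG_carrier Sp_torus_def)
next
  fix x y assume x: "x \<in> T_std m n" and y: "y \<in> T_std m n"
  obtain a d where "\<forall>l. a l \<noteq> 0" "\<forall>l. d l \<noteq> 0" "x = (Dmat m a, Dmat n d)" using T_std_Dmat[OF x] by blast
  moreover obtain a' d' where "\<forall>l. a' l \<noteq> 0" "\<forall>l. d' l \<noteq> 0" "y = (Dmat m a', Dmat n d')" using T_std_Dmat[OF y] by blast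
  ultimately show "x \<otimes>\<^bsub>grpG m n\<^esub> y \<in> T_std m n"
    by (simp add: grpG_mult Dmat_Dmat Dmat_T_std)
qed

lemma T_std_B_std: "T_std m n \<subseteq> B_std m n"
proof
  fix x assume "x \<in> T_std m n"
  then obtain a d where "\<forall>l. a l \<noteq> 0" "\<forall>l. d l \<noteq> 0" "x = (Dmat m a, Dmat n d)" using T_std_Dmat by blast
  then show "x \<in> B_std m n" by (simp add: B_std_def Dmat_borel)
qed

lemma B_std_closed: "mult_closed m n (B_std m n)"
  unfolding mult_closed_def using B_std_G by (auto simp: B_std_def grpG_mult borel_mult_closed)

lemma P_std_closed: "1 \<le> m \<Longrightarrow> 1 \<le> n \<Longrightarrow> mult_closed m n (P_std m n)"
  unfolding mult_closed_def using P_std_G P_std_mult_closed by blast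

lemma TH_std_Dmat:
  assumes "s \<in> TH_std m n" "1 \<le> m" "1 \<le> n"
  obtains a d where "\<forall>l. a l \<noteq> 0" "\<forall>l. d l \<noteq> 0" "s = (Dmat m a, Dmat n d)" "a 0 = d 0"
proof -
  obtain a d where ad: "\<forall>l. a l \<noteq> 0" "\<forall>l. d l \<noteq> 0" "s = (Dmat m a, Dmat n d)"
    using T_std_Dmat[of s m n] assms(1) unfolding TH_std_def by blast
  then have "a 0 = d 0" using assms by (simp add: TH_std_def Dmat_corner)
  then show ?thesis using that ad by blast
qed

lemma Dmat_TH_std:
  "(\<And>l. a l \<noteq> 0) \<Longrightarrow> (\<And>l. d l \<noteq> 0) \<Longrightarrow> a 0 = d 0 \<Longrightarrow> 1 \<le> m \<Longrightarrow> 1 \<le> n \<Longrightarrow>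
    (Dmat m a, Dmat n d) \<in> TH_std m n"
  by (simp add: TH_std_def Dmat_T_std Dmat_corner)

lemma TH_std_P_std:
  assumes "1 \<le> m" "1 \<le> n"
  shows "TH_std m n \<subseteq> P_std m n"
proof
  fix x assume "x \<in> TH_std m n"
  then obtain a d where ad: "\<forall>l. a l \<noteq> 0" "\<forall>l. d l \<noteq> 0" "x = (Dmat m a, Dmat n d)" "a 0 = d 0"
    using TH_std_Dmat assms by blast
  show "x \<in> P_std m n"
    by (rule P_stdI[of _ _ _ "a 0" 0])
       (use ad assms Dmat_par_cols[of m a] Dmat_par_cols[of n d] in \<open>simp_all add: grpG_carrier Dmat_Sp\<close>)
qed

lemma TH_std_closed:
  assumes "1 \<le> m" "1 \<le> n"
  shows "mult_closed m n (TH_std m n)"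
  unfolding mult_closed_def
proof (intro conjI ballI subsetI)
  fix x assume "x \<in> TH_std m n" then show "x \<in> carrier (grpG m n)"
    using T_std_closed by (auto simp: TH_std_def mult_closed_def)
next
  fix x y assume x: "x \<in> TH_std m n" and y: "y \<in> TH_std m n"
  obtain a d where "\<forall>l. a l \<noteq> 0" "\<forall>l. d l \<noteq> 0" "x = (Dmat m a, Dmat n d)" "a 0 = d 0"
    using TH_std_Dmat[OF x assms] by blast
  moreover obtain a' d' where "\<forall>l. a' l \<noteq> 0" "\<forall>l. d' l \<noteq> 0" "y = (Dmat m a', Dmat n d')" "a' 0 = d' 0"
    using TH_std_Dmat[OF y assms] by blast
  ultimately show "x \<otimes>\<^bsub>grpG m n\<^esub> y \<in> TH_std m n"
    using assms by (simp add: grpG_mult Dmat_Dmat Dmat_TH_std)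
qed

lemma conj_set_mono: "K \<subseteq> K' \<Longrightarrow> conj_set G a K \<subseteq> conj_set G a K'"
  by (auto simp: conj_set_def)

context exponent_tuple
begin

lemma om_char_on: "char_on m n (B_std m n) (om_std k1 k2 k3 k4 k5)"
  unfolding char_on_def using om_std_poly om_std_nz om_std_mult by blast

lemma ch_char_on: "char_on m n (P_std m n) (ch_std k)"
  unfolding char_on_def using ch_std_poly ch_std_nz ch_std_mult by blast

lemma om_std_D: "om_std k1 k2 k3 k4 k5 (Dmat m a, Dmat n d) =
    a 0 ^ (k1 + k2 + k4) * a 1 ^ k4 * d 0 ^ (k1 + k3 + k5) * d 1 ^ k5"
proof -
  have "Dmat m a $$ (2,2) ^ k4 = a 1 ^ k4" using Dmat_corner(2)[of m a] k4 m by (cases "m = 1") auto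
  moreover have "Dmat n d $$ (2,2) ^ k5 = d 1 ^ k5" using Dmat_corner(2)[of n d] k5 n by (cases "n = 1") auto
  ultimately show ?thesis by (simp add: om_std_def Dmat_corner m n)
qed

end

lemma ch_std_D: "1 \<le> m \<Longrightarrow> ch_std k (Dmat m a, D) = (1 / a 0) ^ k"
  by (simp add: ch_std_def Dmat_corner)

text \<open>The element \<open>k1 (\<omega>\<^sub>1 + \<omega>'\<^sub>1, 0) + k2 (\<omega>\<^sub>1, -\<varpi>'\<^sub>1) + k3 (\<omega>'\<^sub>1, -\<varpi>'\<^sub>1) + k4 (\<omega>\<^sub>2, 0) + k5 (\<omega>'\<^sub>2, 0)\<close> of the group of
pairs of weights.\<close>

definition weight_pair :: "nat \<Rightarrow> nat \<Rightarrow> cmat \<times> cmat \<Rightarrow> cmat \<times> cmat \<Rightarrow> (cmat \<times> cmat) set \<Rightarrow> (cmat \<times> cmat) set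
    \<Rightarrow> nat \<Rightarrow> nat \<Rightarrow> nat \<Rightarrow> nat \<Rightarrow> nat \<Rightarrow> (cmat \<times> cmat \<Rightarrow> complex) \<times> (cmat \<times> cmat \<Rightarrow> complex)" where
  "weight_pair m n g h T TH k1 k2 k3 k4 k5 =
    (\<lambda>t\<in>T. om_std k1 k2 k3 k4 k5 (pull m n g t),
     \<lambda>t\<in>TH. ch_std (k2 + k3) (pull m n h t))"

locale standard_setup =
  fixes m n :: nat and g h :: "cmat \<times> cmat" and T B TH P :: "(cmat \<times> cmat) set"
  assumes m: "1 \<le> m" and n: "1 \<le> n"
    and g: "g \<in> carrier (grpG m n)" and h: "h \<in> carrier (grpG m n)"
    and T: "T = conj_set (grpG m n) g (T_std m n)" and B: "B = conj_set (grpG m n) g (B_std m n)"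
    and TH: "TH = conj_set (grpG m n) h (TH_std m n)" and P: "P = conj_set (grpG m n) h (P_std m n)"
begin

sublocale G: group "grpG m n" by (rule grpG_group)

lemma T_B: "T \<subseteq> B" and TH_P: "TH \<subseteq> P"
  unfolding T B TH P using m n by (intro conj_set_mono T_std_B_std TH_std_P_std; simp)+

lemma std_subset: "T_std m n \<subseteq> carrier (grpG m n)" "B_std m n \<subseteq> carrier (grpG m n)"
  "TH_std m n \<subseteq> carrier (grpG m n)" "P_std m n \<subseteq> carrier (grpG m n)"
  using T_std_closed B_std_closed TH_std_closed[OF m n] P_std_closed[OF m n] by (auto simp: mult_closed_def)

lemma ext_weight_monoid_subset:
  assumes "z \<in> ext_weight_monoid m n T B TH P"
  shows "\<exists>k1 k2 k3 k4 k5. (m = 1 \<longrightarrow> k4 = 0) \<and> (n = 1 \<longrightarrow> k5 = 0) \<and> z = weight_pair m n g h T TH k1 k2 k3 k4 k5"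
proof -
  let ?G = "grpG m n"
  obtain \<omega> \<chi> f where z: "z = (restrict \<omega> T, restrict \<chi> TH)" and \<omega>: "\<omega> \<in> characters m n B" and \<chi>: "\<chi> \<in> characters m n P"
    and f: "f \<in> regular_functions m n (carrier ?G)" and nz: "\<exists>x\<in>carrier ?G. f x \<noteq> 0"
    and semi: "\<And>b x p. b \<in> B \<Longrightarrow> x \<in> carrier ?G \<Longrightarrow> p \<in> P \<Longrightarrow>
       f (inv\<^bsub>?G\<^esub> b \<otimes>\<^bsub>?G\<^esub> x \<otimes>\<^bsub>?G\<^esub> p) = \<omega> b * f x * \<chi> p"
    using assms unfolding ext_weight_monoid_def by blast
  obtain q where q: "q \<in> poly_fun m n" "f = restrict q (carrier ?G)"
    using f by (auto simp: regular_functions_def)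
  obtain f0 where f0: "f0 \<in> poly_fun m n" "\<forall>x\<in>carrier ?G. f0 x = q (g \<otimes>\<^bsub>?G\<^esub> x \<otimes>\<^bsub>?G\<^esub> inv\<^bsub>?G\<^esub> h)"
    using poly_fun_translate_G[OF q(1) g G.inv_closed[OF h]] by blast
  have f0f: "f0 x = f (g \<otimes>\<^bsub>?G\<^esub> x \<otimes>\<^bsub>?G\<^esub> inv\<^bsub>?G\<^esub> h)" if "x \<in> carrier ?G" for x
    using f0(2) that g h q(2) by simp
  define om where "om = (\<lambda>b. \<omega> (push m n g b))"
  define ch where "ch = (\<lambda>p. \<chi> (push m n h p))"
  have om: "char_on m n (B_std m n) om"
    using char_unconj[OF g B_std_closed] \<omega> unfolding om_def B by blast
  have ch: "char_on m n (P_std m n) ch"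
    using char_unconj[OF h P_std_closed[OF m n]] \<chi> unfolding ch_def P by blast
  interpret S: nonzero_semi_invariant m n f0 om ch
  proof
    show "1 \<le> m" "1 \<le> n" "f0 \<in> poly_fun m n" using m n f0 by simp_all
    show "\<exists>p\<in>poly_fun m n. \<forall>x\<in>B_std m n. om x = p x"
      "\<And>x. x \<in> B_std m n \<Longrightarrow> om x \<noteq> 0"
      "\<And>x y. x \<in> B_std m n \<Longrightarrow> y \<in> B_std m n \<Longrightarrow> om (x \<otimes>\<^bsub>?G\<^esub> y) = om x * om y"
      using om unfolding char_on_def by blast+
    show "\<exists>p\<in>poly_fun m n. \<forall>x\<in>P_std m n. ch x = p x"
      "\<And>x. x \<in> P_std m n \<Longrightarrow> ch x \<noteq> 0"
      "\<And>x y. x \<in> P_std m n \<Longrightarrow> y \<in> P_std m n \<Longrightarrow> ch (x \<otimes>\<^bsub>?G\<^esub> y) = ch x * ch y"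
      using ch unfolding char_on_def by blast+
    fix b x p assume b: "b \<in> B_std m n" and x: "x \<in> carrier ?G" and p: "p \<in> P_std m n"
    have bG: "b \<in> carrier ?G" and pG: "p \<in> carrier ?G" using b p std_subset by blast+
    have "push m n g b \<in> B" "push m n h p \<in> P"
      using b p unfolding B P conj_set_def by blast+
    from semi[OF this(1) _ this(2), of "g \<otimes>\<^bsub>?G\<^esub> (b \<otimes>\<^bsub>?G\<^esub> x) \<otimes>\<^bsub>?G\<^esub> inv\<^bsub>?G\<^esub> h"]
    show "f0 (x \<otimes>\<^bsub>?G\<^esub> p) = om b * f0 (b \<otimes>\<^bsub>?G\<^esub> x) * ch p"
      unfolding G.semi_conj1[OF g h bG x pG] om_def ch_def using g h bG x pG by (simp add: f0f)
  next
    obtain x where x: "x \<in> carrier ?G" "f x \<noteq> 0" using nz by blast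
    have "g \<otimes>\<^bsub>?G\<^esub> (inv\<^bsub>?G\<^esub> g \<otimes>\<^bsub>?G\<^esub> x \<otimes>\<^bsub>?G\<^esub> h) \<otimes>\<^bsub>?G\<^esub> inv\<^bsub>?G\<^esub> h = x"
      using x g h by (simp add: G.m_assoc G.cancel_left)
    then have "f0 (inv\<^bsub>?G\<^esub> g \<otimes>\<^bsub>?G\<^esub> x \<otimes>\<^bsub>?G\<^esub> h) \<noteq> 0" using x g h by (simp add: f0f)
    then show "\<exists>x\<in>carrier ?G. f0 x \<noteq> 0" using x g h by (meson G.inv_closed G.m_closed)
  qed
  obtain k1 k2 k3 k4 k5 :: nat where k: "m = 1 \<longrightarrow> k4 = 0" "n = 1 \<longrightarrow> k5 = 0"
    and ko: "\<forall>a d. (\<forall>l. a l \<noteq> 0) \<longrightarrow> (\<forall>l. d l \<noteq> 0) \<longrightarrow>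
      om (Dmat m a, Dmat n d) = a 0 ^ (k1 + k2 + k4) * a 1 ^ k4 * d 0 ^ (k1 + k3 + k5) * d 1 ^ k5"
    and kc: "\<forall>t. t \<noteq> 0 \<longrightarrow> ch (cochar m {0} t, cochar n {0} t) = (1/t) ^ (k2 + k3)"
    using S.exponents by blast
  interpret K: exponent_tuple m n k1 k2 k3 k4 k5 using m n k by unfold_locales auto
  have "restrict \<omega> T = (\<lambda>t\<in>T. om_std k1 k2 k3 k4 k5 (pull m n g t))"
  proof (rule restrict_ext)
    fix t assume "t \<in> T"
    then obtain s where s: "s \<in> T_std m n" "t = push m n g s" by (auto simp: T conj_set_def)
    obtain a d where ad: "\<forall>l. a l \<noteq> 0" "\<forall>l. d l \<noteq> 0" "s = (Dmat m a, Dmat n d)" using T_std_Dmat[OF s(1)] by blast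
    have sG: "s \<in> carrier ?G" using s std_subset by blast
    have "\<omega> t = om s" by (simp add: om_def s(2))
    also have "\<dots> = om_std k1 k2 k3 k4 k5 s" using ko ad(1,2) K.om_std_D by (simp add: ad(3))
    finally show "\<omega> t = om_std k1 k2 k3 k4 k5 (pull m n g t)"
      unfolding s(2) G.unconj[OF g sG] .
  qed
  moreover have "restrict \<chi> TH = (\<lambda>t\<in>TH. ch_std (k2 + k3) (pull m n h t))"
  proof (rule restrict_ext)
    fix t assume "t \<in> TH"
    then obtain s where s: "s \<in> TH_std m n" "t = push m n h s" by (auto simp: TH conj_set_def)
    obtain a d where ad: "\<forall>l. a l \<noteq> 0" "\<forall>l. d l \<noteq> 0" "s = (Dmat m a, Dmat n d)" "a 0 = d 0" using TH_std_Dmat[OF s(1) m n] by blast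
    have sG: "s \<in> carrier ?G" using s std_subset by blast
    define r where "r = (\<lambda>b :: nat \<Rightarrow> complex. \<lambda>l::nat. if l = 0 then 1 else b l)"
    have rF: "Dmat m (r a) \<in> Fixing m 1" "Dmat n (r d) \<in> Fixing n 1"
      using ad m n by (simp_all add: Dmat_Fixing r_def)
    have co: "Dmat k b = cochar k {0} (b 0) * Dmat k (r b)" for k b
      unfolding cochar_def Dmat_Dmat by (rule Dmat_cong) (auto simp: r_def)
    have cP: "(cochar m {0} (a 0), cochar n {0} (a 0)) \<in> P_std m n"
      unfolding cochar_def using ad by (intro S.D_par) auto
    have "\<chi> t = ch s" by (simp add: ch_def s(2))
    also have "s = (cochar m {0} (a 0), cochar n {0} (a 0)) \<otimes>\<^bsub>?G\<^esub> (Dmat m (r a), Dmat n (r d))"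
      unfolding ad(3) grpG_mult fst_conv snd_conv using co[of m a] co[of n d] ad(4) by simp
    also have "ch \<dots> = (1 / a 0) ^ (k2 + k3)"
      using S.ch_mult[OF cP Fixing_P_std[OF rF]] S.ch_Fixing[OF rF] kc ad(1) by simp
    also have "\<dots> = ch_std (k2 + k3) s" using m by (simp add: ad(3) ch_std_D)
    finally show "\<chi> t = ch_std (k2 + k3) (pull m n h t)"
      unfolding s(2) G.unconj[OF h sG] .
  qed
  ultimately have "z = weight_pair m n g h T TH k1 k2 k3 k4 k5" unfolding z weight_pair_def by simp
  then show ?thesis using k by blast
qed

lemma weight_pair_ext_weight_monoid:
  assumes "m = 1 \<longrightarrow> k4 = 0" "n = 1 \<longrightarrow> k5 = 0"
  shows "weight_pair m n g h T TH k1 k2 k3 k4 k5 \<in> ext_weight_monoid m n T B TH P"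
proof -
  let ?G = "grpG m n"
  interpret K: exponent_tuple m n k1 k2 k3 k4 k5 using m n assms by unfold_locales auto
  define \<omega> where "\<omega> = (\<lambda>t\<in>B. om_std k1 k2 k3 k4 k5 (pull m n g t))"
  define \<chi> where "\<chi> = (\<lambda>t\<in>P. ch_std (k2 + k3) (pull m n h t))"
  have \<omega>: "\<omega> \<in> characters m n B"
    unfolding \<omega>_def B by (rule char_conj[OF g B_std_closed K.om_char_on])
  have \<chi>: "\<chi> \<in> characters m n P"
    unfolding \<chi>_def P by (rule char_conj[OF h P_std_closed[OF m n] K.ch_char_on])
  let ?f = "f_std m n k1 k2 k3 k4 k5"
  obtain q where q: "q \<in> poly_fun m n" "\<forall>x\<in>carrier ?G. q x = ?f (inv\<^bsub>?G\<^esub> g \<otimes>\<^bsub>?G\<^esub> x \<otimes>\<^bsub>?G\<^esub> h)"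
    using poly_fun_translate_G[OF K.f_std_poly G.inv_closed[OF g] h] by blast
  define f where "f = restrict q (carrier ?G)"
  have f: "f \<in> regular_functions m n (carrier ?G)" unfolding f_def regular_functions_def using q(1) by blast
  have fx: "f x = ?f (inv\<^bsub>?G\<^esub> g \<otimes>\<^bsub>?G\<^esub> x \<otimes>\<^bsub>?G\<^esub> h)" if "x \<in> carrier ?G" for x
    using q(2) that by (simp add: f_def)
  have nz: "\<exists>x\<in>carrier ?G. f x \<noteq> 0"
  proof -
    obtain x where x: "x \<in> carrier ?G" "?f x \<noteq> 0" using K.f_std_nz by blast
    have "inv\<^bsub>?G\<^esub> g \<otimes>\<^bsub>?G\<^esub> (g \<otimes>\<^bsub>?G\<^esub> x \<otimes>\<^bsub>?G\<^esub> inv\<^bsub>?G\<^esub> h) \<otimes>\<^bsub>?G\<^esub> h = x"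
      using x g h by (simp add: G.m_assoc G.cancel_left)
    then have "f (g \<otimes>\<^bsub>?G\<^esub> x \<otimes>\<^bsub>?G\<^esub> inv\<^bsub>?G\<^esub> h) \<noteq> 0" using x g h by (simp add: fx)
    then show ?thesis using x g h by (meson G.inv_closed G.m_closed)
  qed
  have semi: "f (inv\<^bsub>?G\<^esub> b \<otimes>\<^bsub>?G\<^esub> x \<otimes>\<^bsub>?G\<^esub> p) = \<omega> b * f x * \<chi> p"
    if bB: "b \<in> B" and x: "x \<in> carrier ?G" and pP: "p \<in> P" for b x p
  proof -
    obtain s where s: "s \<in> B_std m n" "b = push m n g s" using bB by (auto simp: B conj_set_def)
    obtain r where r: "r \<in> P_std m n" "p = push m n h r" using pP by (auto simp: P conj_set_def)
    have sG: "s \<in> carrier ?G" and rG: "r \<in> carrier ?G" using s r std_subset by blast+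
    have bG: "b \<in> carrier ?G" and pG: "p \<in> carrier ?G" using s r sG rG g h by simp_all
    define y where "y = inv\<^bsub>?G\<^esub> g \<otimes>\<^bsub>?G\<^esub> x \<otimes>\<^bsub>?G\<^esub> h"
    have yG: "y \<in> carrier ?G" using x g h by (simp add: y_def)
    have "f (inv\<^bsub>?G\<^esub> b \<otimes>\<^bsub>?G\<^esub> x \<otimes>\<^bsub>?G\<^esub> p) = ?f (inv\<^bsub>?G\<^esub> g \<otimes>\<^bsub>?G\<^esub> (inv\<^bsub>?G\<^esub> b \<otimes>\<^bsub>?G\<^esub> x \<otimes>\<^bsub>?G\<^esub> p) \<otimes>\<^bsub>?G\<^esub> h)"
      using bG pG x by (intro fx) simp
    also have "\<dots> = ?f ((inv\<^bsub>?G\<^esub> s \<otimes>\<^bsub>?G\<^esub> y) \<otimes>\<^bsub>?G\<^esub> r)"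
      unfolding s(2) r(2) G.semi_conj2[OF g h sG x rG] y_def ..
    also have "\<dots> = om_std k1 k2 k3 k4 k5 s * ?f (s \<otimes>\<^bsub>?G\<^esub> (inv\<^bsub>?G\<^esub> s \<otimes>\<^bsub>?G\<^esub> y)) * ch_std (k2 + k3) r"
      using s r sG yG by (intro K.f_std_semi) simp_all
    also have "s \<otimes>\<^bsub>?G\<^esub> (inv\<^bsub>?G\<^esub> s \<otimes>\<^bsub>?G\<^esub> y) = y" using sG yG by (simp add: G.cancel_left)
    also have "?f y = f x" unfolding y_def using fx[OF x] by simp
    also have "om_std k1 k2 k3 k4 k5 s = \<omega> b"
      unfolding \<omega>_def using bB s(2) G.unconj[OF g sG] by simp
    also have "ch_std (k2 + k3) r = \<chi> p"
      unfolding \<chi>_def using pP r(2) G.unconj[OF h rG] by simp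
    finally show ?thesis .
  qed
  have "restrict \<omega> T = (\<lambda>t\<in>T. om_std k1 k2 k3 k4 k5 (pull m n g t))"
    by (rule restrict_ext) (use T_B in \<open>auto simp: \<omega>_def\<close>)
  moreover have "restrict \<chi> TH = (\<lambda>t\<in>TH. ch_std (k2 + k3) (pull m n h t))"
    by (rule restrict_ext) (use TH_P in \<open>auto simp: \<chi>_def\<close>)
  ultimately have E: "weight_pair m n g h T TH k1 k2 k3 k4 k5 = (restrict \<omega> T, restrict \<chi> TH)"
    unfolding weight_pair_def by simp
  have ex: "\<exists>f\<in>regular_functions m n (carrier ?G). (\<exists>x\<in>carrier ?G. f x \<noteq> 0) \<and>
      (\<forall>b\<in>B. \<forall>x\<in>carrier ?G. \<forall>p\<in>P. f (inv\<^bsub>?G\<^esub> b \<otimes>\<^bsub>?G\<^esub> x \<otimes>\<^bsub>?G\<^esub> p) = \<omega> b * f x * \<chi> p)"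
    by (intro bexI[of _ f] conjI nz ballI semi f)
  show ?thesis unfolding ext_weight_monoid_def mem_Collect_eq
    by (rule exI[of _ \<omega>], rule exI[of _ \<chi>]) (intro conjI E \<omega> \<chi> ex)
qed

lemma weight_pair_carrier:
  assumes "m = 1 \<longrightarrow> k4 = 0" "n = 1 \<longrightarrow> k5 = 0"
  shows "weight_pair m n g h T TH k1 k2 k3 k4 k5 \<in> carrier (char_group m n T \<times>\<times> char_group m n TH)"
proof -
  interpret K: exponent_tuple m n k1 k2 k3 k4 k5 using m n assms by unfold_locales auto
  have 1: "(\<lambda>t\<in>T. om_std k1 k2 k3 k4 k5 (pull m n g t)) \<in> characters m n T"
    unfolding T by (rule char_conj[OF g T_std_closed char_on_subset[OF K.om_char_on T_std_B_std]])
  have 2: "(\<lambda>t\<in>TH. ch_std (k2 + k3) (pull m n h t)) \<in> characters m n TH"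
    unfolding TH by (rule char_conj[OF h TH_std_closed[OF m n] char_on_subset[OF K.ch_char_on TH_std_P_std[OF m n]]])
  show ?thesis using 1 2 by (simp add: weight_pair_def char_group_def DirProd_def)
qed

lemma two_power_inj: "(2::complex) ^ a = 2 ^ b \<Longrightarrow> a = b"
proof -
  assume "(2::complex) ^ a = 2 ^ b"
  then have "of_nat (2 ^ a) = (of_nat (2 ^ b) :: complex)" by simp
  then have "(2::nat) ^ a = 2 ^ b" by (rule of_nat_eq_iff[THEN iffD1])
  then show "a = b" by simp
qed

text \<open>Powers of \<open>2\<close> at suitable torus elements reveal \<open>k1 + k2 + k4\<close>, \<open>k4\<close>, \<open>k1 + k3 + k5\<close>, \<open>k5\<close> and \<open>k2 + k3\<close>.\<close>

lemma weight_pair_inj: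
  assumes eq: "weight_pair m n g h T TH k1 k2 k3 k4 k5 = weight_pair m n g h T TH j1 j2 j3 j4 j5"
    and k: "m = 1 \<longrightarrow> k4 = 0" "n = 1 \<longrightarrow> k5 = 0" and j: "m = 1 \<longrightarrow> j4 = 0" "n = 1 \<longrightarrow> j5 = 0"
  shows "k1 = j1 \<and> k2 = j2 \<and> k3 = j3 \<and> k4 = j4 \<and> k5 = j5"
proof -
  interpret K: exponent_tuple m n k1 k2 k3 k4 k5 using m n k by unfold_locales auto
  interpret J: exponent_tuple m n j1 j2 j3 j4 j5 using m n j by unfold_locales auto
  have om: "om_std k1 k2 k3 k4 k5 s = om_std j1 j2 j3 j4 j5 s" if s: "s \<in> T_std m n" for s
  proof -
    let ?t = "push m n g s"
    have "?t \<in> T" using s by (auto simp: T conj_set_def)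
    then show ?thesis using fun_cong[OF arg_cong[OF eq, of fst], of ?t] G.unconj[OF g, of s] s std_subset
      by (auto simp: weight_pair_def)
  qed
  have ch: "ch_std (k2 + k3) s = ch_std (j2 + j3) s" if s: "s \<in> TH_std m n" for s
  proof -
    let ?t = "push m n h s"
    have "?t \<in> TH" using s by (auto simp: TH conj_set_def)
    then show ?thesis using fun_cong[OF arg_cong[OF eq, of snd], of ?t] G.unconj[OF h, of s] s std_subset
      by (auto simp: weight_pair_def)
  qed
  define a where "a = (\<lambda>i. \<lambda>l::nat. if l = i then 2 else 1 :: complex)"
  have a: "a i l \<noteq> 0" "a 0 0 = 2" "a 0 1 = 1" "a 1 0 = 1" "a 1 1 = 2" "a 2 0 = 1" "a 2 1 = 1" for i l
    by (simp_all add: a_def)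
  have D: "om_std k1 k2 k3 k4 k5 (Dmat m (a i), Dmat n (a i')) = om_std j1 j2 j3 j4 j5 (Dmat m (a i), Dmat n (a i'))" for i i'
    by (intro om Dmat_T_std a)
  have "k1 + k2 + k4 = j1 + j2 + j4" using D[of 0 2] unfolding K.om_std_D J.om_std_D by (simp add: a two_power_inj)
  moreover have "k4 = j4" using D[of 1 2] unfolding K.om_std_D J.om_std_D by (simp add: a two_power_inj)
  moreover have "k1 + k3 + k5 = j1 + j3 + j5" using D[of 2 0] unfolding K.om_std_D J.om_std_D by (simp add: a two_power_inj)
  moreover have "k5 = j5" using D[of 2 1] unfolding K.om_std_D J.om_std_D by (simp add: a two_power_inj)
  moreover have "k2 + k3 = j2 + j3"
  proof (rule two_power_inj)
    have "(Dmat m (\<lambda>l. 1/2), Dmat n (\<lambda>l. 1/2)) \<in> TH_std m n" using m n by (intro Dmat_TH_std) simp_all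
    from ch[OF this] show "(2::complex) ^ (k2 + k3) = 2 ^ (j2 + j3)" using m by (simp add: ch_std_D)
  qed
  ultimately show ?thesis by linarith
qed

end

section \<open>Free generation\<close>

lemma characters_restrict:
  assumes "\<chi> \<in> characters m n K"
  shows "restrict \<chi> K = \<chi>"
  using assms by (auto simp: characters_def regular_functions_def)

lemma characters_mult:
  assumes K: "mult_closed m n K" and \<chi>: "\<chi> \<in> characters m n K" and \<psi>: "\<psi> \<in> characters m n K"
  shows "(\<lambda>x\<in>K. \<chi> x * \<psi> x) \<in> characters m n K"
proof -
  obtain p q where pq: "p \<in> poly_fun m n" "\<chi> = restrict p K" "q \<in> poly_fun m n" "\<psi> = restrict q K"
    using \<chi> \<psi> by (auto simp: characters_def regular_functions_def)
  have "(\<lambda>x\<in>K. \<chi> x * \<psi> x) = restrict (\<lambda>x. p x * q x) K"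
    unfolding pq(2,4) by (rule restrict_ext) simp
  then have "(\<lambda>x\<in>K. \<chi> x * \<psi> x) \<in> regular_functions m n K"
    unfolding regular_functions_def using poly_fun.mult[OF pq(1,3)] by blast
  then show ?thesis
    using K \<chi> \<psi> unfolding characters_def mult_closed_def by (simp add: mult_ac)
qed

lemma characters_one:
  assumes K: "mult_closed m n K"
  shows "(\<lambda>x\<in>K. 1) \<in> characters m n K"
proof -
  have "(\<lambda>x\<in>K. 1) \<in> regular_functions m n K"
    unfolding regular_functions_def using poly_fun.const[of 1 m n] by blast
  then show ?thesis using K unfolding characters_def mult_closed_def by simp
qed

lemma char_group_comm_monoid:
  assumes K: "mult_closed m n K"
  shows "comm_monoid (char_group m n K)"
proof (rule comm_monoidI)
  fix \<chi> \<psi> \<theta> assume c: "\<chi> \<in> carrier (char_group m n K)" "\<psi> \<in> carrier (char_group m n K)" "\<theta> \<in> carrier (char_group m n K)"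
  show "\<chi> \<otimes>\<^bsub>char_group m n K\<^esub> \<psi> \<in> carrier (char_group m n K)"
    using characters_mult[OF K] c by (simp add: char_group_def)
  show "\<chi> \<otimes>\<^bsub>char_group m n K\<^esub> \<psi> \<otimes>\<^bsub>char_group m n K\<^esub> \<theta> = \<chi> \<otimes>\<^bsub>char_group m n K\<^esub> (\<psi> \<otimes>\<^bsub>char_group m n K\<^esub> \<theta>)"
    by (auto simp: char_group_def fun_eq_iff)
  show "\<chi> \<otimes>\<^bsub>char_group m n K\<^esub> \<psi> = \<psi> \<otimes>\<^bsub>char_group m n K\<^esub> \<chi>"
    by (auto simp: char_group_def fun_eq_iff)
  have "(\<lambda>x\<in>K. (\<lambda>x\<in>K. 1) x * \<chi> x) = restrict \<chi> K" by (rule restrict_ext) simp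
  then show "\<one>\<^bsub>char_group m n K\<^esub> \<otimes>\<^bsub>char_group m n K\<^esub> \<chi> = \<chi>"
    using c characters_restrict[of \<chi> m n K] by (simp add: char_group_def)
next
  show "\<one>\<^bsub>char_group m n K\<^esub> \<in> carrier (char_group m n K)"
    using characters_one[OF K] by (simp add: char_group_def)
qed

lemma DirProd_comm_monoid:
  assumes "comm_monoid G" "comm_monoid H"
  shows "comm_monoid (G \<times>\<times> H)"
proof -
  interpret G: comm_monoid G by (rule assms)
  interpret H: comm_monoid H by (rule assms)
  interpret GH: monoid "G \<times>\<times> H" by (rule DirProd_monoid) unfold_locales
  show ?thesis by unfold_locales (auto simp: DirProd_def G.m_comm H.m_comm)
qed

abbreviation char_prod where
  "char_prod m n T TH \<equiv> char_group m n T \<times>\<times> char_group m n TH"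

lemma char_prod_pow:
  assumes "mult_closed m n T" "mult_closed m n TH" and x: "x \<in> carrier (char_prod m n T TH)"
  shows "x [^]\<^bsub>char_prod m n T TH\<^esub> (k::nat) = (\<lambda>t\<in>T. fst x t ^ k, \<lambda>t\<in>TH. snd x t ^ k)"
proof (induction k)
  case 0
  then show ?case by (simp add: char_group_def DirProd_def nat_pow_def restrict_def)
next
  case (Suc k)
  have "x [^]\<^bsub>char_prod m n T TH\<^esub> Suc k = x [^]\<^bsub>char_prod m n T TH\<^esub> k \<otimes>\<^bsub>char_prod m n T TH\<^esub> x"
    by (simp add: nat_pow_def)
  then show ?case unfolding Suc by (cases x) (auto simp: char_group_def DirProd_def fun_eq_iff mult.commute)
qed

lemma char_prod_finprod:
  assumes T: "mult_closed m n T" "mult_closed m n TH" and S: "finite S"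
    and x: "\<And>i. i \<in> S \<Longrightarrow> x i \<in> carrier (char_prod m n T TH)"
  shows "(\<Otimes>\<^bsub>char_prod m n T TH\<^esub>i\<in>S. x i [^]\<^bsub>char_prod m n T TH\<^esub> (k i :: nat)) =
    (\<lambda>t\<in>T. \<Prod>i\<in>S. fst (x i) t ^ k i, \<lambda>t\<in>TH. \<Prod>i\<in>S. snd (x i) t ^ k i)"
proof -
  interpret A: comm_monoid "char_prod m n T TH"
    by (intro DirProd_comm_monoid char_group_comm_monoid T)
  show ?thesis using S x
  proof (induction S rule: finite_induct)
    case empty
    have "\<one>\<^bsub>char_prod m n T TH\<^esub> = (\<lambda>t\<in>T. 1, \<lambda>t\<in>TH. 1)"
      by (simp add: char_group_def DirProd_def)
    then show ?case by (simp add: restrict_def)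
  next
    case (insert i S)
    have "(\<Otimes>\<^bsub>char_prod m n T TH\<^esub>i\<in>insert i S. x i [^]\<^bsub>char_prod m n T TH\<^esub> k i) =
      x i [^]\<^bsub>char_prod m n T TH\<^esub> k i \<otimes>\<^bsub>char_prod m n T TH\<^esub>
      (\<Otimes>\<^bsub>char_prod m n T TH\<^esub>i\<in>S. x i [^]\<^bsub>char_prod m n T TH\<^esub> k i)"
    proof (rule A.finprod_insert[OF insert.hyps])
      have c: "x j [^]\<^bsub>char_prod m n T TH\<^esub> k j \<in> carrier (char_prod m n T TH)" if "j \<in> insert i S" for j
        by (rule A.nat_pow_closed, rule insert.prems, rule that)
      show "(\<lambda>i. x i [^]\<^bsub>char_prod m n T TH\<^esub> k i) \<in> S \<rightarrow> carrier (char_prod m n T TH)"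
        using c by blast
      show "x i [^]\<^bsub>char_prod m n T TH\<^esub> k i \<in> carrier (char_prod m n T TH)" by (rule c) simp
    qed
    also have "(\<Otimes>\<^bsub>char_prod m n T TH\<^esub>i\<in>S. x i [^]\<^bsub>char_prod m n T TH\<^esub> k i) =
      (\<lambda>t\<in>T. \<Prod>i\<in>S. fst (x i) t ^ k i, \<lambda>t\<in>TH. \<Prod>i\<in>S. snd (x i) t ^ k i)"
      by (rule insert.IH, rule insert.prems) simp
    also have "x i [^]\<^bsub>char_prod m n T TH\<^esub> k i = (\<lambda>t\<in>T. fst (x i) t ^ k i, \<lambda>t\<in>TH. snd (x i) t ^ k i)"
      by (rule char_prod_pow[OF T], rule insert.prems) simp
    finally show ?case using insert.hyps by (auto simp: char_group_def DirProd_def fun_eq_iff)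
  qed
qed

definition generator_list :: "nat \<Rightarrow> nat \<Rightarrow> (nat \<Rightarrow> nat \<Rightarrow> nat \<Rightarrow> nat \<Rightarrow> nat \<Rightarrow> 'a) \<Rightarrow> 'a list" where
  "generator_list m n E = [E 1 0 0 0 0, E 0 1 0 0 0, E 0 0 1 0 0] @ (if m > 1 then [E 0 0 0 1 0] else [])
     @ (if n > 1 then [E 0 0 0 0 1] else [])"

text \<open>The positions of the last two generators in the list depend on which of \<open>m > 1\<close> and \<open>n > 1\<close> hold.\<close>

definition coord4 :: "nat \<Rightarrow> (nat \<Rightarrow> nat) \<Rightarrow> nat" where
  "coord4 m k = (if m > 1 then k 3 else 0)"

definition coord5 :: "nat \<Rightarrow> nat \<Rightarrow> (nat \<Rightarrow> nat) \<Rightarrow> nat" where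
  "coord5 m n k = (if n > 1 then k (if m > 1 then 4 else 3) else 0)"

lemma prod_generator_list:
  fixes v :: "'a \<Rightarrow> complex"
  shows "(\<Prod>i<length (generator_list m n E). v (generator_list m n E ! i) ^ k i) =
    v (E 1 0 0 0 0) ^ k 0 * v (E 0 1 0 0 0) ^ k 1 * v (E 0 0 1 0 0) ^ k 2 *
    v (E 0 0 0 1 0) ^ coord4 m k * v (E 0 0 0 0 1) ^ coord5 m n k"
proof -
  have s: "{..<3::nat} = {0,1,2}" "{..<4::nat} = {0,1,2,3}" "{..<5::nat} = {0,1,2,3,4}" by auto
  have len: "length (generator_list m n E) = (if m > 1 then if n > 1 then 5 else 4 else if n > 1 then 4 else 3)"
    by (simp add: generator_list_def)
  show ?thesis
    unfolding len by (cases "m > 1"; cases "n > 1") (simp_all add: generator_list_def coord4_def coord5_def s mult.assoc)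
qed

context standard_setup
begin

lemma T_closed: "mult_closed m n T" "mult_closed m n TH"
  unfolding T TH by (intro conj_set_closed g h T_std_closed TH_std_closed m n)+

lemma freely_generated_generator_list:
  "freely_generated (char_prod m n T TH) (ext_weight_monoid m n T B TH P) (generator_list m n (weight_pair m n g h T TH))"
proof -
  let ?E = "weight_pair m n g h T TH" and ?A = "char_prod m n T TH"
  let ?x = "generator_list m n ?E"
  let ?L = "{..<length ?x}"
  have E: "?E 1 0 0 0 0 \<in> carrier ?A" "?E 0 1 0 0 0 \<in> carrier ?A" "?E 0 0 1 0 0 \<in> carrier ?A"
    "m > 1 \<Longrightarrow> ?E 0 0 0 1 0 \<in> carrier ?A" "n > 1 \<Longrightarrow> ?E 0 0 0 0 1 \<in> carrier ?A"
    by (rule weight_pair_carrier; simp)+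
  have sub: "set ?x \<subseteq> carrier ?A" using E by (auto simp: generator_list_def)
  have prod: "(\<Otimes>\<^bsub>?A\<^esub>i\<in>?L. (?x ! i) [^]\<^bsub>?A\<^esub> (k i)) = ?E (k 0) (k 1) (k 2) (coord4 m k) (coord5 m n k)" for k
  proof -
    have "(\<Otimes>\<^bsub>?A\<^esub>i\<in>?L. (?x ! i) [^]\<^bsub>?A\<^esub> (k i)) =
      (\<lambda>t\<in>T. \<Prod>i\<in>?L. fst (?x ! i) t ^ k i, \<lambda>t\<in>TH. \<Prod>i\<in>?L. snd (?x ! i) t ^ k i)"
    proof (rule char_prod_finprod[OF T_closed])
      show "?x ! i \<in> carrier ?A" if "i \<in> ?L" for i
        using that sub nth_mem[of i ?x] by blast
    qed simp
    also have "\<dots> = ?E (k 0) (k 1) (k 2) (coord4 m k) (coord5 m n k)"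
      unfolding weight_pair_def[of _ _ _ _ _ _ "k 0"]
    proof (intro arg_cong2[where f = Pair] restrict_ext)
      fix t assume t: "t \<in> T"
      show "(\<Prod>i\<in>?L. fst (?x ! i) t ^ k i) = om_std (k 0) (k 1) (k 2) (coord4 m k) (coord5 m n k)
          (pull m n g t)"
        using t prod_generator_list[of "\<lambda>x. fst x t" m n ?E k]
        by (simp add: weight_pair_def om_std_def power_add power_mult_distrib)
    next
      fix t assume t: "t \<in> TH"
      show "(\<Prod>i\<in>?L. snd (?x ! i) t ^ k i) = ch_std (k 1 + k 2)
          (pull m n h t)"
        using t prod_generator_list[of "\<lambda>x. snd x t" m n ?E k]
        by (simp add: weight_pair_def ch_std_def power_add)
    qed
    finally show ?thesis .
  qed
  have co: "m = 1 \<longrightarrow> coord4 m k = 0" "n = 1 \<longrightarrow> coord5 m n k = 0" for k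
    by (simp_all add: coord4_def coord5_def)
  have len: "length ?x = 3 + (if m > 1 then 1 else 0) + (if n > 1 then 1 else 0)" by (simp add: generator_list_def)
  have "bij_betw (\<lambda>k. ?E (k 0) (k 1) (k 2) (coord4 m k) (coord5 m n k)) (?L \<rightarrow>\<^sub>E UNIV)
      (ext_weight_monoid m n T B TH P)"
    unfolding bij_betw_def
  proof (intro conjI inj_onI equalityI subsetI)
    fix k j :: "nat \<Rightarrow> nat" assume k: "k \<in> ?L \<rightarrow>\<^sub>E UNIV" and j: "j \<in> ?L \<rightarrow>\<^sub>E UNIV"
      and eq: "?E (k 0) (k 1) (k 2) (coord4 m k) (coord5 m n k) = ?E (j 0) (j 1) (j 2) (coord4 m j) (coord5 m n j)"
    have e: "k 0 = j 0" "k 1 = j 1" "k 2 = j 2" "coord4 m k = coord4 m j" "coord5 m n k = coord5 m n j"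
      using weight_pair_inj[OF eq co co] by simp_all
    show "k = j"
    proof (rule PiE_ext[OF k j])
      fix i assume "i \<in> ?L"
      then have "i = 0 \<or> i = 1 \<or> i = 2 \<or> (i = 3 \<and> (m > 1 \<or> n > 1)) \<or> (i = 4 \<and> m > 1 \<and> n > 1)"
        unfolding len by (auto split: if_splits)
      then show "k i = j i" using e unfolding coord4_def coord5_def by (elim disjE) (simp_all split: if_splits)
    qed
  next
    fix z assume "z \<in> (\<lambda>k. ?E (k 0) (k 1) (k 2) (coord4 m k) (coord5 m n k)) ` (?L \<rightarrow>\<^sub>E UNIV)"
    then obtain k where "z = ?E (k 0) (k 1) (k 2) (coord4 m k) (coord5 m n k)" by (elim imageE)
    then show "z \<in> ext_weight_monoid m n T B TH P" using weight_pair_ext_weight_monoid[OF co] by simp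
  next
    fix z assume "z \<in> ext_weight_monoid m n T B TH P"
    then obtain k1 k2 k3 k4 k5 where k: "m = 1 \<longrightarrow> k4 = 0" "n = 1 \<longrightarrow> k5 = 0" "z = ?E k1 k2 k3 k4 k5"
      using ext_weight_monoid_subset by blast
    define k where "k = (\<lambda>i\<in>?L. if i = 0 then k1 else if i = 1 then k2 else if i = 2 then k3
      else if i = 3 \<and> m > 1 then k4 else k5)"
    have mn: "\<not> m > 1 \<Longrightarrow> m = 1" "\<not> n > 1 \<Longrightarrow> n = 1" using m n by linarith+
    have "k 0 = k1" "k 1 = k2" "k 2 = k3" "coord4 m k = k4" "coord5 m n k = k5"
      using k(1,2) mn unfolding k_def coord4_def coord5_def len by auto
    moreover have "k \<in> ?L \<rightarrow>\<^sub>E UNIV" by (simp add: k_def)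
    ultimately show "z \<in> (\<lambda>k. ?E (k 0) (k 1) (k 2) (coord4 m k) (coord5 m n k)) ` (?L \<rightarrow>\<^sub>E UNIV)"
      using k(3) by (intro image_eqI[of _ _ k]) simp_all
  qed
  then show ?thesis unfolding freely_generated_def using sub by (simp add: prod)
qed

end

section \<open>Block matrices and the interchange of two hyperbolic planes\<close>

lemma diag2_carrier:
  assumes "A \<in> carrier_mat (2*(k-1)) (2*(k-1))" "S \<in> carrier_mat 2 2" "1 \<le> k"
  shows "diag2 A S \<in> carrier_mat (2*k) (2*k)"
proof -
  have "2*k = 2*(k-1) + 2" using assms(3) by linarith
  then show ?thesis using assms(1,2) unfolding diag2_def by (simp only:) (rule four_block_carrier_mat)
qed

lemma diag2_nth:
  assumes "A \<in> carrier_mat (2*(k-1)) (2*(k-1))" "S \<in> carrier_mat 2 2" "1 \<le> k" "i < 2*k" "j < 2*k"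
  shows "diag2 A S $$ (i,j) = (if i < 2*(k-1) then if j < 2*(k-1) then A $$ (i,j) else 0
     else if j < 2*(k-1) then 0 else S $$ (i - 2*(k-1), j - 2*(k-1)))"
proof -
  have "2*k = 2*(k-1) + 2" using assms(3) by linarith
  then show ?thesis using assms unfolding diag2_def by auto
qed

lemma diag2_mult:
  assumes "A \<in> carrier_mat (2*(k-1)) (2*(k-1))" "S \<in> carrier_mat 2 2"
    "A' \<in> carrier_mat (2*(k-1)) (2*(k-1))" "S' \<in> carrier_mat 2 2"
  shows "diag2 A S * diag2 A' S' = diag2 (A * A') (S * S')"
  unfolding diag2_def using assms
  by (subst mult_four_block_mat[of _ "2*(k-1)" "2*(k-1)" _ 2 _ 2 _ _ "2*(k-1)" _ 2]) auto

lemma diag2_one: "1 \<le> k \<Longrightarrow> diag2 (1\<^sub>m (2*(k-1))) (1\<^sub>m 2) = 1\<^sub>m (2*k)"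
proof -
  assume k: "1 \<le> k"
  show ?thesis
  proof (rule eq_matI)
    fix i j assume ij: "i < dim_row (1\<^sub>m (2*k))" "j < dim_col (1\<^sub>m (2*k))"
    then have l: "i < 2*k" "j < 2*k" by simp_all
    have e: "2*k = 2*(k-1) + 2" using k by linarith
    show "diag2 (1\<^sub>m (2*(k-1))) (1\<^sub>m 2) $$ (i,j) = 1\<^sub>m (2*k) $$ (i,j)"
      unfolding diag2_nth[OF one_carrier_mat one_carrier_mat k l] using l e by auto
  qed (use diag2_carrier[OF one_carrier_mat one_carrier_mat k] in auto)
qed

lemma Om_split:
  assumes "1 \<le> k"
  shows "Om k u v = Om (k-1) u v + (u (2*(k-1)) * v (2*(k-1)+1) - u (2*(k-1)+1) * v (2*(k-1)))"
proof -
  obtain k' where "k = Suc k'" using assms by (cases k) auto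
  then show ?thesis by (simp add: Om_def)
qed

lemma diag2_Sp:
  assumes A: "A \<in> carrier (Sp (k-1))" and S: "S \<in> carrier (Sp 1)" and k: "1 \<le> k"
  shows "diag2 A S \<in> carrier (Sp k)"
proof -
  let ?N = "2*(k-1)"
  have cA: "A \<in> carrier_mat ?N ?N" and cS: "S \<in> carrier_mat 2 2"
    using Sp_carrier_mat[OF A] Sp_carrier_mat[OF S] by simp_all
  have N: "2*k = ?N + 2" using k by linarith
  note c = diag2_carrier[OF cA cS k]
  have col: "colv (diag2 A S) j i = (if j < ?N then colv A j i else if i < ?N then 0 else colv S (j - ?N) (i - ?N))"
    if "i < 2*k" "j < 2*k" for i j
    using that c cA cS N by (auto simp: colv_def diag2_nth[OF cA cS k])
  have S1: "Om 1 u v = u 0 * v 1 - u 1 * v 0" for u v by (simp add: Om_def One_nat_def)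
  have bl: "Om (k-1) (colv (diag2 A S) i) (colv (diag2 A S) j) =
      (if i < ?N \<and> j < ?N then Om (k-1) (colv A i) (colv A j) else 0)" if "i < 2*k" "j < 2*k" for i j
  proof (cases "i < ?N \<and> j < ?N")
    case True
    then show ?thesis using that N by (auto intro!: Om_cong simp: col)
  next
    case False
    have "Om (k-1) (colv (diag2 A S) i) (colv (diag2 A S) j) = 0"
    proof (cases "i < ?N")
      case True
      then have "Om (k-1) (colv (diag2 A S) i) (colv (diag2 A S) j) = Om (k-1) (colv (diag2 A S) i) (\<lambda>i. 0)"
        using that N False by (intro Om_cong) (auto simp: col)
      then show ?thesis by (simp add: Om_def)
    next
      case False
      then have "Om (k-1) (colv (diag2 A S) i) (colv (diag2 A S) j) = Om (k-1) (\<lambda>i. 0) (colv (diag2 A S) j)"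
        using that N by (intro Om_cong) (auto simp: col)
      then show ?thesis by simp
    qed
    then show ?thesis unfolding if_not_P[OF False] .
  qed
  have "Om k (colv (diag2 A S) i) (colv (diag2 A S) j) = Om k (unitv i) (unitv j)"
    if ij: "i < 2*k" "j < 2*k" for i j
  proof -
    have n: "?N < 2*k" "?N + 1 < 2*k" using N by linarith+
    have A0: "colv A j ?N = 0" "colv A j (?N+1) = 0" for j using cA by (simp_all add: colv_def)
    have "Om k (colv (diag2 A S) i) (colv (diag2 A S) j) =
      (if i < ?N \<and> j < ?N then Om (k-1) (colv A i) (colv A j)
       else if \<not> i < ?N \<and> \<not> j < ?N then Om 1 (colv S (i - ?N)) (colv S (j - ?N)) else 0)"
      unfolding Om_split[OF k] bl[OF ij] col[OF n(1) ij(1)] col[OF n(2) ij(1)] col[OF n(1) ij(2)] col[OF n(2) ij(2)] S1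
      using A0 by auto
    also have "\<dots> = (if i < ?N \<and> j < ?N then Om (k-1) (unitv i) (unitv j)
       else if \<not> i < ?N \<and> \<not> j < ?N then Om 1 (unitv (i - ?N)) (unitv (j - ?N)) else 0)"
    proof -
      have "Om 1 (colv S (i - ?N)) (colv S (j - ?N)) = Om 1 (unitv (i - ?N)) (unitv (j - ?N))"
        if "\<not> i < ?N" "\<not> j < ?N" using Sp_form[OF S, of "i - ?N" "j - ?N"] ij N that by simp
      then show ?thesis using Sp_form[OF A, of i j] by simp
    qed
    also have "\<dots> = Om k (unitv i) (unitv j)"
    proof -
      have "Om (k-1) (unitv i) (unitv j) = (if i < ?N \<and> j < ?N then Om (k-1) (unitv i) (unitv j) else 0)"
      proof (cases "i < ?N")
        case True
        show ?thesis
        proof (cases "j < ?N")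
          case False
          then show ?thesis by (simp add: Om_unitv_right)
        qed (use True in simp)
      qed (simp add: Om_unitv_left)
      then show ?thesis unfolding Om_split[OF k] S1 by (auto simp: unitv_apply)
    qed
    finally show ?thesis .
  qed
  then show ?thesis using c by (simp add: Sp_iff)
qed

definition Smat :: "complex \<Rightarrow> complex \<Rightarrow> cmat" where
  "Smat a c = mat 2 2 (\<lambda>(i,j). if j = 0 then if i = 0 then a else c else if i = 0 then 0 else 1/a)"

lemma Smat_nth: "Smat a c $$ (0,0) = a" "Smat a c $$ (1,0) = c" "Smat a c $$ (0,1) = 0" "Smat a c $$ (1,1) = 1 / a"
  by (simp_all add: Smat_def)

lemma Smat_carrier: "Smat a c \<in> carrier_mat 2 2"
  by (simp add: Smat_def)

lemma less_2_cases_nat: "(i::nat) < 2*1 \<Longrightarrow> i = 0 \<or> i = 1"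
  by linarith

lemma Sp1_iff: "S \<in> carrier (Sp 1) \<longleftrightarrow> S \<in> carrier_mat 2 2 \<and> S $$ (0,0) * S $$ (1,1) - S $$ (1,0) * S $$ (0,1) = 1"
proof -
  have S1: "Om 1 u v = u 0 * v 1 - u 1 * v 0" for u v by (simp add: Om_def One_nat_def)
  have "(\<forall>i<2*1. \<forall>j<2*1. Om 1 (colv S i) (colv S j) = Om 1 (unitv i) (unitv j)) \<longleftrightarrow>
    S $$ (0,0) * S $$ (1,1) - S $$ (1,0) * S $$ (0,1) = 1" if "S \<in> carrier_mat 2 2"
  proof
    assume "\<forall>i<2*1. \<forall>j<2*1. Om 1 (colv S i) (colv S j) = Om 1 (unitv i) (unitv j)"
    then have "Om 1 (colv S 0) (colv S 1) = Om 1 (unitv 0) (unitv 1)" by simp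
    then show "S $$ (0,0) * S $$ (1,1) - S $$ (1,0) * S $$ (0,1) = 1"
      using that by (simp add: S1 colv_def unitv_apply)
  next
    assume e: "S $$ (0,0) * S $$ (1,1) - S $$ (1,0) * S $$ (0,1) = 1"
    then have e': "S $$ (0,1) * S $$ (1,0) - S $$ (1,1) * S $$ (0,0) = -1" by (simp add: algebra_simps)
    show "\<forall>i<2*1. \<forall>j<2*1. Om 1 (colv S i) (colv S j) = Om 1 (unitv i) (unitv j)"
    proof (intro allI impI)
      fix i j :: nat assume "i < 2*1" "j < 2*1"
      then have "i = 0 \<or> i = 1" "j = 0 \<or> j = 1" by (simp_all only: less_2_cases_nat)
      then show "Om 1 (colv S i) (colv S j) = Om 1 (unitv i) (unitv j)"
        using e e' that by (elim disjE) (simp_all add: S1 colv_def unitv_apply)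
    qed
  qed
  then show ?thesis by (auto simp: Sp_iff)
qed

lemma borel_opp1_iff: "S \<in> Sp_borel_opp 1 \<longleftrightarrow> S \<in> carrier (Sp 1) \<and> S $$ (0,1) = 0"
proof
  assume "S \<in> Sp_borel_opp 1"
  then have S: "S \<in> carrier (Sp 1)" "\<forall>i<2*1. \<forall>j<1. S $$ (i, 2*j+1) \<noteq> 0 \<longrightarrow> odd i \<and> i \<le> 2*j+1"
    by (simp_all add: Sp_borel_opp_def)
  have "S $$ (0, 2*0+1) = 0"
  proof (rule ccontr)
    assume "S $$ (0, 2*0+1) \<noteq> 0"
    moreover have "(0::nat) < 2*1" "(0::nat) < 1" by simp_all
    ultimately have "odd (0::nat)" using S(2) by blast
    then show False by simp
  qed
  then show "S \<in> carrier (Sp 1) \<and> S $$ (0,1) = 0" using S(1) by simp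
next
  assume S: "S \<in> carrier (Sp 1) \<and> S $$ (0,1) = 0"
  have "odd i \<and> i \<le> 2*j+1" if "i < 2*1" "j < 1" "S $$ (i, 2*j+1) \<noteq> 0" for i j :: nat
  proof -
    have "j = 0" using that by simp
    moreover have "i = 0 \<or> i = 1" using that(1) by (rule less_2_cases_nat)
    ultimately show ?thesis using that S by auto
  qed
  then show "S \<in> Sp_borel_opp 1" using S by (simp add: Sp_borel_opp_def)
qed

lemma Smat_borel_opp: "a \<noteq> 0 \<Longrightarrow> Smat a c \<in> Sp_borel_opp 1"
  by (simp add: borel_opp1_iff Sp1_iff Smat_nth Smat_carrier)

lemma borel_opp_Smat:
  assumes "S \<in> Sp_borel_opp 1"
  obtains a c where "a \<noteq> 0" "S = Smat a c"
proof -
  have S: "S \<in> carrier_mat 2 2" "S $$ (0,0) * S $$ (1,1) = 1" "S $$ (0,1) = 0"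
    using assms by (auto simp: borel_opp1_iff Sp1_iff)
  have nz: "S $$ (0,0) \<noteq> 0" using S(2) by auto
  have "S = Smat (S $$ (0,0)) (S $$ (1,0))"
  proof (rule eq_matI)
    fix i j assume "i < dim_row (Smat (S $$ (0,0)) (S $$ (1,0)))" "j < dim_col (Smat (S $$ (0,0)) (S $$ (1,0)))"
    then have "i = 0 \<or> i = 1" "j = 0 \<or> j = 1" by (auto simp: Smat_def)
    then show "S $$ (i,j) = Smat (S $$ (0,0)) (S $$ (1,0)) $$ (i,j)"
      using S(2,3) nz by (elim disjE) (simp_all add: Smat_nth field_simps)
  qed (use S(1) in \<open>auto simp: Smat_def\<close>)
  then show ?thesis using that nz by blast
qed

text \<open>The columns orthogonal to the last hyperbolic plane have no entries in its rows.\<close>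

lemma block_decomp:
  assumes X: "X \<in> carrier (Sp k)" and k: "1 \<le> k" and a: "a \<noteq> 0"
    and c0: "colv X (2*(k-1)) = (\<lambda>i. a * unitv (2*(k-1)) i + c * unitv (2*(k-1)+1) i)"
    and c1: "colv X (2*(k-1)+1) = (\<lambda>i. (1/a) * unitv (2*(k-1)+1) i)"
  obtains A where "A \<in> carrier (Sp (k-1))" "X = diag2 A (Smat a c)"
proof -
  let ?N = "2*(k-1)"
  have N: "2*k = ?N + 2" using k by linarith
  then have n: "?N < 2*k" "?N + 1 < 2*k" by linarith+
  note cm = Sp_carrier_mat[OF X]
  have eN: "Om k (unitv ?N) v = v (?N + 1)" "Om k (unitv (?N+1)) v = - v ?N" for v
    using n by (simp_all add: Om_unitv_left One_nat_def)
  have row: "colv X j ?N = 0" "colv X j (?N+1) = 0" if j: "j < ?N" for j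
  proof -
    have j': "j < 2*k" using j N by linarith
    have "(1/a) * - colv X j ?N = - unitv j ?N"
      using Sp_form[OF X n(2) j'] unfolding c1 Om_scale_left eN .
    then show z: "colv X j ?N = 0" using a j by (simp add: unitv_apply)
    have "a * colv X j (?N+1) + c * - colv X j ?N = unitv j (?N+1)"
      using Sp_form[OF X n(1) j'] unfolding c0 Om_add_left Om_scale_left eN .
    then show "colv X j (?N+1) = 0" using a j z by (simp add: unitv_apply)
  qed
  define A where "A = mat ?N ?N (\<lambda>(i,j). X $$ (i,j))"
  have cA: "A \<in> carrier_mat ?N ?N" by (simp add: A_def)
  have colA: "colv A j i = colv X j i" if "j < ?N" "i < ?N" for i j
    using that cm N by (simp add: colv_def A_def)
  have "Om (k-1) (colv A i) (colv A j) = Om (k-1) (unitv i) (unitv j)" if "i < ?N" "j < ?N" for i j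
  proof -
    have "Om (k-1) (colv A i) (colv A j) = Om (k-1) (colv X i) (colv X j)"
      using that by (intro Om_cong) (simp_all add: colA)
    also have "\<dots> = Om k (colv X i) (colv X j)"
      unfolding Om_split[OF k] using row that by simp
    also have "\<dots> = Om k (unitv i) (unitv j)" using that N by (intro Sp_form[OF X]) linarith+
    also have "\<dots> = Om (k-1) (unitv i) (unitv j)"
      unfolding Om_split[OF k] using that by (simp add: unitv_apply)
    finally show ?thesis .
  qed
  then have "A \<in> carrier (Sp (k-1))" using cA by (simp add: Sp_iff)
  moreover have "X = diag2 A (Smat a c)"
  proof (rule mat_eqI_colv[OF cm diag2_carrier[OF cA Smat_carrier k]])
    fix j assume j: "j < 2*k"
    show "colv X j = colv (diag2 A (Smat a c)) j"
    proof
      fix i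
      show "colv X j i = colv (diag2 A (Smat a c)) j i"
      proof (cases "i < 2*k")
        case False
        then show ?thesis using cm diag2_carrier[OF cA Smat_carrier k, of a c] by (simp add: colv_def)
      next
        case i: True
        have d: "colv (diag2 A (Smat a c)) j i = diag2 A (Smat a c) $$ (i,j)"
          using i by (intro colv_nth[OF diag2_carrier[OF cA Smat_carrier k]])
        have jj: "j < ?N \<or> j = ?N \<or> j = ?N + 1" and ii: "i < ?N \<or> i = ?N \<or> i = ?N + 1" using i j N by linarith+
        have S: "Smat a c $$ (0, Suc 0) = 0" "Smat a c $$ (Suc 0, 0) = c" "Smat a c $$ (Suc 0, Suc 0) = 1 / a"
          using Smat_nth by (simp_all add: One_nat_def)
        show ?thesis unfolding d diag2_nth[OF cA Smat_carrier k i j]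
          using jj
        proof (elim disjE)
          assume "j < ?N"
          then show "colv X j i = (if i < ?N then if j < ?N then A $$ (i,j) else 0
            else if j < ?N then 0 else Smat a c $$ (i - ?N, j - ?N))"
            using ii row[of j] colA[of j i] colv_nth[OF cA, of i j] by auto
        next
          assume "j = ?N"
          then show "colv X j i = (if i < ?N then if j < ?N then A $$ (i,j) else 0
            else if j < ?N then 0 else Smat a c $$ (i - ?N, j - ?N))"
            using ii by (elim disjE) (simp_all add: c0 unitv_apply Smat_nth S)
        next
          assume "j = ?N + 1"
          then show "colv X j i = (if i < ?N then if j < ?N then A $$ (i,j) else 0
            else if j < ?N then 0 else Smat a c $$ (i - ?N, j - ?N))"
            using ii c1 by (elim disjE) (simp_all add: unitv_apply Smat_nth S)
        qed
      qed
    qed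
  qed
  ultimately show ?thesis using that by blast
qed

definition pswap :: "nat \<Rightarrow> nat \<Rightarrow> nat" where
  "pswap k l = (if l = 0 then k - 1 else if l = k - 1 then 0 else l)"

definition iswap :: "nat \<Rightarrow> nat \<Rightarrow> nat" where
  "iswap k i = 2 * pswap k (i div 2) + i mod 2"

text \<open>The permutation matrix that interchanges the first and the last hyperbolic plane.  Conjugation by it
moves the factor \<open>SL(2)\<close> of \<open>H\<close> to the first plane, where the fundamental weights
\<open>\<omega>\<^sub>1\<close> and \<open>\<omega>\<^sub>2\<close> of \<open>G\<close> are visible.\<close>

definition Wmat :: "nat \<Rightarrow> cmat" where
  "Wmat k = mat (2*k) (2*k) (\<lambda>(i,j). unitv (iswap k j) i)"

lemma pswap_pswap: "pswap k (pswap k l) = l"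
  by (auto simp: pswap_def)

lemma pswap_less: "1 \<le> k \<Longrightarrow> l < k \<Longrightarrow> pswap k l < k"
  by (auto simp: pswap_def)

lemma iswap_iswap: "iswap k (iswap k i) = i"
proof -
  have "iswap k i div 2 = pswap k (i div 2)" "iswap k i mod 2 = i mod 2" by (simp_all add: iswap_def)
  then show ?thesis by (subst iswap_def) (simp add: pswap_pswap)
qed

lemma iswap_less: "1 \<le> k \<Longrightarrow> i < 2*k \<Longrightarrow> iswap k i < 2*k"
proof -
  assume "1 \<le> k" "i < 2*k"
  then have "pswap k (i div 2) < k" by (intro pswap_less) linarith+
  moreover have "i mod 2 < 2" by simp
  ultimately show ?thesis unfolding iswap_def by linarith
qed

lemma iswap_eq_iff: "iswap k i = iswap k j \<longleftrightarrow> i = j"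
  by (metis iswap_iswap)

lemma Wmat_carrier [simp]: "Wmat k \<in> carrier_mat (2*k) (2*k)"
  by (simp add: Wmat_def)

lemma colv_Wmat: "1 \<le> k \<Longrightarrow> j < 2*k \<Longrightarrow> colv (Wmat k) j = unitv (iswap k j)"
  using iswap_less[of k j] by (auto simp: colv_def Wmat_def unitv_apply fun_eq_iff)

lemma even_iswap: "even (iswap k i) \<longleftrightarrow> even i"
  by (simp add: iswap_def even_mod_2_iff)

lemma Suc_iswap: "even i \<Longrightarrow> Suc (iswap k i) = iswap k (Suc i)"
  by (auto simp: iswap_def elim!: evenE)

lemma Wmat_Sp:
  assumes k: "1 \<le> k"
  shows "Wmat k \<in> carrier (Sp k)"
proof -
  have "Om k (unitv (iswap k i)) (unitv (iswap k j)) = Om k (unitv i) (unitv j)" if ij: "i < 2*k" "j < 2*k" for i j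
  proof (cases "even i")
    case True
    then show ?thesis using iswap_less[OF k ij(1)] ij
      by (simp add: Om_unitv_left even_iswap unitv_apply Suc_iswap iswap_eq_iff)
  next
    case False
    then obtain l where l: "i = Suc (2*l)" by (elim oddE) simp
    have "iswap k i = Suc (iswap k (2*l))" unfolding l by (simp add: Suc_iswap)
    then show ?thesis using iswap_less[OF k ij(1)] ij False l
      by (simp add: Om_unitv_left even_iswap unitv_apply iswap_eq_iff)
  qed
  then show ?thesis by (simp add: Sp_iff colv_Wmat[OF k])
qed

lemma mult_Wmat_col:
  assumes k: "1 \<le> k" and X: "X \<in> carrier_mat (2*k) (2*k)" and j: "j < 2*k"
  shows "colv (X * Wmat k) j = colv X (iswap k j)"
  using colv_mult[OF X Wmat_carrier j] colv_Wmat[OF k j] mat_act_unitv[OF X iswap_less[OF k j]] by simp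

lemma Wmat_mult_nth:
  assumes k: "1 \<le> k" and X: "X \<in> carrier_mat (2*k) (2*k)" and i: "i < 2*k" and j: "j < 2*k"
  shows "(Wmat k * X) $$ (i,j) = X $$ (iswap k i,j)"
proof -
  have "(Wmat k * X) $$ (i,j) = (\<Sum>l<2*k. Wmat k $$ (i,l) * X $$ (l,j))"
    by (rule mult_nth_sum[OF Wmat_carrier X i j])
  also have "\<dots> = (\<Sum>l<2*k. unitv (iswap k i) l * X $$ (l,j))"
  proof (intro sum.cong refl)
    fix l assume "l \<in> {..<2*k}"
    then have "Wmat k $$ (i,l) = unitv (iswap k l) i" using i by (simp add: Wmat_def)
    also have "\<dots> = unitv (iswap k i) l" by (auto simp: unitv_apply iswap_iswap)
    finally show "Wmat k $$ (i,l) * X $$ (l,j) = unitv (iswap k i) l * X $$ (l,j)" by simp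
  qed
  also have "\<dots> = X $$ (iswap k i,j)" by (rule sum_unitv_mult[OF iswap_less[OF k i]])
  finally show ?thesis .
qed

lemma Wmat_Wmat: "1 \<le> k \<Longrightarrow> Wmat k * Wmat k = 1\<^sub>m (2*k)"
proof -
  assume k: "1 \<le> k"
  show ?thesis
  proof (rule mat_eqI_colv[of _ "2*k"])
    fix j assume j: "j < 2*k"
    show "colv (Wmat k * Wmat k) j = colv (1\<^sub>m (2*k)) j"
      using mult_Wmat_col[OF k Wmat_carrier j] colv_Wmat[OF k iswap_less[OF k j]] j
      by (simp add: iswap_iswap colv_one)
  qed (auto intro: mult_carrier_mat[OF Wmat_carrier Wmat_carrier])
qed

lemma Wmat_conj_nth:
  assumes k: "1 \<le> k" and X: "X \<in> carrier_mat (2*k) (2*k)" and i: "i < 2*k" and j: "j < 2*k"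
  shows "(Wmat k * X * Wmat k) $$ (i,j) = X $$ (iswap k i, iswap k j)"
proof -
  have c: "Wmat k * X \<in> carrier_mat (2*k) (2*k)" by (rule mult_carrier_mat[OF Wmat_carrier X])
  have "colv (Wmat k * X * Wmat k) j i = colv (Wmat k * X) (iswap k j) i"
    using mult_Wmat_col[OF k c j] by simp
  then show ?thesis
    using i c Wmat_mult_nth[OF k X i iswap_less[OF k j]]
      colv_nth[OF c i, of "iswap k j"] colv_nth[OF mult_carrier_mat[OF c Wmat_carrier] i, of j] by simp
qed

lemma iswap_corner:
  assumes "1 \<le> k"
  shows "iswap k 0 = 2*(k-1)" "iswap k 1 = 2*(k-1)+1"
  using assms by (simp_all add: iswap_def pswap_def)

lemma unitv_iswap: "unitv j (iswap k i) = unitv (iswap k j) i"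
  by (auto simp: unitv_apply iswap_iswap)

section \<open>The group H, its torus and its Borel subgroups\<close>

lemma embH_mult:
  assumes "A \<in> carrier (Sp (m-1))" "A' \<in> carrier (Sp (m-1))" "S \<in> carrier (Sp 1)" "S' \<in> carrier (Sp 1)"
    "D \<in> carrier (Sp (n-1))" "D' \<in> carrier (Sp (n-1))"
  shows "embH (A, S, D) \<otimes>\<^bsub>grpG m n\<^esub> embH (A', S', D') = embH (A * A', S * S', D * D')"
proof -
  have S: "S \<in> carrier_mat 2 2" "S' \<in> carrier_mat 2 2" using Sp_carrier_mat assms(3,4) by fastforce+
  note c = Sp_carrier_mat[OF assms(1)] Sp_carrier_mat[OF assms(2)] Sp_carrier_mat[OF assms(5)] Sp_carrier_mat[OF assms(6)]
  show ?thesis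
    by (simp add: embH_def grpG_mult diag2_mult[OF c(1) S(1) c(2) S(2)] diag2_mult[OF c(3) S(1) c(4) S(2)])
qed

lemma embH_G:
  assumes "A \<in> carrier (Sp (m-1))" "S \<in> carrier (Sp 1)" "D \<in> carrier (Sp (n-1))" "1 \<le> m" "1 \<le> n"
  shows "embH (A, S, D) \<in> carrier (grpG m n)"
  using assms by (simp add: embH_def grpG_carrier diag2_Sp)

lemma embH_one: "1 \<le> m \<Longrightarrow> 1 \<le> n \<Longrightarrow> embH (1\<^sub>m (2*(m-1)), 1\<^sub>m 2, 1\<^sub>m (2*(n-1))) = \<one>\<^bsub>grpG m n\<^esub>"
  by (simp add: embH_def diag2_one grpG_one)

lemma embH_inj:
  assumes "embH (A, S, D) = embH (A', S', D')"
    "A \<in> carrier_mat (2*(m-1)) (2*(m-1))" "A' \<in> carrier_mat (2*(m-1)) (2*(m-1))"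
    "S \<in> carrier_mat 2 2" "S' \<in> carrier_mat 2 2" "1 \<le> m"
  shows "S = S'"
proof (rule eq_matI)
  fix i j assume ij: "i < dim_row S'" "j < dim_col S'"
  then have l: "2*(m-1) + i < 2*m" "2*(m-1) + j < 2*m" using assms(5,6) by auto
  have "diag2 A S = diag2 A' S'" using assms(1) by (simp add: embH_def)
  then have "diag2 A S $$ (2*(m-1) + i, 2*(m-1) + j) = diag2 A' S' $$ (2*(m-1) + i, 2*(m-1) + j)" by simp
  then show "S $$ (i,j) = S' $$ (i,j)"
    unfolding diag2_nth[OF assms(2,4,6) l] diag2_nth[OF assms(3,5,6) l] by simp
qed (use assms in auto)

lemma setH_G: "1 \<le> m \<Longrightarrow> 1 \<le> n \<Longrightarrow> setH m n \<subseteq> carrier (grpG m n)"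
  by (auto simp: setH_def embH_G)

lemma setH_mult:
  assumes "x \<in> setH m n" "y \<in> setH m n"
  shows "x \<otimes>\<^bsub>grpG m n\<^esub> y \<in> setH m n"
proof -
  obtain A S D where x: "x = embH (A, S, D)" "A \<in> carrier (Sp (m-1))" "S \<in> carrier (Sp 1)" "D \<in> carrier (Sp (n-1))"
    using assms(1) by (auto simp: setH_def)
  obtain A' S' D' where y: "y = embH (A', S', D')" "A' \<in> carrier (Sp (m-1))" "S' \<in> carrier (Sp 1)" "D' \<in> carrier (Sp (n-1))"
    using assms(2) by (auto simp: setH_def)
  show ?thesis unfolding x(1) y(1) embH_mult[OF x(2) y(2) x(3) y(3) x(4) y(4)] setH_def
    using Sp_mult_closed x y by blast
qed

lemma setH_inv:
  assumes "x \<in> setH m n" "1 \<le> m" "1 \<le> n"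
  shows "inv\<^bsub>grpG m n\<^esub> x \<in> setH m n"
proof -
  interpret G: group "grpG m n" by (rule grpG_group)
  obtain A S D where x: "x = embH (A, S, D)" "A \<in> carrier (Sp (m-1))" "S \<in> carrier (Sp 1)" "D \<in> carrier (Sp (n-1))"
    using assms(1) by (auto simp: setH_def)
  obtain A' where A': "A' \<in> carrier (Sp (m-1))" "A' * A = 1\<^sub>m (2*(m-1))" using Sp_left_inverse[OF x(2)] by blast
  obtain S' where S': "S' \<in> carrier (Sp 1)" "S' * S = 1\<^sub>m (2*1)" using Sp_left_inverse[OF x(3)] by blast
  obtain D' where D': "D' \<in> carrier (Sp (n-1))" "D' * D = 1\<^sub>m (2*(n-1))" using Sp_left_inverse[OF x(4)] by blast
  have "embH (A', S', D') \<otimes>\<^bsub>grpG m n\<^esub> x = \<one>\<^bsub>grpG m n\<^esub>"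
    unfolding x(1) embH_mult[OF A'(1) x(2) S'(1) x(3) D'(1) x(4)] A'(2) S'(2) D'(2)
    using embH_one[OF assms(2,3)] by simp
  then have "inv\<^bsub>grpG m n\<^esub> x = embH (A', S', D')"
    using x A' S' D' assms by (intro G.inv_equality) (auto intro: embH_G)
  then show ?thesis unfolding setH_def using A' S' D' by blast
qed

lemma colv_out: "A \<in> carrier_mat (2*k) (2*k) \<Longrightarrow> \<not> i < 2*k \<Longrightarrow> colv A j i = 0"
  by (simp add: colv_def)

lemma Wmat_Dmat:
  assumes k: "1 \<le> k"
  shows "Wmat k * Dmat k a * Wmat k = Dmat k (\<lambda>l. a (pswap k l))"
proof (rule eq_matI)
  fix i j assume "i < dim_row (Dmat k (\<lambda>l. a (pswap k l)))" "j < dim_col (Dmat k (\<lambda>l. a (pswap k l)))"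
  then have ij: "i < 2*k" "j < 2*k" by (simp_all add: Dmat_def)
  have "diag_entry a (iswap k i) = diag_entry (\<lambda>l. a (pswap k l)) i" for i
    by (auto simp: diag_entry_def even_iswap) (simp_all add: iswap_def)
  then show "(Wmat k * Dmat k a * Wmat k) $$ (i,j) = Dmat k (\<lambda>l. a (pswap k l)) $$ (i,j)"
    unfolding Wmat_conj_nth[OF k Dmat_carrier ij]
    using ij iswap_less[OF k ij(1)] iswap_less[OF k ij(2)] by (simp add: Dmat_nth iswap_eq_iff)
qed (simp_all add: Dmat_def Wmat_def)

lemma diag2_Dmat:
  assumes k: "1 \<le> k"
  shows "diag2 (Dmat (k-1) a) (Dmat 1 b) = Dmat k (\<lambda>l. if l < k-1 then a l else b 0)"
proof (rule eq_matI)
  have c1: "Dmat 1 b \<in> carrier_mat 2 2" using Dmat_carrier[of 1 b] by simp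
  note c = diag2_carrier[OF Dmat_carrier[of "k-1" a] c1 k]
  fix i j assume "i < dim_row (Dmat k (\<lambda>l. if l < k-1 then a l else b 0))"
    "j < dim_col (Dmat k (\<lambda>l. if l < k-1 then a l else b 0))"
  then have ij: "i < 2*k" "j < 2*k" by (simp_all add: Dmat_def)
  let ?N = "2*(k-1)"
  have N: "2*k = ?N + 2" using k by linarith
  show "diag2 (Dmat (k-1) a) (Dmat 1 b) $$ (i,j) = Dmat k (\<lambda>l. if l < k-1 then a l else b 0) $$ (i,j)"
    unfolding diag2_nth[OF Dmat_carrier c1 k ij]
  proof (cases "i < ?N")
    case True
    have "i div 2 < k - 1" using True by linarith
    then show "(if i < ?N then if j < ?N then Dmat (k-1) a $$ (i,j) else 0
      else if j < ?N then 0 else Dmat 1 b $$ (i - ?N, j - ?N)) = Dmat k (\<lambda>l. if l < k-1 then a l else b 0) $$ (i,j)"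
      using True ij by (auto simp: Dmat_nth diag_entry_def)
  next
    case False
    then have i: "i = ?N \<or> i = ?N + 1" using ij N by linarith
    have d: "diag_entry b (i - ?N) = diag_entry (\<lambda>l. if l < k-1 then a l else b 0) i"
      using i by (elim disjE) (simp_all add: diag_entry_def)
    show "(if i < ?N then if j < ?N then Dmat (k-1) a $$ (i,j) else 0
      else if j < ?N then 0 else Dmat 1 b $$ (i - ?N, j - ?N)) = Dmat k (\<lambda>l. if l < k-1 then a l else b 0) $$ (i,j)"
    proof (cases "j < ?N")
      case True
      then show ?thesis using False ij by (simp add: Dmat_nth)
    next
      case F: False
      have lt: "i - ?N < 2*1" "j - ?N < 2*1" using ij N by linarith+
      have "i - ?N = j - ?N \<longleftrightarrow> i = j" using F False by linarith
      then show ?thesis using False F ij d by (cases "i = j") (simp_all add: Dmat_nth[OF lt] Dmat_nth)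
    qed
  qed
qed (use diag2_carrier[OF Dmat_carrier[of "k-1" a] _ k, of "Dmat 1 b"] Dmat_carrier[of 1 b] in \<open>auto simp: Dmat_def[of k]\<close>)

definition w0 :: "nat \<Rightarrow> nat \<Rightarrow> cmat \<times> cmat" where
  "w0 m n = (Wmat m, Wmat n)"

lemma w0_G: "1 \<le> m \<Longrightarrow> 1 \<le> n \<Longrightarrow> w0 m n \<in> carrier (grpG m n)"
  by (simp add: w0_def grpG_carrier Wmat_Sp)

lemma w0_inv: "1 \<le> m \<Longrightarrow> 1 \<le> n \<Longrightarrow> inv\<^bsub>grpG m n\<^esub> w0 m n = w0 m n"
proof -
  assume mn: "1 \<le> m" "1 \<le> n"
  interpret G: group "grpG m n" by (rule grpG_group)
  show ?thesis
    by (rule G.inv_equality) (use mn in \<open>simp_all add: w0_G\<close>,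
      use mn in \<open>simp add: w0_def grpG_mult grpG_one Wmat_Wmat\<close>)
qed

lemma w0_conj: "1 \<le> m \<Longrightarrow> 1 \<le> n \<Longrightarrow> w0 m n \<otimes>\<^bsub>grpG m n\<^esub> x \<otimes>\<^bsub>grpG m n\<^esub> inv\<^bsub>grpG m n\<^esub> w0 m n =
    (Wmat m * fst x * Wmat m, Wmat n * snd x * Wmat n)"
  by (simp add: w0_inv) (simp add: w0_def grpG_mult)

lemma w0_w0:
  assumes "1 \<le> m" "1 \<le> n" "x \<in> carrier (grpG m n)"
  shows "w0 m n \<otimes>\<^bsub>grpG m n\<^esub> (w0 m n \<otimes>\<^bsub>grpG m n\<^esub> x \<otimes>\<^bsub>grpG m n\<^esub> inv\<^bsub>grpG m n\<^esub> w0 m n) \<otimes>\<^bsub>grpG m n\<^esub> inv\<^bsub>grpG m n\<^esub> w0 m n = x"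
proof -
  interpret G: group "grpG m n" by (rule grpG_group)
  have w: "w0 m n \<in> carrier (grpG m n)" "inv\<^bsub>grpG m n\<^esub> w0 m n = w0 m n" using assms by (simp_all add: w0_G w0_inv)
  show ?thesis using G.unconj[OF w(1) assms(3)] unfolding w(2) .
qed

lemma conj_w0_eqI:
  assumes mn: "1 \<le> m" "1 \<le> n" and K: "K \<subseteq> carrier (grpG m n)" and K': "K' \<subseteq> carrier (grpG m n)"
    and 1: "\<And>x. x \<in> K \<Longrightarrow> (Wmat m * fst x * Wmat m, Wmat n * snd x * Wmat n) \<in> K'"
    and 2: "\<And>x. x \<in> K' \<Longrightarrow> (Wmat m * fst x * Wmat m, Wmat n * snd x * Wmat n) \<in> K"
  shows "conj_set (grpG m n) (w0 m n) K = K'"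
proof (intro equalityI subsetI)
  fix x assume "x \<in> conj_set (grpG m n) (w0 m n) K"
  then show "x \<in> K'" using 1 unfolding conj_set_def w0_conj[OF mn] by blast
next
  fix x assume x: "x \<in> K'"
  have "x = w0 m n \<otimes>\<^bsub>grpG m n\<^esub> (Wmat m * fst x * Wmat m, Wmat n * snd x * Wmat n) \<otimes>\<^bsub>grpG m n\<^esub> inv\<^bsub>grpG m n\<^esub> w0 m n"
    using w0_w0[OF mn, of x] x K' unfolding w0_conj[OF mn, of x] by auto
  then show "x \<in> conj_set (grpG m n) (w0 m n) K" unfolding conj_set_def using 2[OF x] by blast
qed

lemma conj_w0_TH:
  assumes mn: "1 \<le> m" "1 \<le> n"
  shows "conj_set (grpG m n) (w0 m n) (TH_std m n) = embH ` (Sp_torus (m-1) \<times> Sp_torus 1 \<times> Sp_torus (n-1))"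
proof (rule conj_w0_eqI[OF mn])
  show "TH_std m n \<subseteq> carrier (grpG m n)" using TH_std_closed[OF mn] by (simp add: mult_closed_def)
  show "embH ` (Sp_torus (m-1) \<times> Sp_torus 1 \<times> Sp_torus (n-1)) \<subseteq> carrier (grpG m n)"
    using mn by (auto simp: Sp_torus_def embH_G)
next
  fix x assume "x \<in> TH_std m n"
  then obtain a d where ad: "\<forall>l. a l \<noteq> 0" "\<forall>l. d l \<noteq> 0" "x = (Dmat m a, Dmat n d)" "a 0 = d 0"
    using TH_std_Dmat mn by blast
  have b: "Dmat k (\<lambda>l. c (pswap k l)) = diag2 (Dmat (k-1) (\<lambda>l. c (pswap k l))) (Dmat 1 (\<lambda>l. c 0))" if "1 \<le> k" for k and c :: "nat \<Rightarrow> complex"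
    unfolding diag2_Dmat[OF that] by (rule Dmat_cong) (use that in \<open>auto simp: pswap_def\<close>)
  have "(Wmat m * fst x * Wmat m, Wmat n * snd x * Wmat n) =
    embH (Dmat (m-1) (\<lambda>l. a (pswap m l)), Dmat 1 (\<lambda>l. a 0), Dmat (n-1) (\<lambda>l. d (pswap n l)))"
    unfolding ad(3) fst_conv snd_conv Wmat_Dmat[OF mn(1)] Wmat_Dmat[OF mn(2)]
    unfolding b[OF mn(1), of a] b[OF mn(2), of d] embH_def using ad(4) by simp
  then show "(Wmat m * fst x * Wmat m, Wmat n * snd x * Wmat n) \<in> embH ` (Sp_torus (m-1) \<times> Sp_torus 1 \<times> Sp_torus (n-1))"
    using ad by (simp add: Dmat_torus)
next
  fix x assume "x \<in> embH ` (Sp_torus (m-1) \<times> Sp_torus 1 \<times> Sp_torus (n-1))"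
  then obtain A S D where x: "x = embH (A, S, D)" "A \<in> Sp_torus (m-1)" "S \<in> Sp_torus 1" "D \<in> Sp_torus (n-1)" by auto
  obtain a where a: "\<forall>l. a l \<noteq> 0" "A = Dmat (m-1) a" using torus_Dmat[OF x(2)] by blast
  obtain s where s: "\<forall>l. s l \<noteq> 0" "S = Dmat 1 s" using torus_Dmat[OF x(3)] by blast
  obtain d where d: "\<forall>l. d l \<noteq> 0" "D = Dmat (n-1) d" using torus_Dmat[OF x(4)] by blast
  define a' d' where "a' = (\<lambda>l. if l < m-1 then a l else s 0)" and "d' = (\<lambda>l. if l < n-1 then d l else s 0)"
  have "x = (Dmat m a', Dmat n d')"
    unfolding x(1) embH_def a s d by (simp add: diag2_Dmat mn a'_def d'_def)
  then show "(Wmat m * fst x * Wmat m, Wmat n * snd x * Wmat n) \<in> TH_std m n"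
    using mn a s d by (simp add: Wmat_Dmat) (rule Dmat_TH_std, auto simp: a'_def d'_def pswap_def)
qed

lemma conj_w0_P:
  assumes mn: "1 \<le> m" "1 \<le> n"
  shows "conj_set (grpG m n) (w0 m n) (P_std m n) = embH ` (carrier (Sp (m-1)) \<times> Sp_borel_opp 1 \<times> carrier (Sp (n-1)))"
proof (rule conj_w0_eqI[OF mn])
  show "P_std m n \<subseteq> carrier (grpG m n)" using P_std_closed[OF mn] by (simp add: mult_closed_def)
  show KG: "embH ` (carrier (Sp (m-1)) \<times> Sp_borel_opp 1 \<times> carrier (Sp (n-1))) \<subseteq> carrier (grpG m n)"
    using mn by (auto simp: borel_opp1_iff embH_G)
next
  fix x assume "x \<in> P_std m n"
  then obtain a c where x: "x \<in> carrier (grpG m n)" "a \<noteq> 0" "par_cols (fst x) a c" "par_cols (snd x) a c"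
    by (auto simp: P_std_def)
  have dec: "\<exists>A\<in>carrier (Sp (k-1)). Wmat k * X * Wmat k = diag2 A (Smat a c)"
    if k: "1 \<le> k" and X: "X \<in> carrier (Sp k)" "par_cols X a c" for k X
  proof -
    note cX = Sp_carrier_mat[OF X(1)]
    have S: "Wmat k * X * Wmat k \<in> carrier (Sp k)" using X k by (intro Sp_mult_closed Wmat_Sp)
    have col: "colv (Wmat k * X * Wmat k) j i = (if i < 2*k then colv X (iswap k j) (iswap k i) else 0)" if "j < 2*k" for i j
    proof (cases "i < 2*k")
      case True
      show ?thesis unfolding colv_nth[OF Sp_carrier_mat[OF S] True] Wmat_conj_nth[OF k cX True that]
        using colv_nth[OF cX iswap_less[OF k True]] True by simp
    next
      case False
      then show ?thesis using colv_out[OF Sp_carrier_mat[OF S]] by simp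
    qed
    have n: "2*(k-1) < 2*k" "2*(k-1)+1 < 2*k" using k by linarith+
    have i0: "iswap k (2*(k-1)) = 0" "iswap k (2*(k-1)+1) = 1"
      using iswap_iswap[of k 0] iswap_iswap[of k 1] unfolding iswap_corner[OF k] .
    have u: "unitv 0 (iswap k i) = unitv (2*(k-1)) i" "unitv 1 (iswap k i) = unitv (2*(k-1)+1) i" for i
      unfolding unitv_iswap iswap_corner[OF k] by (rule refl)+
    have c0: "colv (Wmat k * X * Wmat k) (2*(k-1)) i = a * unitv (2*(k-1)) i + c * unitv (2*(k-1)+1) i"
      and c1: "colv (Wmat k * X * Wmat k) (2*(k-1)+1) i = (1/a) * unitv (2*(k-1)+1) i" for i
    proof -
      have "unitv (2*(k-1)) i = 0 \<and> unitv (2*(k-1)+1) i = 0" if "\<not> i < 2*k"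
        using that n by (auto simp: unitv_apply)
      then show "colv (Wmat k * X * Wmat k) (2*(k-1)) i = a * unitv (2*(k-1)) i + c * unitv (2*(k-1)+1) i"
        "colv (Wmat k * X * Wmat k) (2*(k-1)+1) i = (1/a) * unitv (2*(k-1)+1) i"
        unfolding col[OF n(1)] col[OF n(2)] i0 X(2)[unfolded par_cols_def, THEN conjunct1]
          X(2)[unfolded par_cols_def, THEN conjunct2] u by (cases "i < 2*k"; simp)+
    qed
    show ?thesis
    proof (rule block_decomp[OF S k x(2)])
      show "colv (Wmat k * X * Wmat k) (2*(k-1)) = (\<lambda>i. a * unitv (2*(k-1)) i + c * unitv (2*(k-1)+1) i)"
        "colv (Wmat k * X * Wmat k) (2*(k-1)+1) = (\<lambda>i. (1/a) * unitv (2*(k-1)+1) i)"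
        by (rule ext, rule c0, rule ext, rule c1)
    qed blast
  qed
  obtain A where A: "A \<in> carrier (Sp (m-1))" "Wmat m * fst x * Wmat m = diag2 A (Smat a c)"
    using dec[OF mn(1) _ x(3)] x(1) by (auto simp: grpG_carrier)
  obtain D where D: "D \<in> carrier (Sp (n-1))" "Wmat n * snd x * Wmat n = diag2 D (Smat a c)"
    using dec[OF mn(2) _ x(4)] x(1) by (auto simp: grpG_carrier)
  have "(Wmat m * fst x * Wmat m, Wmat n * snd x * Wmat n) = embH (A, Smat a c, D)"
    using A D by (simp add: embH_def)
  then show "(Wmat m * fst x * Wmat m, Wmat n * snd x * Wmat n) \<in>
      embH ` (carrier (Sp (m-1)) \<times> Sp_borel_opp 1 \<times> carrier (Sp (n-1)))"
    using A D Smat_borel_opp[OF x(2)] by simp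
next
  fix x assume "x \<in> embH ` (carrier (Sp (m-1)) \<times> Sp_borel_opp 1 \<times> carrier (Sp (n-1)))"
  then obtain A S D where x: "x = embH (A, S, D)" "A \<in> carrier (Sp (m-1))" "S \<in> Sp_borel_opp 1" "D \<in> carrier (Sp (n-1))" by auto
  obtain a c where ac: "a \<noteq> 0" "S = Smat a c" using borel_opp_Smat[OF x(3)] .
  have S1: "S \<in> carrier (Sp 1)" using x(3) by (simp add: borel_opp1_iff)
  have pc: "par_cols (Wmat k * diag2 B S * Wmat k) a c" and Spk: "Wmat k * diag2 B S * Wmat k \<in> carrier (Sp k)"
    if k: "1 \<le> k" and B: "B \<in> carrier (Sp (k-1))" for k B
  proof -
    have X: "diag2 B S \<in> carrier (Sp k)" by (rule diag2_Sp[OF B S1 k])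
    note cX = Sp_carrier_mat[OF X]
    show SS: "Wmat k * diag2 B S * Wmat k \<in> carrier (Sp k)" using X k by (intro Sp_mult_closed Wmat_Sp)
    have n: "0 < 2*k" "1 < 2*k" "2*(k-1) < 2*k" "2*(k-1)+1 < 2*k" using k by linarith+
    have nth: "colv (Wmat k * diag2 B S * Wmat k) j i =
        (if i < 2*k then diag2 B S $$ (iswap k i, iswap k j) else 0)" if "j < 2*k" for i j
    proof (cases "i < 2*k")
      case True
      show ?thesis unfolding colv_nth[OF Sp_carrier_mat[OF SS] True] Wmat_conj_nth[OF k cX True that]
        using True by simp
    next
      case False
      then show ?thesis using colv_out[OF Sp_carrier_mat[OF SS]] by simp
    qed
    have d: "diag2 B S $$ (i, 2*(k-1)) = a * unitv (2*(k-1)) i + c * unitv (2*(k-1)+1) i"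
      "diag2 B S $$ (i, 2*(k-1)+1) = (1/a) * unitv (2*(k-1)+1) i" if i: "i < 2*k" for i
    proof -
      have ii: "i < 2*(k-1) \<or> i = 2*(k-1) \<or> i = 2*(k-1) + 1" using i k by linarith
      have sn: "Smat a c $$ (0, Suc 0) = 0" "Smat a c $$ (Suc 0, 0) = c" "Smat a c $$ (Suc 0, Suc 0) = 1 / a"
        using Smat_nth by (simp_all add: One_nat_def)
      show "diag2 B S $$ (i, 2*(k-1)) = a * unitv (2*(k-1)) i + c * unitv (2*(k-1)+1) i"
        "diag2 B S $$ (i, 2*(k-1)+1) = (1/a) * unitv (2*(k-1)+1) i"
        unfolding ac(2) diag2_nth[OF Sp_carrier_mat[OF B] Smat_carrier k i n(3)] diag2_nth[OF Sp_carrier_mat[OF B] Smat_carrier k i n(4)]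
        using ii by (elim disjE; simp add: unitv_apply Smat_nth sn)+
    qed
    show "par_cols (Wmat k * diag2 B S * Wmat k) a c"
      unfolding par_cols_def
    proof (intro conjI ext)
      have i0: "iswap k (2*(k-1)) = 0" "iswap k (2*(k-1)+1) = 1"
        using iswap_iswap[of k 0] iswap_iswap[of k 1] unfolding iswap_corner[OF k] .
      fix i
      have u: "unitv (2*(k-1)) (iswap k i) = unitv 0 i" "unitv (2*(k-1)+1) (iswap k i) = unitv 1 i"
        unfolding unitv_iswap i0 by (rule refl)+
      have z: "unitv 0 i = 0" "unitv 1 i = 0" if "\<not> i < 2*k" using that n by (auto simp: unitv_apply)
      show "colv (Wmat k * diag2 B S * Wmat k) 0 i = a * unitv 0 i + c * unitv 1 i"
        "colv (Wmat k * diag2 B S * Wmat k) 1 i = (1/a) * unitv 1 i"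
        unfolding nth[OF n(1)] nth[OF n(2)] iswap_corner[OF k]
        using d[OF iswap_less[OF k], of i] z u by (cases "i < 2*k"; simp)+
    qed
  qed
  show "(Wmat m * fst x * Wmat m, Wmat n * snd x * Wmat n) \<in> P_std m n"
    by (rule P_stdI[of _ _ _ a c])
       (use pc[OF mn(1) x(2)] pc[OF mn(2) x(4)] Spk[OF mn(1) x(2)] Spk[OF mn(2) x(4)] ac(1) in
         \<open>simp_all add: x(1) embH_def grpG_carrier\<close>)
qed

section \<open>The parabolic subgroup and the theorem\<close>

lemma C_eps_diag2:
  assumes A: "A \<in> carrier_mat (2*(k-1)) (2*(k-1))" and S: "S \<in> carrier_mat 2 2" and k: "1 \<le> k"
  shows "i \<in> {1..k-1} \<Longrightarrow> C_eps i (diag2 A S) = A $$ (2*(i-1), 2*(i-1))" "C_eps k (diag2 A S) = S $$ (0,0)"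
proof -
  assume i: "i \<in> {1..k-1}"
  then have l: "2*(i-1) < 2*k" "2*(i-1) < 2*(k-1)" by auto
  show "C_eps i (diag2 A S) = A $$ (2*(i-1), 2*(i-1))"
    unfolding C_eps_def diag2_nth[OF A S k l(1) l(1)] using l(2) by simp
next
  have l: "2*(k-1) < 2*k" using k by linarith
  show "C_eps k (diag2 A S) = S $$ (0,0)"
    unfolding C_eps_def diag2_nth[OF A S k l l] by simp
qed

lemma scalar_commute:
  assumes c: "c^2 = (1::complex)" and a: "\<forall>l<k. a l = c" and A: "A \<in> carrier_mat (2*k) (2*k)"
  shows "A * Dmat k a = Dmat k a * A"
proof (rule eq_matI)
  fix i j assume "i < dim_row (Dmat k a * A)" "j < dim_col (Dmat k a * A)"
  then have ij: "i < 2*k" "j < 2*k" using A by (simp_all add: Dmat_def)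
  have "c * c = 1" using c by (simp add: power2_eq_square)
  then have "1 / c = c" by (cases "c = 0") (simp_all add: divide_eq_eq)
  then have d: "diag_entry a i = c" if "i < 2*k" for i
    using a that by (auto simp: diag_entry_def)
  show "(A * Dmat k a) $$ (i,j) = (Dmat k a * A) $$ (i,j)"
    unfolding mult_Dmat_nth[OF A ij] Dmat_mult_nth[OF A ij] d[OF ij(1)] d[OF ij(2)] by simp
qed (use A in \<open>auto simp: Dmat_def\<close>)

text \<open>The simple roots \<open>\<epsilon>\<^sub>i - \<epsilon>\<^sub>i\<^sub>+\<^sub>1\<close> force equal coordinates, and \<open>2\<epsilon>\<^sub>k\<^sub>-\<^sub>1\<close> forces the sign.\<close>

lemma roots_trivial_scalar:
  assumes nz: "\<forall>l. a l \<noteq> (0::complex)"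
    and S: "S \<in> carrier_mat 2 2" and k: "1 \<le> k"
    and root: "\<And>i. i \<in> {1..k-1} \<Longrightarrow> C_simple_root (k-1) i (diag2 (Dmat (k-1) a) S) = 1"
  shows "\<exists>c. c^2 = 1 \<and> (\<forall>l<k-1. a l = c)"
proof (cases "k = 1")
  case True
  then show ?thesis by (auto intro!: exI[of _ 1])
next
  case False
  then have k2: "k \<ge> 2" using k by linarith
  have e: "C_eps i (diag2 (Dmat (k-1) a) S) = a (i-1)" if "i \<in> {1..k-1}" for i
  proof -
    have l: "2*(i-1) < 2*(k-1)" using that by auto
    show ?thesis unfolding C_eps_diag2(1)[OF Dmat_carrier S k that] Dmat_nth[OF l l] by (simp add: diag_entry_def)
  qed
  have last: "a (k-2) ^ 2 = 1"
  proof -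
    have "k - 1 \<in> {1..k-1}" using k2 by auto
    moreover have "k - 1 - 1 = k - 2" by simp
    ultimately show ?thesis using root[of "k-1"] e[of "k-1"] by (simp add: C_simple_root_def)
  qed
  have step: "a l = a (Suc l)" if "Suc l < k - 1" for l
  proof -
    have "Suc l \<in> {1..k-1}" "Suc (Suc l) \<in> {1..k-1}" using that by auto
    then show ?thesis using root[of "Suc l"] e[of "Suc l"] e[of "Suc (Suc l)"] that nz
      by (simp add: C_simple_root_def)
  qed
  have "a (k - 2 - d) = a (k-2)" if "d \<le> k - 2" for d
    using that
  proof (induction d)
    case (Suc d)
    have s: "Suc (k - 2 - Suc d) = k - 2 - d" using Suc.prems by arith
    have "a (k - 2 - Suc d) = a (k - 2 - d)" using step[of "k - 2 - Suc d"] Suc.prems s by simp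
    then show ?case using Suc by simp
  qed simp
  note const = this
  have "a l = a (k-2)" if "l < k - 1" for l
  proof -
    have "k - 2 - (k - 2 - l) = l" "k - 2 - l \<le> k - 2" using that by arith+
    then show ?thesis using const[of "k - 2 - l"] by simp
  qed
  then show ?thesis using last by blast
qed

lemma C_simple_root_one:
  assumes k: "1 \<le> k" and S: "S \<in> carrier_mat 2 2" and i: "i \<in> {1..k-1}"
  shows "C_simple_root (k-1) i (diag2 (1\<^sub>m (2*(k-1))) S) = 1"
proof -
  have e: "C_eps i (diag2 (1\<^sub>m (2*(k-1))) S) = 1" if "i \<in> {1..k-1}" for i
    unfolding C_eps_diag2(1)[OF one_carrier_mat S k that] using that by auto
  show ?thesis using e[OF i] e[of "Suc i"] i by (auto simp: C_simple_root_def)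
qed

locale H_setup =
  fixes m n :: nat and h :: "cmat \<times> cmat" and TH BHm :: "(cmat \<times> cmat) set"
  assumes m: "1 \<le> m" and n: "1 \<le> n" and h: "h \<in> setH m n"
    and TH: "TH = conj_set (grpG m n) h (embH ` (Sp_torus (m-1) \<times> Sp_torus 1 \<times> Sp_torus (n-1)))"
    and BHm: "BHm = conj_set (grpG m n) h
             (embH ` (Sp_borel_opp (m-1) \<times> Sp_borel_opp 1 \<times> Sp_borel_opp (n-1)))"
begin

sublocale G: group "grpG m n" by (rule grpG_group)

lemma hG: "h \<in> carrier (grpG m n)"
  using h setH_G[OF m n] by blast

lemma torus_H_G: "embH ` (Sp_torus (m-1) \<times> Sp_torus 1 \<times> Sp_torus (n-1)) \<subseteq> carrier (grpG m n)"
  using m n by (auto simp: Sp_torus_def embH_G)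

lemma transport_conj:
  assumes "t \<in> embH ` (Sp_torus (m-1) \<times> Sp_torus 1 \<times> Sp_torus (n-1))"
  shows "push m n h t \<in> TH"
    "transport m n h TH \<chi> (push m n h t) = \<chi> t"
proof -
  show 1: "push m n h t \<in> TH"
    unfolding TH conj_set_def using assms by blast
  have "t \<in> carrier (grpG m n)" using assms torus_H_G by blast
  then show "transport m n h TH \<chi> (push m n h t) = \<chi> t"
    unfolding transport_def using 1 G.unconj[OF hG] by simp
qed

text \<open>An element of the torus of \<open>SL(2)\<close>: all simple roots but \<open>\<beta>'\<^sub>1\<close> are trivial on it, while its
centralizer in \<open>SL(2)\<close> is the torus.\<close>

definition test_elem where
  "test_elem = embH (1\<^sub>m (2*(m-1)), Smat 2 0, 1\<^sub>m (2*(n-1)))"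

lemma one_torus: "1\<^sub>m (2*k) \<in> Sp_torus k"
  by (simp add: Sp_torus_def Sp_one_closed diagonal_mat_def)

lemma Smat_torus: "a \<noteq> 0 \<Longrightarrow> Smat a 0 \<in> Sp_torus 1"
proof -
  assume a: "a \<noteq> 0"
  have "diagonal_mat (Smat a 0)" unfolding diagonal_mat_def
  proof (intro allI impI)
    fix i j assume "i < dim_row (Smat a 0)" "j < dim_col (Smat a 0)" "i \<noteq> j"
    then have "(i = 0 \<and> j = 1) \<or> (i = 1 \<and> j = 0)" by (auto simp: Smat_def)
    then show "Smat a 0 $$ (i,j) = 0" by (elim disjE conjE) (simp_all add: Smat_nth)
  qed
  then show ?thesis using Smat_borel_opp[OF a, of 0] by (simp add: Sp_torus_def borel_opp1_iff)
qed

lemma test_elem_torus: "test_elem \<in> embH ` (Sp_torus (m-1) \<times> Sp_torus 1 \<times> Sp_torus (n-1))"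
  unfolding test_elem_def using one_torus Smat_torus[of 2] by (intro imageI) simp

lemma roots_test_elem:
  "i \<in> {1..m-1} \<Longrightarrow> C_simple_root (m-1) i (fst test_elem) = 1"
  "i \<in> {1..n-1} \<Longrightarrow> C_simple_root (n-1) i (snd test_elem) = 1"
  by (simp_all add: test_elem_def embH_def C_simple_root_one m n Smat_carrier)

lemma beta_test_elem: "(C_eps m (fst test_elem))^2 = 4"
  by (simp add: test_elem_def embH_def C_eps_diag2(2)[OF one_carrier_mat Smat_carrier m] Smat_nth)

text \<open>Simple roots are compared as functions on the torus; that \<open>\<beta>'\<^sub>1\<close> differs from the others is needed to know
that these remain after its removal.\<close>

lemma not_beta:
  "i \<in> {1..m-1} \<Longrightarrow> transport m n h TH (\<lambda>t. C_simple_root (m-1) i (fst t)) \<noteq> beta m n h TH"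
  "i \<in> {1..n-1} \<Longrightarrow> transport m n h TH (\<lambda>t. C_simple_root (n-1) i (snd t)) \<noteq> beta m n h TH"
proof -
  note tr = transport_conj(2)[OF test_elem_torus]
  let ?t = "push m n h test_elem"
  have b: "beta m n h TH ?t = 4" unfolding beta_def tr by (rule beta_test_elem)
  show "transport m n h TH (\<lambda>t. C_simple_root (m-1) i (fst t)) \<noteq> beta m n h TH" if "i \<in> {1..m-1}"
  proof
    assume "transport m n h TH (\<lambda>t. C_simple_root (m-1) i (fst t)) = beta m n h TH"
    then have "C_simple_root (m-1) i (fst test_elem) = 4" using b tr by metis
    then show False using roots_test_elem(1)[OF that] by simp
  qed
  show "transport m n h TH (\<lambda>t. C_simple_root (n-1) i (snd t)) \<noteq> beta m n h TH" if "i \<in> {1..n-1}"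
  proof
    assume "transport m n h TH (\<lambda>t. C_simple_root (n-1) i (snd t)) = beta m n h TH"
    then have "C_simple_root (n-1) i (snd test_elem) = 4" using b tr by metis
    then show False using roots_test_elem(2)[OF that] by simp
  qed
qed

text \<open>On the common kernel of the simple roots other than \<open>\<beta>'\<^sub>1\<close> the blocks in \<open>Sp(2m - 2)\<close> and \<open>Sp(2n - 2)\<close> are
scalar, so they impose no condition; the block in \<open>SL(2)\<close> runs through its torus.\<close>

lemma levi_eq:
  "levi (grpG m n) (setH m n) TH (simple_roots_H m n h TH - {beta m n h TH}) =
    conj_set (grpG m n) h (embH ` (carrier (Sp (m-1)) \<times> Sp_torus 1 \<times> carrier (Sp (n-1))))"
proof (intro equalityI subsetI)
  let ?G = "grpG m n" and ?J = "simple_roots_H m n h TH - {beta m n h TH}"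
  fix x assume "x \<in> levi ?G (setH m n) TH ?J"
  then have x: "x \<in> setH m n" and comm: "\<And>t. t \<in> TH \<Longrightarrow> \<forall>\<alpha>\<in>?J. \<alpha> t = 1 \<Longrightarrow> x \<otimes>\<^bsub>?G\<^esub> t = t \<otimes>\<^bsub>?G\<^esub> x"
    unfolding levi_def by blast+
  have xG: "x \<in> carrier ?G" using x setH_G[OF m n] by blast
  define y where "y = pull m n h x"
  have y: "y \<in> setH m n" unfolding y_def by (intro setH_mult setH_inv h x m n)
  have xy: "x = push m n h y" unfolding y_def using hG xG by (simp add: G.m_assoc G.cancel_left)
  have yG: "y \<in> carrier ?G" using y setH_G[OF m n] by blast
  obtain A S D where ASD: "y = embH (A, S, D)" "A \<in> carrier (Sp (m-1))" "S \<in> carrier (Sp 1)" "D \<in> carrier (Sp (n-1))"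
    using y by (auto simp: setH_def)
  let ?t = "push m n h test_elem"
  have tG: "test_elem \<in> carrier ?G" using test_elem_torus torus_H_G by blast
  have "\<alpha> ?t = 1" if "\<alpha> \<in> ?J" for \<alpha>
    using that roots_test_elem transport_conj(2)[OF test_elem_torus] unfolding simple_roots_H_def by auto
  then have "x \<otimes>\<^bsub>?G\<^esub> ?t = ?t \<otimes>\<^bsub>?G\<^esub> x" using comm transport_conj(1)[OF test_elem_torus] by blast
  then have "push m n h (y \<otimes>\<^bsub>?G\<^esub> test_elem) = push m n h (test_elem \<otimes>\<^bsub>?G\<^esub> y)"
    unfolding xy using G.conj_mult[OF hG yG tG] G.conj_mult[OF hG tG yG] by simp
  then have yt: "y \<otimes>\<^bsub>?G\<^esub> test_elem = test_elem \<otimes>\<^bsub>?G\<^esub> y"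
    using hG yG tG by simp
  have S2: "Smat 2 0 \<in> carrier (Sp 1)" using Smat_torus[of 2] by (simp add: Sp_torus_def)
  have one: "1\<^sub>m (2*(m-1)) \<in> carrier (Sp (m-1))" "1\<^sub>m (2*(n-1)) \<in> carrier (Sp (n-1))" by (rule Sp_one_closed)+
  have cS: "S \<in> carrier_mat 2 2" using Sp_carrier_mat[OF ASD(3)] by simp
  have "embH (A * 1\<^sub>m (2*(m-1)), S * Smat 2 0, D * 1\<^sub>m (2*(n-1))) = embH (1\<^sub>m (2*(m-1)) * A, Smat 2 0 * S, 1\<^sub>m (2*(n-1)) * D)"
    using yt unfolding ASD(1) test_elem_def
      embH_mult[OF ASD(2) one(1) ASD(3) S2 ASD(4) one(2)] embH_mult[OF one(1) ASD(2) S2 ASD(3) one(2) ASD(4)] .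
  then have SS: "S * Smat 2 0 = Smat 2 0 * S"
    by (rule embH_inj[where m = m])
      (use Sp_carrier_mat[OF ASD(2)] m mult_carrier_mat[OF cS Smat_carrier] mult_carrier_mat[OF Smat_carrier cS] in simp_all)
  have mat2: "(X * Y) $$ (i,j) = X $$ (i,0) * Y $$ (0,j) + X $$ (i,1) * Y $$ (1,j)"
    if "X \<in> carrier_mat 2 2" "Y \<in> carrier_mat 2 2" "i < 2" "j < 2" for X Y :: cmat and i j
  proof -
    have "{0..<2::nat} = {0,1}" by auto
    then show ?thesis using that by (simp add: scalar_prod_def)
  qed
  have "S $$ (0,1) = 0" "S $$ (1,0) = 0"
    using arg_cong[OF SS, of "\<lambda>M. M $$ (0,1)"] arg_cong[OF SS, of "\<lambda>M. M $$ (1,0)"]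
    by (simp_all add: mat2[OF cS Smat_carrier] mat2[OF Smat_carrier cS] Smat_nth del: index_mult_mat(1))
  note off = this
  have "diagonal_mat S" unfolding diagonal_mat_def
  proof (intro allI impI)
    fix i j assume "i < dim_row S" "j < dim_col S" "i \<noteq> j"
    then have "(i = 0 \<and> j = 1) \<or> (i = 1 \<and> j = 0)" using cS by auto
    then show "S $$ (i,j) = 0" using off by auto
  qed
  then have "S \<in> Sp_torus 1" using ASD(3) by (simp add: Sp_torus_def)
  then show "x \<in> conj_set ?G h (embH ` (carrier (Sp (m-1)) \<times> Sp_torus 1 \<times> carrier (Sp (n-1))))"
    unfolding conj_set_def xy ASD(1) using ASD(2,4) by blast
next
  let ?G = "grpG m n" and ?J = "simple_roots_H m n h TH - {beta m n h TH}"
  fix x assume "x \<in> conj_set ?G h (embH ` (carrier (Sp (m-1)) \<times> Sp_torus 1 \<times> carrier (Sp (n-1))))"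
  then obtain A S D where x: "x = push m n h (embH (A, S, D))"
    and A: "A \<in> carrier (Sp (m-1))" and S: "S \<in> Sp_torus 1" and D: "D \<in> carrier (Sp (n-1))"
    unfolding conj_set_def by blast
  have S1: "S \<in> carrier (Sp 1)" using S by (simp add: Sp_torus_def)
  have eH: "embH (A, S, D) \<in> setH m n" unfolding setH_def using A S1 D by blast
  have eG: "embH (A, S, D) \<in> carrier ?G" using A S1 D m n by (rule embH_G)
  have "x \<otimes>\<^bsub>?G\<^esub> t = t \<otimes>\<^bsub>?G\<^esub> x" if t: "t \<in> TH" and J: "\<forall>\<alpha>\<in>?J. \<alpha> t = 1" for t
  proof -
    obtain A' S' D' where t': "t = push m n h (embH (A', S', D'))"
      and A': "A' \<in> Sp_torus (m-1)" and S': "S' \<in> Sp_torus 1" and D': "D' \<in> Sp_torus (n-1)"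
      using t unfolding TH conj_set_def by blast
    have e: "embH (A', S', D') \<in> embH ` (Sp_torus (m-1) \<times> Sp_torus 1 \<times> Sp_torus (n-1))"
      using A' S' D' by blast
    have S2: "S' \<in> carrier_mat 2 2" using Sp_carrier_mat[of S' 1] S' by (simp add: Sp_torus_def)
    have r1: "C_simple_root (m-1) i (diag2 A' S') = 1" if "i \<in> {1..m-1}" for i
    proof -
      have "transport m n h TH (\<lambda>t. C_simple_root (m-1) i (fst t)) \<in> ?J"
        using that not_beta(1)[OF that] unfolding simple_roots_H_def by blast
      then have "transport m n h TH (\<lambda>t. C_simple_root (m-1) i (fst t)) t = 1" using J by blast
      then show ?thesis unfolding t' transport_conj(2)[OF e] by (simp add: embH_def)
    qed
    have r2: "C_simple_root (n-1) i (diag2 D' S') = 1" if "i \<in> {1..n-1}" for i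
    proof -
      have "transport m n h TH (\<lambda>t. C_simple_root (n-1) i (snd t)) \<in> ?J"
        using that not_beta(2)[OF that] unfolding simple_roots_H_def by blast
      then have "transport m n h TH (\<lambda>t. C_simple_root (n-1) i (snd t)) t = 1" using J by blast
      then show ?thesis unfolding t' transport_conj(2)[OF e] by (simp add: embH_def)
    qed
    obtain a where a: "\<forall>l. a l \<noteq> 0" "A' = Dmat (m-1) a" using torus_Dmat[OF A'] by blast
    obtain d where d: "\<forall>l. d l \<noteq> 0" "D' = Dmat (n-1) d" using torus_Dmat[OF D'] by blast
    obtain s where s: "\<forall>l. s l \<noteq> 0" "S = Dmat 1 s" using torus_Dmat[OF S] by blast
    obtain s' where s': "\<forall>l. s' l \<noteq> 0" "S' = Dmat 1 s'" using torus_Dmat[OF S'] by blast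
    have cA: "A * A' = A' * A"
    proof -
      obtain c where "c^2 = 1" "\<forall>l<m-1. a l = c"
        using roots_trivial_scalar[OF a(1) S2 m] r1 a(2) by blast
      then show ?thesis unfolding a(2) using Sp_carrier_mat[OF A] by (rule scalar_commute)
    qed
    have cD: "D * D' = D' * D"
    proof -
      obtain c where "c^2 = 1" "\<forall>l<n-1. d l = c"
        using roots_trivial_scalar[OF d(1) S2 n] r2 d(2) by blast
      then show ?thesis unfolding d(2) using Sp_carrier_mat[OF D] by (rule scalar_commute)
    qed
    have cS: "S * S' = S' * S" unfolding s(2) s'(2) Dmat_Dmat by (simp add: mult.commute)
    have Sp': "A' \<in> carrier (Sp (m-1))" "S' \<in> carrier (Sp 1)" "D' \<in> carrier (Sp (n-1))"
      using A' S' D' by (simp_all add: Sp_torus_def)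
    have e'G: "embH (A', S', D') \<in> carrier ?G" using Sp' m n by (rule embH_G)
    have "embH (A, S, D) \<otimes>\<^bsub>?G\<^esub> embH (A', S', D') = embH (A', S', D') \<otimes>\<^bsub>?G\<^esub> embH (A, S, D)"
      unfolding embH_mult[OF A Sp'(1) S1 Sp'(2) D Sp'(3)] embH_mult[OF Sp'(1) A Sp'(2) S1 Sp'(3) D] cA cD cS ..
    then show ?thesis unfolding x t' G.conj_mult[OF hG eG e'G] G.conj_mult[OF hG e'G eG] by simp
  qed
  moreover have "x \<in> setH m n" unfolding x by (intro setH_mult setH_inv h eH m n)
  ultimately show "x \<in> levi ?G (setH m n) TH ?J" unfolding levi_def by blast
qed

lemma opp_carrier: "x \<in> Sp_borel_opp k \<Longrightarrow> x \<in> carrier (Sp k)"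
  by (simp add: Sp_borel_opp_def)

lemma one_opp: "1\<^sub>m (2*k) \<in> Sp_borel_opp k"
  by (auto simp: Sp_borel_opp_def Sp_one_closed)

lemma parabolic_eq:
  "parabolic (grpG m n) (setH m n) TH BHm (simple_roots_H m n h TH) {beta m n h TH} =
    conj_set (grpG m n) h (embH ` (carrier (Sp (m-1)) \<times> Sp_borel_opp 1 \<times> carrier (Sp (n-1))))"
  unfolding parabolic_def levi_eq BHm
proof (intro equalityI subsetI)
  let ?G = "grpG m n"
  fix x assume "x \<in> conj_set ?G h (embH ` (carrier (Sp (m-1)) \<times> Sp_torus 1 \<times> carrier (Sp (n-1)))) <#>\<^bsub>?G\<^esub>
    conj_set ?G h (embH ` (Sp_borel_opp (m-1) \<times> Sp_borel_opp 1 \<times> Sp_borel_opp (n-1)))"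
  then obtain u v where uv: "x = u \<otimes>\<^bsub>?G\<^esub> v"
    "u \<in> conj_set ?G h (embH ` (carrier (Sp (m-1)) \<times> Sp_torus 1 \<times> carrier (Sp (n-1))))"
    "v \<in> conj_set ?G h (embH ` (Sp_borel_opp (m-1) \<times> Sp_borel_opp 1 \<times> Sp_borel_opp (n-1)))"
    unfolding set_mult_def by blast
  obtain A S D where u: "u = push m n h (embH (A, S, D))"
    "A \<in> carrier (Sp (m-1))" "S \<in> Sp_torus 1" "D \<in> carrier (Sp (n-1))"
    using uv(2) unfolding conj_set_def by blast
  obtain A' S' D' where v: "v = push m n h (embH (A', S', D'))"
    "A' \<in> Sp_borel_opp (m-1)" "S' \<in> Sp_borel_opp 1" "D' \<in> Sp_borel_opp (n-1)"
    using uv(3) unfolding conj_set_def by blast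
  note x = uv(1)[unfolded u(1) v(1)] and 1 = u(2-4) v(2-4)
  have S1: "S \<in> carrier (Sp 1)" using 1(2) by (simp add: Sp_torus_def)
  have 2: "A' \<in> carrier (Sp (m-1))" "S' \<in> carrier (Sp 1)" "D' \<in> carrier (Sp (n-1))"
    using 1(4-6) by (simp_all add: opp_carrier)
  obtain s where s: "\<forall>l. s l \<noteq> 0" "S = Dmat 1 s" using torus_Dmat[OF 1(2)] by blast
  have "(S * S') $$ (0,1) = 0"
    unfolding s(2) using Dmat_mult_nth[OF Sp_carrier_mat[OF 2(2)], of 0 1 s] 1(5) by (simp add: borel_opp1_iff del: index_mult_mat(1))
  then have SS: "S * S' \<in> Sp_borel_opp 1" using S1 2(2) by (simp add: borel_opp1_iff Sp_mult_closed del: index_mult_mat(1))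
  have "x = push m n h (embH (A * A', S * S', D * D'))"
    unfolding x G.conj_mult[OF hG embH_G[OF 1(1) S1 1(3) m n] embH_G[OF 2 m n]]
      embH_mult[OF 1(1) 2(1) S1 2(2) 1(3) 2(3)] ..
  then show "x \<in> conj_set ?G h (embH ` (carrier (Sp (m-1)) \<times> Sp_borel_opp 1 \<times> carrier (Sp (n-1))))"
    unfolding conj_set_def using SS Sp_mult_closed[OF 1(1) 2(1)] Sp_mult_closed[OF 1(3) 2(3)] by blast
next
  let ?G = "grpG m n"
  fix x assume "x \<in> conj_set ?G h (embH ` (carrier (Sp (m-1)) \<times> Sp_borel_opp 1 \<times> carrier (Sp (n-1))))"
  then obtain A S D where x: "x = push m n h (embH (A, S, D))"
    and 1: "A \<in> carrier (Sp (m-1))" "S \<in> Sp_borel_opp 1" "D \<in> carrier (Sp (n-1))"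
    unfolding conj_set_def by blast
  have one: "1\<^sub>m (2*k) \<in> carrier (Sp k)" for k by (rule Sp_one_closed)
  note S1 = opp_carrier[OF 1(2)]
  have "embH (A, S, D) = embH (A, 1\<^sub>m (2*1), D) \<otimes>\<^bsub>?G\<^esub> embH (1\<^sub>m (2*(m-1)), S, 1\<^sub>m (2*(n-1)))"
    unfolding embH_mult[OF 1(1) one one S1 1(3) one]
    using Sp_carrier_mat[OF 1(1)] Sp_carrier_mat[OF S1] Sp_carrier_mat[OF 1(3)] by simp
  then have "x = (h \<otimes>\<^bsub>?G\<^esub> embH (A, 1\<^sub>m (2*1), D) \<otimes>\<^bsub>?G\<^esub> inv\<^bsub>?G\<^esub> h) \<otimes>\<^bsub>?G\<^esub>
      (h \<otimes>\<^bsub>?G\<^esub> embH (1\<^sub>m (2*(m-1)), S, 1\<^sub>m (2*(n-1))) \<otimes>\<^bsub>?G\<^esub> inv\<^bsub>?G\<^esub> h)"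
    unfolding x G.conj_mult[OF hG embH_G[OF 1(1) one 1(3) m n] embH_G[OF one S1 one m n]] by simp
  moreover have "h \<otimes>\<^bsub>?G\<^esub> embH (A, 1\<^sub>m (2*1), D) \<otimes>\<^bsub>?G\<^esub> inv\<^bsub>?G\<^esub> h \<in>
      conj_set ?G h (embH ` (carrier (Sp (m-1)) \<times> Sp_torus 1 \<times> carrier (Sp (n-1))))"
    unfolding conj_set_def using 1 one_torus[of 1] by (intro imageI SigmaI) simp_all
  moreover have "h \<otimes>\<^bsub>?G\<^esub> embH (1\<^sub>m (2*(m-1)), S, 1\<^sub>m (2*(n-1))) \<otimes>\<^bsub>?G\<^esub> inv\<^bsub>?G\<^esub> h \<in>
      conj_set ?G h (embH ` (Sp_borel_opp (m-1) \<times> Sp_borel_opp 1 \<times> Sp_borel_opp (n-1)))"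
    unfolding conj_set_def using 1 one_opp by (intro imageI SigmaI)
  ultimately show "x \<in> conj_set ?G h (embH ` (carrier (Sp (m-1)) \<times> Sp_torus 1 \<times> carrier (Sp (n-1)))) <#>\<^bsub>?G\<^esub>
    conj_set ?G h (embH ` (Sp_borel_opp (m-1) \<times> Sp_borel_opp 1 \<times> Sp_borel_opp (n-1)))"
    unfolding set_mult_def by blast
qed

lemma conj_conj:
  assumes "w \<in> carrier (grpG m n)" "K \<subseteq> carrier (grpG m n)"
  shows "conj_set (grpG m n) h (conj_set (grpG m n) w K) = conj_set (grpG m n) (h \<otimes>\<^bsub>grpG m n\<^esub> w) K"
proof -
  have "push m n h (w \<otimes>\<^bsub>grpG m n\<^esub> s \<otimes>\<^bsub>grpG m n\<^esub> inv\<^bsub>grpG m n\<^esub> w) =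
     (h \<otimes>\<^bsub>grpG m n\<^esub> w) \<otimes>\<^bsub>grpG m n\<^esub> s \<otimes>\<^bsub>grpG m n\<^esub> inv\<^bsub>grpG m n\<^esub> (h \<otimes>\<^bsub>grpG m n\<^esub> w)" if "s \<in> K" for s
    using assms that hG by (auto simp: G.m_assoc G.inv_mult_group)
  then show ?thesis unfolding conj_set_def image_image by (intro image_cong) auto
qed

text \<open>The conjugating element that takes the standard torus and parabolic subgroup, with \<open>SL(2)\<close> at the first
plane, to the given ones.\<close>

definition h' where "h' = h \<otimes>\<^bsub>grpG m n\<^esub> w0 m n"

lemma h'G: "h' \<in> carrier (grpG m n)"
  unfolding h'_def using hG w0_G[OF m n] by simp

lemma TH_h': "TH = conj_set (grpG m n) h' (TH_std m n)"
  unfolding TH conj_w0_TH[OF m n, symmetric] h'_def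
  using conj_conj[OF w0_G[OF m n]] TH_std_closed[OF m n] by (simp add: mult_closed_def)

lemma P_h': "parabolic (grpG m n) (setH m n) TH BHm (simple_roots_H m n h TH) {beta m n h TH} =
    conj_set (grpG m n) h' (P_std m n)"
  unfolding parabolic_eq conj_w0_P[OF m n, symmetric] h'_def
  using conj_conj[OF w0_G[OF m n]] P_std_closed[OF m n] by (simp add: mult_closed_def)

lemma varpi_h': "varpi m n h TH =
   (\<lambda>t\<in>TH. fst (pull m n h' t) $$ (0,0))"
  unfolding varpi_def transport_def
proof (rule restrict_ext)
  let ?G = "grpG m n"
  fix t assume "t \<in> TH"
  then obtain s where s: "s \<in> TH_std m n" "t = push m n h' s"
    unfolding TH_h' conj_set_def by blast
  have sG: "s \<in> carrier ?G" using s TH_std_closed[OF m n] by (auto simp: mult_closed_def)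
  note wG = w0_G[OF m n]
  have "pull m n h t = w0 m n \<otimes>\<^bsub>?G\<^esub> s \<otimes>\<^bsub>?G\<^esub> inv\<^bsub>?G\<^esub> w0 m n"
    unfolding s(2) h'_def using hG wG sG by (simp add: G.m_assoc G.inv_mult_group G.cancel_left)
  then have e: "fst (pull m n h t) = Wmat m * fst s * Wmat m"
    unfolding w0_conj[OF m n] by simp
  have l: "2*(m-1) < 2*m" using m by linarith
  have i: "iswap m (2*(m-1)) = 0" using iswap_iswap[of m 0] unfolding iswap_corner[OF m] .
  show "C_eps m (fst (pull m n h t)) = fst (pull m n h' t) $$ (0,0)"
    unfolding e C_eps_def Wmat_conj_nth[OF m grpG_carrier_mat(1)[OF sG] l l] i
    unfolding s(2) G.unconj[OF h'G sG] ..
qed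

end

theorem mainTheorem10:
  fixes m n :: nat and g h :: "cmat \<times> cmat"
    and T B TH BH BHm P :: "(cmat \<times> cmat) set"
  assumes "m \<ge> 1" and "n \<ge> 1" and "max m n > 1"
    and "borel_pair_G m n g T B"
    and "borel_triple_H m n h TH BH BHm"
    and "TH \<subseteq> T" and "BH \<subseteq> B"
    and "P = parabolic (grpG m n) (setH m n) TH BHm (simple_roots_H m n h TH) {beta m n h TH}"
  shows "freely_generated (char_group m n T \<times>\<times> char_group m n TH)
    (ext_weight_monoid m n T B TH P)
    ([(omega1 m n g T 1 \<otimes>\<^bsub>char_group m n T\<^esub> omega2 m n g T 1, \<one>\<^bsub>char_group m n TH\<^esub>),
      (omega1 m n g T 1, inv\<^bsub>char_group m n TH\<^esub> varpi m n h TH),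
      (omega2 m n g T 1, inv\<^bsub>char_group m n TH\<^esub> varpi m n h TH)]
     @ (if m > 1 then [(omega1 m n g T 2, \<one>\<^bsub>char_group m n TH\<^esub>)] else [])
     @ (if n > 1 then [(omega2 m n g T 2, \<one>\<^bsub>char_group m n TH\<^esub>)] else []))"
proof -
  interpret H: H_setup m n h TH BHm
    using assms(1,2,5) by unfold_locales (simp_all add: borel_triple_H_def)
  interpret S: standard_setup m n g H.h' T B TH P
  proof
    show "1 \<le> m" "1 \<le> n" by (rule assms)+
    show "g \<in> carrier (grpG m n)" "T = conj_set (grpG m n) g (T_std m n)" "B = conj_set (grpG m n) g (B_std m n)"
      using assms(4) by (simp_all add: borel_pair_G_def T_std_def B_std_def)
    show "H.h' \<in> carrier (grpG m n)" by (rule H.h'G)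
    show "TH = conj_set (grpG m n) H.h' (TH_std m n)" by (rule H.TH_h')
    show "P = conj_set (grpG m n) H.h' (P_std m n)" using assms(8) H.P_h' by simp
  qed
  let ?G = "grpG m n"
  have w: "C_fund_weight 1 A = A $$ (0,0)" "C_fund_weight 2 A = A $$ (0,0) * A $$ (2,2)" for A
  proof -
    have "{1..2::nat} = {1,2}" by auto
    then show "C_fund_weight 1 A = A $$ (0,0)" "C_fund_weight 2 A = A $$ (0,0) * A $$ (2,2)"
      by (simp_all add: C_fund_weight_def C_eps_def)
  qed
  have inv: "inv\<^bsub>char_group m n TH\<^esub> varpi m n h TH =
      (\<lambda>t\<in>TH. ch_std 1 (pull m n H.h' t))" (is "_ = ?y")
  proof -
    interpret C: comm_monoid "char_group m n TH" by (rule char_group_comm_monoid[OF S.T_closed(2)])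
    interpret K: exponent_tuple m n 0 1 0 0 0 using S.m S.n by unfold_locales auto
    have y: "?y \<in> carrier (char_group m n TH)"
      using S.weight_pair_carrier[of 0 0 0 1 0] by (simp add: weight_pair_def DirProd_def)
    have "char_on m n (TH_std m n) (om_std 0 1 0 0 0)"
    proof (rule char_on_subset[OF K.om_char_on])
      show "TH_std m n \<subseteq> B_std m n" using T_std_B_std[of m n] by (auto simp: TH_std_def)
    qed
    then have "(\<lambda>t\<in>TH. om_std 0 1 0 0 0 (pull m n H.h' t)) \<in> characters m n TH"
      unfolding H.TH_h' by (rule char_conj[OF S.h TH_std_closed[OF S.m S.n]])
    then have x: "varpi m n h TH \<in> carrier (char_group m n TH)"
      unfolding H.varpi_h' by (simp add: om_std_def char_group_def)
    have "fst (pull m n H.h' t) $$ (0,0) * ch_std 1 (pull m n H.h' t) = 1"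
      if t: "t \<in> TH" for t
    proof -
      have std: "pull m n H.h' t \<in> TH_std m n"
        by (rule conj_set_elem(1)[OF S.h S.std_subset(3)]) (use t H.TH_h' in blast)
      obtain a d where "\<forall>l. a l \<noteq> 0" "\<forall>l. d l \<noteq> 0" "a 0 = d 0"
        "pull m n H.h' t = (Dmat m a, Dmat n d)"
        by (rule TH_std_Dmat[OF std S.m S.n])
      then show ?thesis using S.m by (simp add: ch_std_def Dmat_corner)
    qed
    then have "(\<lambda>t\<in>TH. varpi m n h TH t * ?y t) = (\<lambda>t\<in>TH. 1)"
      unfolding H.varpi_h' by (intro restrict_ext) simp
    then have xy: "varpi m n h TH \<otimes>\<^bsub>char_group m n TH\<^esub> ?y = \<one>\<^bsub>char_group m n TH\<^esub>"
      by (simp only: char_group_def monoid.select_convs)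
    then have "?y \<otimes>\<^bsub>char_group m n TH\<^esub> varpi m n h TH = \<one>\<^bsub>char_group m n TH\<^esub>"
      using C.m_comm[OF x y] by simp
    then show ?thesis using C.inv_unique'[OF x y xy] by simp
  qed
  have one: "\<one>\<^bsub>char_group m n TH\<^esub> = (\<lambda>t\<in>TH. 1)" by (simp add: char_group_def)
  have mul: "omega1 m n g T 1 \<otimes>\<^bsub>char_group m n T\<^esub> omega2 m n g T 1 =
      (\<lambda>t\<in>T. om_std 1 0 0 0 0 (pull m n g t))"
  proof -
    have "(\<lambda>t\<in>T. omega1 m n g T 1 t * omega2 m n g T 1 t) =
        (\<lambda>t\<in>T. om_std 1 0 0 0 0 (pull m n g t))"
      by (rule restrict_ext) (simp add: omega1_def omega2_def transport_def w om_std_def)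
    then show ?thesis by (simp only: char_group_def monoid.select_convs)
  qed
  have om: "omega1 m n g T 1 = (\<lambda>t\<in>T. om_std 0 1 0 0 0 (pull m n g t))"
    "omega2 m n g T 1 = (\<lambda>t\<in>T. om_std 0 0 1 0 0 (pull m n g t))"
    "omega1 m n g T 2 = (\<lambda>t\<in>T. om_std 0 0 0 1 0 (pull m n g t))"
    "omega2 m n g T 2 = (\<lambda>t\<in>T. om_std 0 0 0 0 1 (pull m n g t))"
    by (simp_all add: omega1_def omega2_def transport_def w om_std_def)
  have ch0: "(\<lambda>t\<in>TH. ch_std 0 (pull m n H.h' t)) = (\<lambda>t\<in>TH. 1)"
    by (simp add: ch_std_def)
  show ?thesis
    using S.freely_generated_generator_list unfolding mul unfolding om inv one generator_list_def weight_pair_def add_0 add_0_right ch0 .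
qed

end
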